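(* Let $\Bbbk$ be a field, let $T$ be an unmixed balanced tree, and let $R=\Bbbk[V_{even}]$. Then $\mathrm{type}(R/\mathcal{N}_{odd}(T))$ equals the number of minimal $V_3$-TD-sets of $T$.
   Context: $N(v)=\{u:uv\in E\}$, $N(D)=\bigcup_{v\in D}N(v)$, $X_U=\prod_{v\in U}v$. A leaf is a vertex of degree 1; height of a vertex = minimum distance to a leaf (isolated vertex: 0); $V_k$ = vertices of height $k$; $V_{even}$, $V_{odd}$ = vertices of even/odd height; $T$ balanced means no two adjacent vertices have equal height. A TD-set is $D$ with $N(D)=V$, minimal if no proper subset is; $T$ unmixed if all minimal TD-sets have the same size. $\mathcal{N}_{odd}(T)$ is the ideal of $R$ generated by $X_{N(v)}$, $v\in V_{odd}$ (these lie in $R$ since $T$ is balanced). A $V_3$-TD-set is $D\subseteq V$ with $N(D)\supseteq V_3$, minimal if no proper subset is one (if $V_3=\emptyset$ the only minimal one is $\emptyset$). $\mathrm{type}$ denotes Cohen–Macaulay type (socle dimension over $\Bbbk$ after factoring out a maximal regular sequence in the homogeneous maximal ideal). *)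

theory Defs
  imports Main "HOL-Library.Poly_Mapping"
begin

definition graph :: "'v set \<Rightarrow> ('v \<Rightarrow> 'v \<Rightarrow> bool) \<Rightarrow> bool" where
  "graph V E \<longleftrightarrow> finite V \<and> (\<forall>u v. E u v \<longrightarrow> u \<in> V \<and> v \<in> V)
      \<and> (\<forall>u v. E u v \<longrightarrow> E v u) \<and> (\<forall>v. \<not> E v v)"

fun walk :: "('v \<Rightarrow> 'v \<Rightarrow> bool) \<Rightarrow> 'v list \<Rightarrow> bool" where
  "walk E [] = False"
| "walk E [v] = True"
| "walk E (u # v # vs) = (E u v \<and> walk E (v # vs))"

definition connected_graph :: "'v set \<Rightarrow> ('v \<Rightarrow> 'v \<Rightarrow> bool) \<Rightarrow> bool" where
  "connected_graph V E \<longleftrightarrow> V \<noteq> {} \<and>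
     (\<forall>u\<in>V. \<forall>v\<in>V. \<exists>xs. walk E xs \<and> hd xs = u \<and> last xs = v)"

definition has_cycle :: "('v \<Rightarrow> 'v \<Rightarrow> bool) \<Rightarrow> bool" where
  "has_cycle E \<longleftrightarrow> (\<exists>xs. length xs \<ge> 3 \<and> distinct xs \<and> walk E xs \<and> E (last xs) (hd xs))"

definition tree :: "'v set \<Rightarrow> ('v \<Rightarrow> 'v \<Rightarrow> bool) \<Rightarrow> bool" where
  "tree V E \<longleftrightarrow> graph V E \<and> connected_graph V E \<and> \<not> has_cycle E"

definition nbhd :: "('v \<Rightarrow> 'v \<Rightarrow> bool) \<Rightarrow> 'v \<Rightarrow> 'v set" where
  "nbhd E v = {u. E u v}"

definition nbhd_set :: "('v \<Rightarrow> 'v \<Rightarrow> bool) \<Rightarrow> 'v set \<Rightarrow> 'v set" where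
  "nbhd_set E D = (\<Union>v\<in>D. nbhd E v)"

definition leaf :: "('v \<Rightarrow> 'v \<Rightarrow> bool) \<Rightarrow> 'v \<Rightarrow> bool" where
  "leaf E v \<longleftrightarrow> card (nbhd E v) = 1"

definition height :: "('v \<Rightarrow> 'v \<Rightarrow> bool) \<Rightarrow> 'v \<Rightarrow> nat" where
  "height E v = (if nbhd E v = {} then 0 else
     (LEAST k. \<exists>xs. walk E xs \<and> hd xs = v \<and> leaf E (last xs) \<and> length xs = k + 1))"

definition Vk :: "'v set \<Rightarrow> ('v \<Rightarrow> 'v \<Rightarrow> bool) \<Rightarrow> nat \<Rightarrow> 'v set" where
  "Vk V E k = {v \<in> V. height E v = k}"

definition V_even :: "'v set \<Rightarrow> ('v \<Rightarrow> 'v \<Rightarrow> bool) \<Rightarrow> 'v set" where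
  "V_even V E = {v \<in> V. even (height E v)}"

definition V_odd :: "'v set \<Rightarrow> ('v \<Rightarrow> 'v \<Rightarrow> bool) \<Rightarrow> 'v set" where
  "V_odd V E = {v \<in> V. odd (height E v)}"

definition balanced :: "'v set \<Rightarrow> ('v \<Rightarrow> 'v \<Rightarrow> bool) \<Rightarrow> bool" where
  "balanced V E \<longleftrightarrow> (\<forall>u\<in>V. \<forall>v\<in>V. E u v \<longrightarrow> height E u \<noteq> height E v)"

definition TD_set :: "'v set \<Rightarrow> ('v \<Rightarrow> 'v \<Rightarrow> bool) \<Rightarrow> 'v set \<Rightarrow> bool" where
  "TD_set V E D \<longleftrightarrow> D \<subseteq> V \<and> nbhd_set E D = V"

definition minimal_TD_set :: "'v set \<Rightarrow> ('v \<Rightarrow> 'v \<Rightarrow> bool) \<Rightarrow> 'v set \<Rightarrow> bool" where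
  "minimal_TD_set V E D \<longleftrightarrow> TD_set V E D \<and> (\<forall>D'. D' \<subset> D \<longrightarrow> \<not> TD_set V E D')"

definition unmixed :: "'v set \<Rightarrow> ('v \<Rightarrow> 'v \<Rightarrow> bool) \<Rightarrow> bool" where
  "unmixed V E \<longleftrightarrow> (\<forall>D D'. minimal_TD_set V E D \<longrightarrow> minimal_TD_set V E D' \<longrightarrow> card D = card D')"

definition V3_TD_set :: "'v set \<Rightarrow> ('v \<Rightarrow> 'v \<Rightarrow> bool) \<Rightarrow> 'v set \<Rightarrow> bool" where
  "V3_TD_set V E D \<longleftrightarrow> D \<subseteq> V \<and> Vk V E 3 \<subseteq> nbhd_set E D"

definition minimal_V3_TD_set :: "'v set \<Rightarrow> ('v \<Rightarrow> 'v \<Rightarrow> bool) \<Rightarrow> 'v set \<Rightarrow> bool" where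
  "minimal_V3_TD_set V E D \<longleftrightarrow> V3_TD_set V E D \<and> (\<forall>D'. D' \<subset> D \<longrightarrow> \<not> V3_TD_set V E D')"

type_synonym ('v, 'k) mpoly = "('v \<Rightarrow>\<^sub>0 nat) \<Rightarrow>\<^sub>0 'k"

definition poly_ring :: "'v set \<Rightarrow> ('v, 'k::comm_ring_1) mpoly set" where
  "poly_ring S = {p::('v, 'k) mpoly. \<forall>m \<in> Poly_Mapping.keys p. Poly_Mapping.keys m \<subseteq> S}"

definition Var :: "'v \<Rightarrow> ('v, 'k::comm_ring_1) mpoly" where
  "Var v = Poly_Mapping.single (Poly_Mapping.single v 1) 1"

definition Const :: "'k::comm_ring_1 \<Rightarrow> ('v, 'k) mpoly" where
  "Const c = Poly_Mapping.single 0 c"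

definition monomial_prod :: "'v set \<Rightarrow> ('v, 'k::comm_ring_1) mpoly" where
  "monomial_prod U = (\<Prod>u\<in>U. Var u)"

definition tdeg :: "('v \<Rightarrow>\<^sub>0 nat) \<Rightarrow> nat" where
  "tdeg m = (\<Sum>v\<in>Poly_Mapping.keys m. Poly_Mapping.lookup m v)"

definition homogeneous :: "('v, 'k::comm_ring_1) mpoly \<Rightarrow> bool" where
  "homogeneous p \<longleftrightarrow> (\<exists>d. \<forall>m\<in>Poly_Mapping.keys p. tdeg m = d)"

definition max_ideal :: "'v set \<Rightarrow> ('v, 'k::comm_ring_1) mpoly set" where
  "max_ideal S = {p \<in> poly_ring S. Poly_Mapping.lookup p 0 = 0}"

definition ideal_gen :: "'v set \<Rightarrow> ('v, 'k::comm_ring_1) mpoly set \<Rightarrow> ('v, 'k) mpoly set" where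
  "ideal_gen S G = {p. \<exists>rs gs. length rs = length gs \<and> set rs \<subseteq> poly_ring S \<and> set gs \<subseteq> G
                        \<and> p = (\<Sum>i<length gs. rs ! i * gs ! i)}"

definition colon :: "'v set \<Rightarrow> ('v, 'k::comm_ring_1) mpoly set \<Rightarrow> ('v, 'k) mpoly set \<Rightarrow> ('v, 'k) mpoly set" where
  "colon S J M = {f \<in> poly_ring S. \<forall>g\<in>M. f * g \<in> J}"

definition quot_dim :: "('v, 'k::field) mpoly set \<Rightarrow> ('v, 'k) mpoly set \<Rightarrow> nat" where
  "quot_dim A B = (LEAST n. \<exists>bs. length bs = n \<and> set bs \<subseteq> A \<and>
       (\<forall>a\<in>A. \<exists>c::nat \<Rightarrow> 'k. a - (\<Sum>i<n. Const (c i) * bs ! i) \<in> B))"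

definition hom_regular_seq :: "'v set \<Rightarrow> ('v, 'k::field) mpoly set \<Rightarrow> ('v, 'k) mpoly list \<Rightarrow> bool" where
  "hom_regular_seq S G \<theta> \<longleftrightarrow>
     set \<theta> \<subseteq> max_ideal S \<and> (\<forall>t\<in>set \<theta>. homogeneous t) \<and>
     ideal_gen S (G \<union> set \<theta>) \<noteq> poly_ring S \<and>
     (\<forall>i<length \<theta>. \<forall>f\<in>poly_ring S.
        f * \<theta> ! i \<in> ideal_gen S (G \<union> set (take i \<theta>)) \<longrightarrow> f \<in> ideal_gen S (G \<union> set (take i \<theta>)))"

definition maximal_hom_regular_seq :: "'v set \<Rightarrow> ('v, 'k::field) mpoly set \<Rightarrow> ('v, 'k) mpoly list \<Rightarrow> bool" where
  "maximal_hom_regular_seq S G \<theta> \<longleftrightarrow> hom_regular_seq S G \<theta> \<and>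
     (\<forall>t. \<not> hom_regular_seq S G (\<theta> @ [t]))"

text \<open>Cohen-Macaulay type of k[S]/(G): socle dimension of k[S]/(G + theta) for a
  maximal homogeneous regular sequence theta in the homogeneous maximal ideal
  (independent of the choice of theta).\<close>
definition cm_type :: "'v set \<Rightarrow> ('v, 'k::field) mpoly set \<Rightarrow> nat" where
  "cm_type S G = (THE t. \<forall>\<theta>. maximal_hom_regular_seq S G \<theta> \<longrightarrow>
      quot_dim (colon S (ideal_gen S (G \<union> set \<theta>)) (max_ideal S)) (ideal_gen S (G \<union> set \<theta>)) = t)"

definition N_odd_gens :: "'v set \<Rightarrow> ('v \<Rightarrow> 'v \<Rightarrow> bool) \<Rightarrow> ('v, 'k::comm_ring_1) mpoly set" where
  "N_odd_gens V E = (\<lambda>v. monomial_prod (nbhd E v)) ` V_odd V E"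

end

theory Submission
  imports Defs "HOL-Computational_Algebra.Primes" HOL.Vector_Spaces
begin

text \<open>
  Split total domination by parity of heights: the part of a minimal TD-set in even heights is a
  minimal transversal of the neighbourhoods of odd vertices, so unmixedness makes all these
  transversals equally large. Exchanging transversals branch by branch then shows that every even
  vertex lies in the neighbourhood of exactly one support vertex, that each such neighbourhood
  contains at most one non-leaf \<open>x\<^sub>a\<close>, and that the remaining odd vertices have height 3 and
  neighbourhoods consisting of such \<open>x\<^sub>a\<close>. Hence the ideal is the polarization of an Artinian
  monomial ideal generated by powers of the \<open>x\<^sub>a\<close> and the squarefree monomials of \<open>V\<^sub>3\<close>: the
  differences of the leaves with their \<open>x\<^sub>a\<close> form a regular sequence, and the socle of the quotient has
  a basis of monomials supported on the complements of the minimal \<open>V\<^sub>3\<close>-TD-sets. That every other maximal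
  homogeneous regular sequence gives the same socle dimension follows from an exchange argument
  based on graded prime avoidance.
\<close>

section \<open>Branches and heights in trees\<close>

text \<open>\<open>cm_type\<close> is a \<open>THE\<close> over all maximal homogeneous regular
  sequences, so computing one socle does not determine it: any other sequence has to be compared,
  over any field. This is why Noetherianity and associated primes occur in a proof about trees. The
  hinge is that a regular sequence is maximal exactly when the quotient by it has a nonzero socle.
  On the tree side the contradictions have one shape: forbid some even vertices so as to force
  chosen ones into a minimal transversal, then exchange parts and reach a smaller transversal.
  Forbidding is harmless because an odd vertex is never a leaf: it has two neighbours, and
  acyclicity lets at most one of them lie towards the forbidden set. Minimal TD-sets for height 3
  appear as the sets of variables with exponent zero. A socle monomial times a root variable must
  enter the ideal, either by completing the pure power, whose exponent is the size of the block, or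
  by completing a monomial from height 3 that lacked just this variable. As blocks have at least two
  elements, the two cases mean different exponents.\<close>

lemma walk_Cons: "xs \<noteq> [] \<Longrightarrow> walk E (u # xs) \<longleftrightarrow> E u (hd xs) \<and> walk E xs"
  by (cases xs) auto

lemma walk_append: "xs \<noteq> [] \<Longrightarrow> ys \<noteq> [] \<Longrightarrow>
    walk E (xs @ ys) \<longleftrightarrow> walk E xs \<and> E (last xs) (hd ys) \<and> walk E ys"
  by (induction E xs rule: walk.induct) (auto simp: walk_Cons)

definition off :: "('v \<Rightarrow> 'v \<Rightarrow> bool) \<Rightarrow> 'v \<Rightarrow> 'v \<Rightarrow> 'v \<Rightarrow> bool" where
  "off E c u v \<longleftrightarrow> E u v \<and> u \<noteq> c \<and> v \<noteq> c"

text \<open>The component of \<open>x\<close> after deleting \<open>v\<close>. Reflexivity of the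
  closure puts \<open>x\<close> into it even when \<open>x = v\<close>, hence the side condition
  \<open>x \<noteq> v\<close> in the lemmas below.\<close>

definition branch :: "('v \<Rightarrow> 'v \<Rightarrow> bool) \<Rightarrow> 'v \<Rightarrow> 'v \<Rightarrow> 'v set" where
  "branch E v x = {y. (off E v)\<^sup>*\<^sup>* x y}"

text \<open>Loop erasure: if the vertex to be prepended already occurs, the walk is cut back to that
  occurrence.\<close>

lemma off_path_distinct_walk:
  assumes "(off E c)\<^sup>*\<^sup>* p q" "p \<noteq> c"
  shows "\<exists>xs. walk E xs \<and> distinct xs \<and> hd xs = p \<and> last xs = q \<and> c \<notin> set xs"
  using assms
proof (induction rule: converse_rtranclp_induct)
  case base
  then show ?case by (intro exI[of _ "[q]"]) auto
next
  case (step p p1)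
  then obtain ys where ys: "walk E ys" "distinct ys" "hd ys = p1" "last ys = q" "c \<notin> set ys"
    by (auto simp: off_def)
  have ne: "ys \<noteq> []" using ys(1) by auto
  show ?case
  proof (cases "p \<in> set ys")
    case True
    then obtain as bs where s: "ys = as @ p # bs" by (meson split_list)
    have "walk E (p # bs)"
      using ys(1) s walk_append[of as "p # bs" E] by (cases "as = []") auto
    then show ?thesis using s ys by (intro exI[of _ "p # bs"]) auto
  next
    case False
    then show ?thesis using step ys ne
      by (intro exI[of _ "p # ys"]) (auto simp: walk_Cons off_def)
  qed
qed

locale tree_graph =
  fixes V :: "'v set" and E :: "'v \<Rightarrow> 'v \<Rightarrow> bool"
  assumes tree: "tree V E"
begin

lemma finite_V: "finite V" and E_in: "E u v \<Longrightarrow> u \<in> V \<and> v \<in> V"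
  and E_sym: "E u v \<Longrightarrow> E v u" and E_irrefl: "\<not> E v v"
  using tree unfolding tree_def graph_def by blast+

lemma mem_nbhd: "u \<in> nbhd E v \<longleftrightarrow> E v u"
  unfolding nbhd_def using E_sym by blast

lemma nbhd_subset: "nbhd E v \<subseteq> V"
  unfolding nbhd_def using E_in by blast

lemma finite_nbhd: "finite (nbhd E v)"
  using nbhd_subset finite_V finite_subset by blast

lemma leaf_unique: "leaf E l \<Longrightarrow> E l a \<Longrightarrow> E l b \<Longrightarrow> a = b"
  unfolding leaf_def by (metis card_1_singletonE mem_nbhd singletonD)

lemma leafI: "E l a \<Longrightarrow> (\<And>b. E l b \<Longrightarrow> b = a) \<Longrightarrow> leaf E l"
proof -
  assume "E l a" "\<And>b. E l b \<Longrightarrow> b = a"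
  then have "nbhd E l = {a}" unfolding set_eq_iff mem_nbhd by blast
  then show ?thesis by (simp add: leaf_def)
qed

text \<open>Two distinct neighbours of \<open>c\<close> joined by a path avoiding \<open>c\<close>
  would close up to a cycle through \<open>c\<close>. All uses of acyclicity pass through this
  lemma.\<close>

lemma off_path_unique:
  assumes "E c p" "E c q" "(off E c)\<^sup>*\<^sup>* p q"
  shows "p = q"
proof (rule ccontr)
  assume pq: "p \<noteq> q"
  have "p \<noteq> c" using assms(1) E_irrefl by auto
  then obtain xs where xs: "walk E xs" "distinct xs" "hd xs = p" "last xs = q" "c \<notin> set xs"
    using off_path_distinct_walk[OF assms(3)] by blast
  have "xs \<noteq> []" using xs(1) by auto
  moreover have "length xs \<ge> 2"
    using pq xs \<open>xs \<noteq> []\<close> by (cases xs; cases "tl xs") auto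
  ultimately have "has_cycle E" unfolding has_cycle_def
    using xs assms by (intro exI[of _ "c # xs"]) (auto simp: walk_Cons intro: E_sym)
  then show False using tree by (simp add: tree_def)
qed

lemma two_path_unique: "E a p \<Longrightarrow> E p b \<Longrightarrow> E a q \<Longrightarrow> E q b \<Longrightarrow> a \<noteq> b \<Longrightarrow> p = q"
proof -
  assume h: "E a p" "E p b" "E a q" "E q b" "a \<noteq> b"
  have "off E a p b" "off E a b q" using h E_irrefl by (auto simp: off_def intro: E_sym)
  then have "(off E a)\<^sup>*\<^sup>* p q" by (meson converse_rtranclp_into_rtranclp rtranclp.rtrancl_refl)
  then show "p = q" using off_path_unique h by blast
qed

lemma branch_self: "x \<in> branch E v x"
  by (simp add: branch_def)

lemma branch_avoids: "x \<noteq> v \<Longrightarrow> v \<notin> branch E v x"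
proof
  assume "x \<noteq> v" "v \<in> branch E v x"
  then have "(off E v)\<^sup>*\<^sup>* x v" by (simp add: branch_def)
  then show False using \<open>x \<noteq> v\<close> by (cases rule: rtranclp.cases) (auto simp: off_def)
qed

lemma branch_step: "x \<noteq> v \<Longrightarrow> y \<in> branch E v x \<Longrightarrow> E y z \<Longrightarrow> z \<noteq> v \<Longrightarrow> z \<in> branch E v x"
proof -
  assume h: "x \<noteq> v" "y \<in> branch E v x" "E y z" "z \<noteq> v"
  then have "y \<noteq> v" using branch_avoids by metis
  then have "off E v y z" using h by (simp add: off_def)
  then show ?thesis using h(2) unfolding branch_def by (simp add: rtranclp.rtrancl_into_rtrancl)
qed

lemma branch_exit: "E v x \<Longrightarrow> y \<in> branch E v x \<Longrightarrow> E y v \<Longrightarrow> y = x"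
  using off_path_unique[of v x y] E_sym[of y v] by (simp add: branch_def)

lemma branch_subset: "x \<in> V \<Longrightarrow> branch E v x \<subseteq> V"
proof
  fix y assume "x \<in> V" "y \<in> branch E v x"
  then have "(off E v)\<^sup>*\<^sup>* x y" by (simp add: branch_def)
  then show "y \<in> V" by (induction rule: rtranclp_induct) (use \<open>x \<in> V\<close> in \<open>auto simp: off_def dest: E_in\<close>)
qed

lemma branch_closed_subset:
  assumes "x \<in> C" "\<And>y z. y \<in> C \<Longrightarrow> y \<in> branch E v x \<Longrightarrow> E y z \<Longrightarrow> z \<noteq> v \<Longrightarrow> z \<in> C"
  shows "branch E v x \<subseteq> C"
proof
  fix y assume "y \<in> branch E v x"
  then have "(off E v)\<^sup>*\<^sup>* x y" by (simp add: branch_def)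
  then have "y \<in> C \<and> (off E v)\<^sup>*\<^sup>* x y"
  proof (induction rule: rtranclp_induct)
    case (step y z)
    then have xy: "(off E v)\<^sup>*\<^sup>* x y" and "y \<in> C" by auto
    then have "y \<in> branch E v x" by (simp add: branch_def)
    moreover have "E y z" "z \<noteq> v" using step(2) by (auto simp: off_def)
    ultimately show ?case using assms(2) \<open>y \<in> C\<close> rtranclp.rtrancl_into_rtrancl[OF xy step(2)] by blast
  qed (use assms(1) in auto)
  then show "y \<in> C" by blast
qed

text \<open>A directed edge from \<open>v\<close> to \<open>x\<close> with the smallest branch ends
  in a leaf: a further neighbour \<open>y\<close> of \<open>x\<close> would have its branch strictly
  inside, since that branch omits \<open>x\<close>.\<close>

lemma leaf_exists:
  assumes "E a b" shows "\<exists>l\<in>V. leaf E l"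
proof -
  define P where "P = (\<lambda>(v, x). E v x)"
  define m where "m = (\<lambda>(v, x). card (branch E v x))"
  have "P (a, b)" using assms by (simp add: P_def)
  then obtain e where "P e" and least: "\<And>e'. P e' \<Longrightarrow> m e \<le> m e'"
    using ex_has_least_nat[of P "(a, b)" m] by blast
  obtain v x where e: "e = (v, x)" by force
  have vx: "E v x" using \<open>P e\<close> e by (simp add: P_def)
  have "y = v" if y: "E x y" for y
  proof (rule ccontr)
    assume "y \<noteq> v"
    have xv: "x \<noteq> v" "y \<noteq> x" using vx y E_irrefl by auto
    have vn: "v \<notin> branch E x y" using branch_exit[OF y] vx \<open>y \<noteq> v\<close> by blast
    have "branch E x y \<subseteq> branch E v x"
    proof (rule branch_closed_subset)
      show "y \<in> branch E v x" using branch_step[OF xv(1) branch_self y \<open>y \<noteq> v\<close>] .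
      fix s t assume h: "s \<in> branch E v x" "s \<in> branch E x y" "E s t" "t \<noteq> x"
      then have "t \<in> branch E x y" using branch_step xv(2) by blast
      then have "t \<noteq> v" using vn by blast
      then show "t \<in> branch E v x" using branch_step[OF xv(1) h(1) h(3)] by blast
    qed
    moreover have "x \<notin> branch E x y" using branch_avoids xv by blast
    ultimately have "branch E x y \<subset> branch E v x" using branch_self by blast
    moreover have "finite (branch E v x)"
      using branch_subset E_in[OF vx] finite_V finite_subset by blast
    ultimately have "m (x, y) < m e" by (simp add: m_def e psubset_card_mono)
    then show False using least[of "(x, y)"] y by (simp add: P_def)
  qed
  then have "leaf E x" using leafI[of x v] vx E_sym by blast
  then show ?thesis using E_in[OF vx] by blast
qed

lemma walk_exists: "u \<in> V \<Longrightarrow> v \<in> V \<Longrightarrow> \<exists>xs. walk E xs \<and> hd xs = u \<and> last xs = v"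
  using tree by (auto simp: tree_def connected_graph_def)

lemma nbhd_nonempty:
  assumes "E a b" "v \<in> V" shows "\<exists>w. E v w"
proof (cases "v = a")
  case False
  obtain xs where xs: "walk E xs" "hd xs = v" "last xs = a"
    using walk_exists E_in assms by blast
  then show ?thesis using False by (cases xs; cases "tl xs") auto
qed (use assms in auto)

section \<open>Heights through walks to leaves\<close>

lemma height_le:
  assumes "E u w" "walk E xs" "hd xs = u" "leaf E (last xs)" "length xs = k + 1"
  shows "height E u \<le> k"
proof -
  have "nbhd E u \<noteq> {}" using assms(1) mem_nbhd by blast
  then show ?thesis unfolding height_def using assms by (auto intro!: Least_le)
qed

lemma height_walk:
  assumes "E u w"
  shows "\<exists>xs. walk E xs \<and> hd xs = u \<and> leaf E (last xs) \<and> length xs = height E u + 1"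
proof -
  have ne: "nbhd E u \<noteq> {}" using assms(1) mem_nbhd by blast
  obtain l where "l \<in> V" "leaf E l" using leaf_exists[OF assms] by blast
  then obtain xs where xs: "walk E xs" "hd xs = u" "last xs = l"
    using walk_exists E_in[OF assms] by blast
  then have "xs \<noteq> []" by auto
  then have "\<exists>k xs. walk E xs \<and> hd xs = u \<and> leaf E (last xs) \<and> length xs = k + 1"
    using xs \<open>leaf E l\<close> by (intro exI[of _ "length xs - 1"] exI[of _ xs]) auto
  from LeastI_ex[OF this] show ?thesis using ne by (simp add: height_def)
qed

lemma height_leaf: "E u w \<Longrightarrow> leaf E u \<Longrightarrow> height E u = 0"
  using height_le[of u w "[u]" 0] by auto

lemma height_step: "E u v \<Longrightarrow> height E u \<le> height E v + 1"
proof -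
  assume uv: "E u v"
  obtain xs where xs: "walk E xs" "hd xs = v" "leaf E (last xs)" "length xs = height E v + 1"
    using height_walk[OF E_sym[OF uv]] by blast
  then have "xs \<noteq> []" by auto
  then show ?thesis using height_le[OF uv, of "u # xs"] xs uv by (auto simp: walk_Cons)
qed

lemma height_1_adjacent_leaf:
  assumes "height E u = 1" shows "\<exists>l. E u l \<and> leaf E l"
proof -
  obtain w where "E u w" using assms mem_nbhd by (fastforce simp: height_def split: if_splits)
  then obtain xs where xs: "walk E xs" "hd xs = u" "leaf E (last xs)" "length xs = 2"
    using height_walk[of u w] assms by auto
  then obtain a b where "xs = [a, b]" by (auto simp: length_Suc_conv numeral_2_eq_2)
  then show ?thesis using xs by auto
qed

end

section \<open>Minimal transversals\<close>

lemma minimal_hitting_subset: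
  assumes "finite X" "\<forall>c\<in>A. \<exists>x\<in>X. R c x"
  shows "\<exists>Y\<subseteq>X. (\<forall>c\<in>A. \<exists>x\<in>Y. R c x) \<and> (\<forall>x\<in>Y. \<exists>c\<in>A. \<forall>y\<in>Y. R c y \<longleftrightarrow> y = x)"
  using assms
proof (induction X rule: finite_psubset_induct)
  case (psubset X)
  show ?case
  proof (cases "\<forall>x\<in>X. \<exists>c\<in>A. \<forall>y\<in>X. R c y \<longleftrightarrow> y = x")
    case False
    then obtain x where x: "x \<in> X" "\<And>c. c \<in> A \<Longrightarrow> \<exists>y\<in>X. (R c y) \<noteq> (y = x)" by blast
    have "\<forall>c\<in>A. \<exists>y\<in>X - {x}. R c y"
    proof
      fix c assume "c \<in> A"
      then show "\<exists>y\<in>X - {x}. R c y"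
        using x(2)[OF \<open>c \<in> A\<close>] psubset.prems by blast
    qed
    moreover have "X - {x} \<subset> X" using x(1) by blast
    ultimately obtain Y where "Y \<subseteq> X - {x}" "\<forall>c\<in>A. \<exists>x\<in>Y. R c x" "\<forall>x\<in>Y. \<exists>c\<in>A. \<forall>y\<in>Y. R c y \<longleftrightarrow> y = x"
      using psubset.IH[of "X - {x}"] by auto
    then show ?thesis by (intro exI[of _ Y]) blast
  qed (use psubset in blast)
qed

lemma off_meet_sym:
  assumes "symp R" "R\<^sup>*\<^sup>* a r" "R\<^sup>*\<^sup>* b r"
  shows "R\<^sup>*\<^sup>* a b"
  using assms by (meson rtranclp_trans symp_rtranclp sympD)

text \<open>\<open>V_odd_nonempty\<close> excludes the one-vertex tree, which the final theorem
  treats separately. It supplies an edge and thereby a neighbour of every vertex.\<close>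

locale unmixed_balanced_tree = tree_graph +
  assumes unmixed: "unmixed V E" and balanced: "balanced V E" and V_odd_nonempty: "V_odd V E \<noteq> {}"
begin

lemma off_meet:
  assumes "E c p" "E c q" "(off E c)\<^sup>*\<^sup>* p r" "(off E c)\<^sup>*\<^sup>* q r"
  shows "p = q"
proof -
  have "symp (off E c)" by (auto simp: symp_def off_def intro: E_sym)
  then show ?thesis using off_path_unique[OF assms(1,2) off_meet_sym[OF _ assms(3,4)]] by simp
qed

lemma neighbour_exists: "v \<in> V \<Longrightarrow> \<exists>w. E v w"
proof -
  obtain c where c: "odd (height E c)" using V_odd_nonempty by (auto simp: V_odd_def)
  then have "nbhd E c \<noteq> {}" by (auto simp: height_def)
  then obtain b where "E c b" by (auto simp: mem_nbhd)
  then show "v \<in> V \<Longrightarrow> \<exists>w. E v w" using nbhd_nonempty by blast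
qed

text \<open>Heights of adjacent vertices differ by at most one in any tree; balancedness excludes
  equality, so they differ by exactly one.\<close>

lemma parity: "E u v \<Longrightarrow> even (height E u) \<longleftrightarrow> odd (height E v)"
proof -
  assume uv: "E u v"
  have "height E u \<noteq> height E v" using balanced uv E_in unfolding balanced_def by blast
  then have "height E u = height E v + 1 \<or> height E v = height E u + 1"
    using height_step[OF uv] height_step[OF E_sym[OF uv]] by linarith
  then show ?thesis by auto
qed

lemma even_odd: "E u v \<Longrightarrow> u \<in> V_even V E \<Longrightarrow> v \<in> V_odd V E"
  and odd_even: "E u v \<Longrightarrow> u \<in> V_odd V E \<Longrightarrow> v \<in> V_even V E"
  using parity E_in by (auto simp: V_even_def V_odd_def)

lemma even_not_odd: "u \<in> V_even V E \<Longrightarrow> u \<notin> V_odd V E"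
  by (auto simp: V_even_def V_odd_def)

lemma V_split: "V = V_even V E \<union> V_odd V E"
  by (auto simp: V_even_def V_odd_def)

lemma finite_even: "finite (V_even V E)" and finite_odd: "finite (V_odd V E)"
  using finite_V by (auto simp: V_even_def V_odd_def)

lemma leaf_even: "E u w \<Longrightarrow> leaf E u \<Longrightarrow> u \<in> V_even V E"
  using height_leaf E_in by (auto simp: V_even_def)

text \<open>Leaves have height 0, so an odd vertex is no leaf. The second neighbour is what later
  allows one of them to be forbidden.\<close>

lemma odd_other_neighbour: "c \<in> V_odd V E \<Longrightarrow> \<exists>y. E c y \<and> y \<noteq> x"
proof -
  assume c: "c \<in> V_odd V E"
  obtain w where w: "E c w" using neighbour_exists c by (auto simp: V_odd_def)
  have "\<not> leaf E c" using leaf_even[OF w] c even_not_odd by blast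
  then show ?thesis using leafI[OF w] w by metis
qed

definition transversal :: "'a set \<Rightarrow> bool" where
  "transversal X \<longleftrightarrow> X \<subseteq> V_even V E \<and> (\<forall>c\<in>V_odd V E. \<exists>x\<in>X. E c x)"

definition minimal_transversal :: "'a set \<Rightarrow> bool" where
  "minimal_transversal X \<longleftrightarrow> transversal X \<and> (\<forall>x\<in>X. \<exists>c\<in>V_odd V E. \<forall>y\<in>X. E c y \<longleftrightarrow> y = x)"

lemma finite_transversal: "transversal X \<Longrightarrow> finite X"
  unfolding transversal_def using finite_even finite_subset by blast

lemma minimal_transversal_subset:
  assumes "transversal X" shows "\<exists>Y\<subseteq>X. minimal_transversal Y"
proof -
  have "\<forall>c\<in>V_odd V E. \<exists>x\<in>X. E c x" "X \<subseteq> V_even V E" using assms by (simp_all add: transversal_def)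
  then obtain Y where "Y \<subseteq> X" "\<forall>c\<in>V_odd V E. \<exists>x\<in>Y. E c x"
      "\<forall>x\<in>Y. \<exists>c\<in>V_odd V E. \<forall>y\<in>Y. E c y \<longleftrightarrow> y = x"
    using minimal_hitting_subset[OF finite_transversal[OF assms], of "V_odd V E" E] by auto
  then show ?thesis using \<open>X \<subseteq> V_even V E\<close>
    unfolding minimal_transversal_def transversal_def by (intro exI[of _ Y]) simp
qed

text \<open>The device for forcing vertices in: when \<open>W\<close> contains all neighbours of
  some odd vertex but one, that one has to belong to \<open>X\<close>.\<close>

lemma minimal_transversal_avoiding:
  assumes "\<And>c. c \<in> V_odd V E \<Longrightarrow> \<exists>y. E c y \<and> y \<notin> W"
  shows "\<exists>X. minimal_transversal X \<and> X \<inter> W = {}"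
proof -
  have "transversal (V_even V E - W)"
    unfolding transversal_def using assms odd_even by blast
  then show ?thesis using minimal_transversal_subset by blast
qed

text \<open>Even vertices are dominated only by odd ones and conversely. So one fixed minimal odd
  part \<open>Z\<close> completes every minimal transversal to a minimal TD-set, and unmixedness
  compares two such unions.\<close>

lemma card_minimal_transversal:
  assumes "minimal_transversal X" "minimal_transversal Y"
  shows "card X = card Y"
proof -
  have "\<forall>c\<in>V_even V E. \<exists>x\<in>V_odd V E. E c x"
    using neighbour_exists even_odd V_split by blast
  from minimal_hitting_subset[OF finite_odd this] obtain Z where Z: "Z \<subseteq> V_odd V E"
    "\<forall>c\<in>V_even V E. \<exists>x\<in>Z. E c x" "\<forall>x\<in>Z. \<exists>c\<in>V_even V E. \<forall>y\<in>Z. E c y \<longleftrightarrow> y = x" by blast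
  have mem: "v \<in> nbhd_set E D \<longleftrightarrow> (\<exists>d\<in>D. E v d)" for v D
    by (auto simp: nbhd_set_def mem_nbhd intro: E_sym)
  have TD: "minimal_TD_set V E (X \<union> Z)" if X: "minimal_transversal X" for X
    unfolding minimal_TD_set_def
  proof (intro conjI allI impI notI)
    have XV: "X \<subseteq> V_even V E" "\<forall>c\<in>V_odd V E. \<exists>x\<in>X. E c x"
      using X unfolding minimal_transversal_def transversal_def by blast+
    have "v \<in> nbhd_set E (X \<union> Z) \<longleftrightarrow> v \<in> V" for v
      unfolding mem using XV(2) Z(2) V_split E_in by blast
    then show "TD_set V E (X \<union> Z)"
      unfolding TD_set_def using XV(1) Z(1) V_split by blast
    fix D' assume D': "D' \<subset> X \<union> Z" "TD_set V E D'"
    then have hit: "\<exists>d\<in>D'. E v d" if "v \<in> V" for v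
      using that mem unfolding TD_set_def by blast
    obtain x where x: "x \<in> X \<union> Z" "x \<notin> D'" using D'(1) by blast
    show False
    proof (cases "x \<in> X")
      case True
      then obtain c where c: "c \<in> V_odd V E" "\<forall>y\<in>X. E c y \<longleftrightarrow> y = x"
        using X unfolding minimal_transversal_def by blast
      obtain d where d: "d \<in> D'" "E c d" using hit c(1) V_split by blast
      then have "d \<in> X" using D'(1) odd_even[OF d(2) c(1)] Z(1) even_not_odd by blast
      then have "d = x" using c(2) d(2) by simp
      then show False using d(1) x(2) by simp
    next
      case False
      then obtain c where c: "c \<in> V_even V E" "\<forall>y\<in>Z. E c y \<longleftrightarrow> y = x"
        using x(1) Z(3) by blast
      obtain d where d: "d \<in> D'" "E c d" using hit c(1) V_split by blast
      then have "d \<in> Z" using D'(1) even_odd[OF d(2) c(1)] XV(1) even_not_odd by blast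
      then have "d = x" using c(2) d(2) by simp
      then show False using d(1) x(2) by simp
    qed
  qed
  have card: "card (X \<union> Z) = card X + card Z" if "minimal_transversal X" for X
  proof (rule card_Un_disjoint)
    have "transversal X" using that by (simp add: minimal_transversal_def)
    then show "finite X" "X \<inter> Z = {}"
      using finite_transversal Z(1) even_not_odd unfolding transversal_def by blast+
    show "finite Z" using Z(1) finite_odd finite_subset by blast
  qed
  have "card (X \<union> Z) = card (Y \<union> Z)"
    using unmixed TD assms unfolding unmixed_def by blast
  then show ?thesis using card assms by simp
qed

text \<open>The hybrid \<open>H\<close> follows \<open>D\<close> inside the branch and
  \<open>Y\<close> outside. Only \<open>v\<close> links the two sides; it stays hit by
  \<open>x'\<close>, and it is private to no element that is kept: in \<open>Y\<close> both
  \<open>x\<close> and \<open>x'\<close> hit it, in \<open>D\<close> it is hit by \<open>u\<close>,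
  which lies outside the branch. Hence \<open>H\<close> is minimal, and comparing its size with that
  of \<open>Y\<close> leaves the two parts inside the branch.\<close>

lemma card_branch_exchange:
  assumes D: "minimal_transversal D" and Y: "minimal_transversal Y" and v: "v \<in> V_odd V E"
    and x: "E v x" "x \<in> Y" and x': "E v x'" "x' \<in> Y" "x' \<noteq> x" and u: "E v u" "u \<in> D" "u \<noteq> x"
  shows "card (D \<inter> branch E v x) = card (Y \<inter> branch E v x)"
proof -
  define B where "B = branch E v x"
  define H where "H = (Y - B) \<union> (D \<inter> B)"
  have xv: "x \<noteq> v" using x(1) E_irrefl by blast
  have step: "z \<in> B" if "y \<in> B" "E y z" "z \<noteq> v" for y z
    using branch_step[OF xv] that unfolding B_def by blast
  have exit: "y = x" if "y \<in> B" "E v y" for y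
    using branch_exit[OF x(1)] that E_sym unfolding B_def by blast
  have tD: "D \<subseteq> V_even V E" "\<And>c. c \<in> V_odd V E \<Longrightarrow> \<exists>x\<in>D. E c x"
    and tY: "Y \<subseteq> V_even V E" "\<And>c. c \<in> V_odd V E \<Longrightarrow> \<exists>x\<in>Y. E c x"
    using D Y unfolding minimal_transversal_def transversal_def by blast+
  have nv: "y \<noteq> v" if "y \<in> D \<or> y \<in> Y" for y using that tD(1) tY(1) v even_not_odd by blast
  have "minimal_transversal H"
    unfolding minimal_transversal_def transversal_def
  proof (intro conjI ballI)
    show "H \<subseteq> V_even V E" using tD tY H_def by blast
    fix c assume c: "c \<in> V_odd V E"
    show "\<exists>x\<in>H. E c x"
    proof (cases "c \<in> B")
      case True
      then show ?thesis using tD(2)[OF c] step nv unfolding H_def by blast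
    next
      case False
      show ?thesis
      proof (cases "c = v")
        case True
        then show ?thesis using x' exit unfolding H_def by blast
      next
        case cv: False
        then show ?thesis using tY(2)[OF c] step E_sym False unfolding H_def by blast
      qed
    qed
  next
    fix d assume d: "d \<in> H"
    show "\<exists>c\<in>V_odd V E. \<forall>y\<in>H. E c y \<longleftrightarrow> y = d"
    proof (cases "d \<in> B")
      case True
      then have "d \<in> D" using d H_def by blast
      then obtain f where f: "f \<in> V_odd V E" "\<forall>y\<in>D. E f y \<longleftrightarrow> y = d"
        using D unfolding minimal_transversal_def by blast
      have "f \<noteq> v"
      proof
        assume "f = v"
        then have "u = d" using f(2) u by simp
        then show False using True exit u by simp
      qed
      moreover have fd: "E f d" using f(2) \<open>d \<in> D\<close> by simp
      ultimately have "f \<in> B" using step[OF True E_sym] by blast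
      then have "y \<in> D" if "E f y" "y \<in> H" for y
        using step[OF _ that(1)] nv that(2) unfolding H_def by blast
      then have "E f y \<longleftrightarrow> y = d" if "y \<in> H" for y
        using that f(2) fd by (cases "E f y") auto
      then show ?thesis using f(1) by blast
    next
      case False
      then have "d \<in> Y" using d H_def by blast
      then obtain f where f: "f \<in> V_odd V E" "\<forall>y\<in>Y. E f y \<longleftrightarrow> y = d"
        using Y unfolding minimal_transversal_def by blast
      have fv: "f \<noteq> v" using f(2) x x' by metis
      have fd: "E f d" using f(2) \<open>d \<in> Y\<close> by simp
      have "f \<notin> B" using step[of f d] False fd \<open>d \<in> Y\<close> nv by blast
      then have "y \<notin> B" if "E f y" for y using step[of y f] fv E_sym[OF that] by blast
      then have "E f y \<longleftrightarrow> y = d" if "y \<in> H" for y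
        using that f(2) fd unfolding H_def by (cases "E f y") auto
      then show ?thesis using f(1) by blast
    qed
  qed
  then have "card H = card Y" using card_minimal_transversal Y by blast
  moreover have fin: "finite D" "finite Y"
    using D Y finite_transversal unfolding minimal_transversal_def by blast+
  moreover have "card H = card (Y - B) + card (D \<inter> B)"
    unfolding H_def using fin by (intro card_Un_disjoint) auto
  moreover have "card Y = card (Y - B) + card (Y \<inter> B)"
    using card_Int_Diff[OF fin(2), of B] by simp
  ultimately show ?thesis unfolding B_def by linarith
qed

end

section \<open>Structure of unmixed balanced trees\<close>

context unmixed_balanced_tree
begin

section \<open>Minimal transversals with prescribed elements\<close>

lemma off_step: "E a b \<Longrightarrow> a \<noteq> c \<Longrightarrow> b \<noteq> c \<Longrightarrow> (off E c)\<^sup>*\<^sup>* b r \<Longrightarrow> (off E c)\<^sup>*\<^sup>* a r"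
  by (rule converse_rtranclp_into_rtranclp[of "off E c"]) (simp_all add: off_def)

text \<open>All neighbours of \<open>c\<close> in \<open>W\<close> reach the same \<open>r\<close>
  without passing \<open>c\<close>, so in a tree there is at most one of them, while an odd vertex
  has two neighbours.\<close>

lemma two_of_avoided:
  assumes "c \<in> V_odd V E" "\<And>y. E c y \<Longrightarrow> y \<in> W \<Longrightarrow> (off E c)\<^sup>*\<^sup>* y r"
  shows "\<exists>y. E c y \<and> y \<notin> W"
proof -
  obtain p where p: "E c p" using odd_other_neighbour[OF assms(1)] by blast
  obtain q where q: "E c q" "q \<noteq> p" using odd_other_neighbour[OF assms(1)] by blast
  show ?thesis
  proof (rule ccontr)
    assume "\<not> ?thesis"
    then have "p = q" using off_meet[OF p q(1)] assms(2) p q(1) by metis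
    then show False using q(2) by simp
  qed
qed

lemma even_ne_odd: "u \<in> V_even V E \<Longrightarrow> c \<in> V_odd V E \<Longrightarrow> u \<noteq> c"
  using even_not_odd by metis

lemma other_neighbour: "E v x \<Longrightarrow> \<not> leaf E x \<Longrightarrow> \<exists>z. E x z \<and> z \<noteq> v"
  using leafI E_sym by metis

text \<open>Everything at distance two from \<open>u\<close> is forbidden. An odd neighbour of
  \<open>u\<close> can then be hit by \<open>u\<close> only; any other odd \<open>c\<close> meets
  the forbidden set just on the side of \<open>u\<close>.\<close>

lemma minimal_transversal_through:
  assumes u: "u \<in> V_even V E" "E u v"
  shows "\<exists>D. minimal_transversal D \<and> u \<in> D \<and> (\<forall>v d. E u v \<longrightarrow> E v d \<longrightarrow> d \<in> D \<longrightarrow> d = u)"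
proof -
  define W where "W = {y. y \<noteq> u \<and> (\<exists>v. E u v \<and> E v y)}"
  have "\<exists>y. E c y \<and> y \<notin> W" if c: "c \<in> V_odd V E" for c
  proof (cases "E u c")
    case True
    then show ?thesis using E_sym[of u c] by (intro exI[of _ u]) (simp add: W_def)
  next
    case False
    have "(off E c)\<^sup>*\<^sup>* y u" if y: "E c y" "y \<in> W" for y
    proof -
      obtain v where v: "E u v" "E v y" using y by (auto simp: W_def)
      have "y \<noteq> c" "v \<noteq> c" "u \<noteq> c" using y(1) E_irrefl v(1) False even_ne_odd[OF u(1) c] by metis+
      then show ?thesis using off_step[OF E_sym[OF v(2)]] off_step[OF E_sym[OF v(1)]] by simp
    qed
    then show ?thesis using two_of_avoided[OF c] by blast
  qed
  then obtain D where D: "minimal_transversal D" "D \<inter> W = {}"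
    using minimal_transversal_avoiding by blast
  have only: "d = u" if "E u v" "E v d" "d \<in> D" for v d
    using that D(2) unfolding W_def by blast
  have "v \<in> V_odd V E" using even_odd[OF u(2,1)] .
  then obtain d where "d \<in> D" "E v d" using D(1) unfolding minimal_transversal_def transversal_def by blast
  then have "u \<in> D" using only u(2) by blast
  then show ?thesis using D(1) only by blast
qed

text \<open>The nonleaves \<open>x\<close> and \<open>x'\<close> have further neighbours
  \<open>z\<close> and \<open>z'\<close>; forbidding all other neighbours of these two forces both.
  An odd vertex other than \<open>z\<close>, \<open>z'\<close>, \<open>v\<close> meets the forbidden
  set only in the direction of \<open>v\<close>.\<close>

lemma minimal_transversal_two:
  assumes v: "v \<in> V_odd V E" and x: "E v x" "\<not> leaf E x" and x': "E v x'" "\<not> leaf E x'" "x \<noteq> x'"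
  shows "\<exists>Y. minimal_transversal Y \<and> x \<in> Y \<and> x' \<in> Y"
proof -
  obtain z where z: "E x z" "z \<noteq> v" using other_neighbour x by blast
  obtain z' where z': "E x' z'" "z' \<noteq> v" using other_neighbour x' by blast
  have ev: "x \<in> V_even V E" "x' \<in> V_even V E" using odd_even x(1) x'(1) v by blast+
  \<comment> \<open>Otherwise \<open>v\<close> and \<open>z'\<close> would both link
    \<open>x\<close> to \<open>x'\<close>. This and the symmetric fact keep \<open>x\<close> and
    \<open>x'\<close> themselves from being forbidden.\<close>
  have n1: "\<not> E z' x" using two_path_unique[OF x(1) E_sym[of z' x] x'(1) z'(1)] z'(2) x'(3) by metis
  have n2: "\<not> E z x'" using two_path_unique[OF x'(1) E_sym[of z x'] x(1) z(1)] z(2) x'(3) by metis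
  define W where "W = {y. y \<noteq> x \<and> E z y} \<union> {y. y \<noteq> x' \<and> E z' y}"
  have xW: "x \<notin> W" "x' \<notin> W" using n1 n2 by (auto simp: W_def)
  have "\<exists>y. E c y \<and> y \<notin> W" if c: "c \<in> V_odd V E" for c
  proof (cases "c = z \<or> c = z' \<or> c = v")
    case True
    then show ?thesis using xW x(1) x'(1) E_sym[OF z(1)] E_sym[OF z'(1)] by blast
  next
    case False
    have ne: "x \<noteq> c" "x' \<noteq> c" "z \<noteq> c" "z' \<noteq> c" "v \<noteq> c" using even_ne_odd[OF _ c] ev False by blast+
    have "(off E c)\<^sup>*\<^sup>* y v" if y: "E c y" "y \<in> W" for y
    proof -
      have yc: "y \<noteq> c" using y(1) E_irrefl by blast
      have "E z y \<or> E z' y" using y(2) by (auto simp: W_def)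
      moreover have "(off E c)\<^sup>*\<^sup>* z v"
        using off_step[OF E_sym[OF z(1)]] off_step[OF E_sym[OF x(1)]] ne by simp
      moreover have "(off E c)\<^sup>*\<^sup>* z' v"
        using off_step[OF E_sym[OF z'(1)]] off_step[OF E_sym[OF x'(1)]] ne by simp
      ultimately show ?thesis using off_step[OF E_sym[of z y]] off_step[OF E_sym[of z' y]] yc ne by metis
    qed
    then show ?thesis using two_of_avoided[OF c] by blast
  qed
  then obtain Y where Y: "minimal_transversal Y" "Y \<inter> W = {}"
    using minimal_transversal_avoiding by blast
  have hit: "\<exists>d\<in>Y. E c d" if "c \<in> V_odd V E" for c
    using Y(1) that unfolding minimal_transversal_def transversal_def by blast
  have "x \<in> Y" using hit[OF even_odd[OF z(1) ev(1)]] Y(2) unfolding W_def by blast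
  moreover have "x' \<in> Y" using hit[OF even_odd[OF z'(1) ev(2)]] Y(2) unfolding W_def by blast
  ultimately show ?thesis using Y(1) by blast
qed

lemma no_bad_vertex:
  assumes u: "u \<in> V_even V E"
    and bad: "\<And>v. E u v \<Longrightarrow> \<exists>x x'. E v x \<and> E v x' \<and> x \<noteq> u \<and> x \<noteq> x' \<and> \<not> leaf E x \<and> \<not> leaf E x'"
  shows False
proof -
  obtain v0 where v0: "E u v0" using neighbour_exists u by (auto simp: V_even_def)
  obtain D where D: "minimal_transversal D" "u \<in> D" "\<And>v d. E u v \<Longrightarrow> E v d \<Longrightarrow> d \<in> D \<Longrightarrow> d = u"
    using minimal_transversal_through[OF u v0] by blast
  have "\<forall>v. \<exists>x Y. E u v \<longrightarrow> (E v x \<and> x \<noteq> u \<and> minimal_transversal Y \<and> x \<in> Y \<and>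
      card (D \<inter> branch E v x) = card (Y \<inter> branch E v x))"
  proof
    fix v
    show "\<exists>x Y. E u v \<longrightarrow> (E v x \<and> x \<noteq> u \<and> minimal_transversal Y \<and> x \<in> Y \<and>
      card (D \<inter> branch E v x) = card (Y \<inter> branch E v x))"
    proof (cases "E u v")
      case True
      then obtain x x' where x: "E v x" "E v x'" "x \<noteq> u" "x \<noteq> x'" "\<not> leaf E x" "\<not> leaf E x'"
        using bad by blast
      have v: "v \<in> V_odd V E" using even_odd[OF True u] .
      obtain Y where Y: "minimal_transversal Y" "x \<in> Y" "x' \<in> Y"
        using minimal_transversal_two[OF v x(1,5,2,6,4)] by blast
      show ?thesis
        using card_branch_exchange[OF D(1) Y(1) v x(1) Y(2) x(2) Y(3) _ E_sym[OF True] D(2)] x Y by metis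
    qed simp
  qed
  then obtain X Y where XY: "\<And>v. E u v \<Longrightarrow> E v (X v) \<and> X v \<noteq> u \<and> minimal_transversal (Y v) \<and> X v \<in> Y v \<and>
      card (D \<inter> branch E v (X v)) = card (Y v \<inter> branch E v (X v))"
    by metis
  define N where "N = nbhd E u"
  define B where "B v = branch E v (X v)" for v
  have N: "v \<in> N \<longleftrightarrow> E u v" for v by (simp add: N_def mem_nbhd)
  have finN: "finite N" by (simp add: N_def finite_nbhd)
  have Xv: "X v \<noteq> v" if "v \<in> N" for v using XY[of v] that E_irrefl N by metis
  have step: "z \<in> B v" if "v \<in> N" "y \<in> B v" "E y z" "z \<noteq> v" for v y z
    using branch_step[OF Xv[OF that(1)]] that unfolding B_def by blast
  have vB: "v \<notin> B v" if "v \<in> N" for v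
    using branch_avoids[OF Xv[OF that]] unfolding B_def by blast
  have uB: "u \<notin> B v" if "v \<in> N" for v
    using branch_exit[of v "X v" u] XY[of v] that N unfolding B_def by metis
  have nB: "w \<notin> B v" if "v \<in> N" "w \<in> N" for v w
  proof
    assume w: "w \<in> B v"
    have "u \<noteq> v" "E w u" using that N E_irrefl E_sym by metis+
    then show False using step[OF that(1) w] uB that(1) by blast
  qed
  have disj: "B v \<inter> B w = {}" if vw: "v \<in> N" "w \<in> N" "v \<noteq> w" for v w
  proof -
    have "X v \<notin> B w"
      using step[OF vw(2), of "X v" v] nB[OF vw(2,1)] vw XY[of v] N E_sym by metis
    moreover have "z \<notin> B w" if "y \<notin> B w" "y \<in> B v" "E y z" for y z
      using step[OF vw(2) _ E_sym[OF that(3)]] nB[OF vw(1,2)] that by metis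
    ultimately have "B v \<subseteq> - B w"
      using branch_closed_subset[of "X v" "- B w" v] unfolding B_def by auto
    then show ?thesis by blast
  qed
  have tD: "D \<subseteq> V_even V E" "\<And>c. c \<in> V_odd V E \<Longrightarrow> \<exists>x\<in>D. E c x"
    using D unfolding minimal_transversal_def transversal_def by blast+
  have tY: "Y v \<subseteq> V_even V E" "\<And>c. c \<in> V_odd V E \<Longrightarrow> \<exists>x\<in>Y v. E c x" if "v \<in> N" for v
    using XY[of v] that N unfolding minimal_transversal_def transversal_def by blast+
  have Nodd: "v \<in> V_odd V E" if "v \<in> N" for v using that N even_odd u by blast
  \<comment> \<open>The branches \<open>B v\<close> are pairwise disjoint and miss \<open>u\<close>,
    so \<open>D'\<close> has at most as many elements as \<open>D - {u}\<close>.\<close>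
  define D' where "D' = (D - {u} - (\<Union>v\<in>N. B v)) \<union> (\<Union>v\<in>N. Y v \<inter> B v)"
  have "transversal D'"
    unfolding transversal_def
  proof (intro conjI ballI)
    show "D' \<subseteq> V_even V E" using tD tY unfolding D'_def by blast
    fix c assume c: "c \<in> V_odd V E"
    show "\<exists>x\<in>D'. E c x"
    proof (cases "\<exists>v\<in>N. c \<in> B v")
      case True
      then obtain v where v: "v \<in> N" "c \<in> B v" by blast
      obtain y where y: "y \<in> Y v" "E c y" using tY(2)[OF v(1) c] by blast
      have "y \<noteq> v" using even_ne_odd y(1) tY(1)[OF v(1)] Nodd[OF v(1)] by blast
      then show ?thesis using step[OF v y(2)] y v(1) unfolding D'_def by blast
    next
      case nb: False
      show ?thesis
      proof (cases "E u c")
        case True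
        then have "X c \<in> B c" using branch_self unfolding B_def by fast
        then show ?thesis using XY[OF True] True N unfolding D'_def by blast
      next
        case False
        obtain d where d: "d \<in> D" "E c d" using tD(2)[OF c] by blast
        have "d \<noteq> u" using False E_sym d(2) by blast
        moreover have "d \<notin> B v" if "v \<in> N" for v
          using step[OF that _ E_sym[OF d(2)]] nb that False N by blast
        ultimately show ?thesis using d unfolding D'_def by blast
      qed
    qed
  qed
  then obtain D'' where D'': "D'' \<subseteq> D'" "minimal_transversal D''"
    using minimal_transversal_subset by blast
  have finD: "finite D" using D(1) finite_transversal unfolding minimal_transversal_def by blast
  have "card D'' \<le> card D'" using D'' \<open>transversal D'\<close> finite_transversal card_mono by blast
  also have "\<dots> \<le> card (D - {u} - (\<Union>v\<in>N. B v)) + card (\<Union>v\<in>N. Y v \<inter> B v)"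
    unfolding D'_def by (rule card_Un_le)
  also have "card (\<Union>v\<in>N. Y v \<inter> B v) \<le> (\<Sum>v\<in>N. card (Y v \<inter> B v))"
    by (rule card_UN_le[OF finN])
  also have "(\<Sum>v\<in>N. card (Y v \<inter> B v)) = (\<Sum>v\<in>N. card (D \<inter> B v))"
    using XY N unfolding B_def by (intro sum.cong) auto
  also have "\<dots> = card (\<Union>v\<in>N. D \<inter> B v)"
    using finN finD disj by (intro card_UN_disjoint[symmetric]) auto
  also have "card (D - {u} - (\<Union>v\<in>N. B v)) + card (\<Union>v\<in>N. D \<inter> B v)
      = card ((D - {u} - (\<Union>v\<in>N. B v)) \<union> (\<Union>v\<in>N. D \<inter> B v))"
    using finD finN by (intro card_Un_disjoint[symmetric]) auto
  also have "(D - {u} - (\<Union>v\<in>N. B v)) \<union> (\<Union>v\<in>N. D \<inter> B v) = D - {u}"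
    using uB by blast
  also have "card (D - {u}) < card D" by (rule card_Diff1_less[OF finD D(2)])
  finally show False using card_minimal_transversal[OF D(1) D''(2)] by simp
qed

text \<open>Taking \<open>x' = u\<close> in \<open>no_bad_vertex\<close> gives a neighbour of
  \<open>u\<close> whose neighbours other than \<open>u\<close> are all leaves; being odd, it does
  have another neighbour.\<close>

lemma nonleaf_adjacent_support:
  assumes u: "u \<in> V_even V E" "\<not> leaf E u"
  shows "\<exists>a l. E u a \<and> E a l \<and> leaf E l"
proof -
  obtain v where v: "E u v" "\<And>x x'. E v x \<Longrightarrow> E v x' \<Longrightarrow> x \<noteq> u \<Longrightarrow> x \<noteq> x' \<Longrightarrow> leaf E x \<or> leaf E x'"
    using no_bad_vertex[OF u(1)] by blast
  obtain y where "E v y" "y \<noteq> u" using odd_other_neighbour even_odd[OF v(1) u(1)] by blast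
  then show ?thesis using v(2)[of y u] u(2) v(1) E_sym by blast
qed

text \<open>The leaf \<open>l\<close> has the single neighbour \<open>a\<close>, so two nonleaves at
  \<open>a\<close> would make \<open>l\<close> a vertex as excluded by
  \<open>no_bad_vertex\<close>.\<close>

lemma support_nonleaf_unique:
  assumes "E a l" "leaf E l" "E a w" "\<not> leaf E w" "E a w'" "\<not> leaf E w'"
  shows "w = w'"
proof (rule ccontr)
  assume "w \<noteq> w'"
  have la: "E l a" using assms(1) E_sym by blast
  show False
  proof (rule no_bad_vertex)
    show "l \<in> V_even V E" using leaf_even la assms(2) by blast
    fix v assume "E l v"
    then have "v = a" using leaf_unique assms(2) la by blast
    then show "\<exists>x x'. E v x \<and> E v x' \<and> x \<noteq> l \<and> x \<noteq> x' \<and> \<not> leaf E x \<and> \<not> leaf E x'"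
      using assms \<open>w \<noteq> w'\<close> by metis
  qed
qed

text \<open>With two supports at \<open>w\<close>, their leaves \<open>la\<close> and
  \<open>lb\<close> can be forced into one minimal transversal. Each leaf serves only its own
  support, so \<open>w\<close> replaces both and the size drops.\<close>

lemma support_unique:
  assumes w: "w \<in> V_even V E" and a: "E w a" "E a la" "leaf E la" and b: "E w b" "E b lb" "leaf E lb"
  shows "a = b"
proof (rule ccontr)
  assume ab: "a \<noteq> b"
  have odd: "a \<in> V_odd V E" "b \<in> V_odd V E" using even_odd w a b by blast+
  have lu: "c = a" if "E c la" for c using leaf_unique[OF a(3)] E_sym a(2) that by blast
  have lu': "c = b" if "E c lb" for c using leaf_unique[OF b(3)] E_sym b(2) that by blast
  have lab: "la \<noteq> lb" using lu b(2) ab by blast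
  have wl: "w \<noteq> la" "w \<noteq> lb" using lu lu' ab E_sym a(1) b(1) by blast+
  define W where "W = {y. (E a y \<or> E b y) \<and> y \<noteq> la \<and> y \<noteq> lb}"
  have "\<exists>y. E c y \<and> y \<notin> W" if c: "c \<in> V_odd V E" for c
  proof (cases "c = a \<or> c = b")
    case True
    then show ?thesis using a(2) b(2) by (auto simp: W_def)
  next
    case False
    have wc: "w \<noteq> c" "a \<noteq> c" "b \<noteq> c" using even_ne_odd[OF w c] False by blast+
    have "(off E c)\<^sup>*\<^sup>* y w" if y: "E c y" "y \<in> W" for y
    proof -
      have yc: "y \<noteq> c" using y(1) E_irrefl by blast
      have "E a y \<or> E b y" using y(2) by (auto simp: W_def)
      moreover have "(off E c)\<^sup>*\<^sup>* a w" "(off E c)\<^sup>*\<^sup>* b w"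
        using off_step[OF E_sym[OF a(1)]] off_step[OF E_sym[OF b(1)]] wc by simp_all
      ultimately show ?thesis using off_step[OF E_sym[of a y]] off_step[OF E_sym[of b y]] yc wc by metis
    qed
    then show ?thesis using two_of_avoided[OF c] by blast
  qed
  then obtain D where D: "minimal_transversal D" "D \<inter> W = {}"
    using minimal_transversal_avoiding by blast
  have tD: "D \<subseteq> V_even V E" "\<And>c. c \<in> V_odd V E \<Longrightarrow> \<exists>x\<in>D. E c x"
    using D unfolding minimal_transversal_def transversal_def by blast+
  have finD: "finite D" using D(1) finite_transversal unfolding minimal_transversal_def by blast
  have la: "la \<in> D" using tD(2)[OF odd(1)] D(2) lu' ab unfolding W_def by blast
  have lb: "lb \<in> D" using tD(2)[OF odd(2)] D(2) lu ab unfolding W_def by blast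
  define D' where "D' = insert w (D - {la, lb})"
  have "transversal D'"
    unfolding transversal_def
  proof (intro conjI ballI)
    show "D' \<subseteq> V_even V E" using tD w unfolding D'_def by blast
    fix c assume c: "c \<in> V_odd V E"
    obtain d where d: "d \<in> D" "E c d" using tD(2)[OF c] by blast
    show "\<exists>x\<in>D'. E c x"
    proof (cases "d = la \<or> d = lb")
      case True
      then have "c = a \<or> c = b" using lu lu' d(2) by blast
      then show ?thesis using E_sym a(1) b(1) unfolding D'_def by blast
    qed (use d in \<open>auto simp: D'_def\<close>)
  qed
  then obtain D'' where D'': "D'' \<subseteq> D'" "minimal_transversal D''"
    using minimal_transversal_subset by blast
  have "card D'' \<le> card D'" using D'' \<open>transversal D'\<close> finite_transversal card_mono by blast
  also have "\<dots> \<le> Suc (card (D - {la, lb}))" unfolding D'_def by (rule card_insert_le_m1) auto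
  also have "card (D - {la, lb}) = card D - 2"
    using la lb lab finD by (simp add: card_Diff_subset)
  also have "Suc (card D - 2) < card D"
    using card_mono[OF finD, of "{la, lb}"] la lb lab by simp
  finally show False using card_minimal_transversal[OF D(1) D''(2)] by simp
qed

lemma height_support: "c \<in> V_odd V E \<Longrightarrow> height E c = 1 \<longleftrightarrow> (\<exists>l. E c l \<and> leaf E l)"
proof
  assume c: "c \<in> V_odd V E"
  show "height E c = 1" if ex: "\<exists>l. E c l \<and> leaf E l"
  proof -
    obtain l where l: "E c l" "leaf E l" using ex by blast
    have "height E c \<le> 1" using height_le[OF l(1), of "[c, l]" 1] l by simp
    then show ?thesis using c by (cases "height E c") (auto simp: V_odd_def)
  qed
qed (rule height_1_adjacent_leaf)

text \<open>If all neighbours of an odd \<open>c\<close> are nonleaves,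
  \<open>nonleaf_adjacent_support\<close> yields a walk \<open>c\<close>, \<open>u\<close>,
  \<open>a\<close>, \<open>l\<close> to a leaf, so the height is at most 3.\<close>

lemma odd_height: "V_odd V E = Vk V E 1 \<union> Vk V E 3"
proof -
  have "height E c = 1 \<or> height E c = 3" if c: "c \<in> V_odd V E" for c
  proof (rule disjCI)
    assume n3: "height E c \<noteq> 3"
    show "height E c = 1"
    proof (rule ccontr)
      assume n1: "height E c \<noteq> 1"
      obtain u where u: "E c u" using odd_other_neighbour[OF c] by blast
      have "\<not> leaf E u" using height_support[OF c] n1 u by blast
      then obtain a l where al: "E u a" "E a l" "leaf E l"
        using nonleaf_adjacent_support[OF odd_even[OF u c]] by blast
      have le: "height E c \<le> 3" using height_le[OF u, of "[c, u, a, l]" 3] u al by simp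
      have "odd (height E c)" using c by (simp add: V_odd_def)
      have "height E c = 0 \<or> height E c = 2" using le n1 n3 by linarith
      then show False using \<open>odd (height E c)\<close> by (elim disjE) simp_all
    qed
  qed
  then show ?thesis by (auto simp: V_odd_def Vk_def)
qed

text \<open>In other words, the neighbourhoods of the vertices of height 1 partition
  \<open>V_even\<close>; these are the blocks of variables below.\<close>

lemma support_block:
  assumes u: "u \<in> V_even V E"
  shows "\<exists>!a. a \<in> Vk V E 1 \<and> u \<in> nbhd E a"
proof -
  have V1: "a \<in> Vk V E 1 \<and> u \<in> nbhd E a \<longleftrightarrow> E u a \<and> (\<exists>l. E a l \<and> leaf E l)" for a
  proof
    assume a: "a \<in> Vk V E 1 \<and> u \<in> nbhd E a"
    then have "a \<in> V_odd V E" "E u a" using E_sym by (auto simp: Vk_def V_odd_def mem_nbhd)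
    then show "E u a \<and> (\<exists>l. E a l \<and> leaf E l)" using height_support a by (auto simp: Vk_def)
  next
    assume a: "E u a \<and> (\<exists>l. E a l \<and> leaf E l)"
    then show "a \<in> Vk V E 1 \<and> u \<in> nbhd E a"
      using height_support[of a] even_odd[of u a] u E_sym by (auto simp: Vk_def V_odd_def mem_nbhd)
  qed
  have "\<exists>a. E u a \<and> (\<exists>l. E a l \<and> leaf E l)"
  proof (cases "leaf E u")
    case True
    then show ?thesis using neighbour_exists[of u] u E_sym by (auto simp: V_even_def)
  qed (use nonleaf_adjacent_support u in blast)
  then show ?thesis unfolding V1 using support_unique[OF u] by blast
qed

text \<open>Vertices of height 3 have no leaf neighbours, so they can meet the block of
  \<open>a\<close> only in its one nonleaf. If the block consists of leaves, any of them serves as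
  \<open>x\<close>.\<close>

lemma support_root:
  assumes a: "a \<in> Vk V E 1"
  shows "\<exists>x\<in>nbhd E a. \<forall>z\<in>Vk V E 3. nbhd E z \<inter> nbhd E a \<subseteq> {x}"
proof -
  have odd: "a \<in> V_odd V E" using a by (simp add: odd_height)
  obtain l where l: "E a l" "leaf E l" using height_support[OF odd] a by (auto simp: Vk_def)
  have nl: "\<not> leaf E y" if "z \<in> Vk V E 3" "y \<in> nbhd E z" for z y
    using height_support[of z] that by (auto simp: odd_height mem_nbhd Vk_def)
  show ?thesis
  proof (cases "\<exists>w. E a w \<and> \<not> leaf E w")
    case True
    then obtain w where w: "E a w" "\<not> leaf E w" by blast
    have "y = w" if "z \<in> Vk V E 3" "y \<in> nbhd E z" "y \<in> nbhd E a" for z y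
      using support_nonleaf_unique[OF l _ _ w] nl that by (simp add: mem_nbhd)
    then show ?thesis using w by (intro bexI[of _ w]) (auto simp: mem_nbhd)
  next
    case False
    then show ?thesis using l nl by (intro bexI[of _ l]) (auto simp: mem_nbhd)
  qed
qed

lemma odd_nbhd: "c \<in> V_odd V E \<Longrightarrow> nbhd E c \<subseteq> V_even V E \<and> card (nbhd E c) \<ge> 2"
proof
  assume c: "c \<in> V_odd V E"
  show "nbhd E c \<subseteq> V_even V E" using odd_even c by (auto simp: mem_nbhd)
  obtain p q where "E c p" "E c q" "p \<noteq> q" using odd_other_neighbour[OF c] by metis
  then have "{p, q} \<subseteq> nbhd E c" "card {p, q} = 2" by (auto simp: mem_nbhd)
  then show "card (nbhd E c) \<ge> 2" using card_mono[OF finite_nbhd] by metis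
qed

end

section \<open>Ideals and homogeneous polynomials\<close>

abbreviation "lookup \<equiv> Poly_Mapping.lookup"
abbreviation "keys \<equiv> Poly_Mapping.keys"
abbreviation "single \<equiv> Poly_Mapping.single"

lemma keys_minus_subset: "keys (p - q :: 'a \<Rightarrow>\<^sub>0 'b::ab_group_add) \<subseteq> keys p \<union> keys q"
  by (auto simp: in_keys_iff lookup_minus)

lemma keys_uminus: "keys (- p :: 'a \<Rightarrow>\<^sub>0 'b::ab_group_add) = keys p"
  by (auto simp: in_keys_iff)

lemma keys_plus_monomial: "keys (a + b :: 'v \<Rightarrow>\<^sub>0 nat) = keys a \<union> keys b"
  by (auto simp: in_keys_iff lookup_add)

lemma poly_ring_0: "0 \<in> poly_ring S" and poly_ring_1: "1 \<in> poly_ring S"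
  by (auto simp: poly_ring_def)

lemma poly_ring_add: "p \<in> poly_ring S \<Longrightarrow> q \<in> poly_ring S \<Longrightarrow> p + q \<in> poly_ring S"
  using keys_add[of p q] by (fastforce simp: poly_ring_def)

lemma poly_ring_minus: "p \<in> poly_ring S \<Longrightarrow> q \<in> poly_ring S \<Longrightarrow> p - q \<in> poly_ring S"
  using keys_minus_subset[of p q] by (fastforce simp: poly_ring_def)

lemma poly_ring_uminus: "p \<in> poly_ring S \<Longrightarrow> - p \<in> poly_ring S"
  by (simp add: poly_ring_def keys_uminus)

lemma poly_ring_mult: "p \<in> poly_ring S \<Longrightarrow> q \<in> poly_ring S \<Longrightarrow> p * q \<in> poly_ring S"
  using keys_mult[of p q] by (fastforce simp: poly_ring_def keys_plus_monomial)

lemma poly_ring_sum: "(\<And>i. i \<in> I \<Longrightarrow> f i \<in> poly_ring S) \<Longrightarrow> sum f I \<in> poly_ring S"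
  by (induction I rule: infinite_finite_induct) (auto simp: poly_ring_0 poly_ring_add)

lemma poly_ring_prod: "(\<And>i. i \<in> I \<Longrightarrow> f i \<in> poly_ring S) \<Longrightarrow> prod f I \<in> poly_ring S"
  by (induction I rule: infinite_finite_induct) (auto simp: poly_ring_1 poly_ring_mult)

lemma poly_ring_power: "p \<in> poly_ring S \<Longrightarrow> p ^ n \<in> poly_ring S"
  by (induction n) (auto simp: poly_ring_1 poly_ring_mult)

lemma poly_ring_single: "keys m \<subseteq> S \<Longrightarrow> single m c \<in> poly_ring S"
  by (auto simp: poly_ring_def)

lemma poly_ring_Const: "Const c \<in> poly_ring S"
  by (auto simp: Const_def intro!: poly_ring_single)

lemma poly_ring_Var: "v \<in> S \<Longrightarrow> Var v \<in> poly_ring S"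
  by (auto simp: Var_def intro!: poly_ring_single)

lemma max_ideal_subset: "max_ideal S \<subseteq> poly_ring S"
  by (auto simp: max_ideal_def)

lemma max_ideal_Var: "v \<in> S \<Longrightarrow> Var v \<in> max_ideal S"
proof -
  assume v: "v \<in> S"
  have "single v (1::nat) \<noteq> 0" by (metis keys_single keys_zero insert_not_empty one_neq_zero)
  then show ?thesis using poly_ring_Var[OF v] by (simp add: max_ideal_def Var_def lookup_single when_def)
qed

lemma sum_single: "p = (\<Sum>m\<in>keys p. single m (lookup p m))"
  by (rule poly_mapping_eqI)
    (auto simp: lookup_sum lookup_single when_def in_keys_iff sum.delta' if_distrib cong: if_cong)

lemma lookup_single_mult: "lookup (single t c * p) (t + m :: 'v \<Rightarrow>\<^sub>0 nat) = c * lookup p m"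
proof -
  have "single t c * p = (\<Sum>m\<in>keys p. single (t + m) (c * lookup p m))"
    by (subst sum_single[of p]) (simp add: sum_distrib_left mult_single)
  then show ?thesis
    by (auto simp: lookup_sum lookup_single when_def in_keys_iff sum.delta' if_distrib cong: if_cong)
qed

lemma lookup_single_mult_0:
  assumes "\<And>m. n \<noteq> t + m"
  shows "lookup (single t c * p) (n :: 'v \<Rightarrow>\<^sub>0 nat) = 0"
proof (rule ccontr)
  assume "\<not> ?thesis"
  then have "n \<in> keys (single t c * p)" by (simp add: in_keys_iff)
  then have "n \<in> {a + b | a b. a \<in> keys (single t c) \<and> b \<in> keys p}" using keys_mult by blast
  then show False using assms by (auto split: if_splits)
qed

lemma lookup_Const_mult: "lookup (Const c * p) m = c * lookup p m"
  using lookup_single_mult[of 0 c p m] by (simp add: Const_def)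

lemma max_ideal_add: "p \<in> max_ideal S \<Longrightarrow> q \<in> max_ideal S \<Longrightarrow> p + q \<in> max_ideal S"
  by (simp add: max_ideal_def poly_ring_add lookup_add)

lemma lookup_mult_0: "lookup (p * q :: ('v, 'k::comm_ring_1) mpoly) 0 = lookup p 0 * lookup q 0"
proof -
  have *: "lookup (single m c * q) 0 = (if m = 0 then c * lookup q 0 else 0)" for m :: "'v \<Rightarrow>\<^sub>0 nat" and c
  proof (cases "m = 0")
    case True
    then show ?thesis using lookup_single_mult[of 0 c q 0] by simp
  next
    case False
    have "0 \<noteq> m + n" for n
    proof
      assume "0 = m + n"
      then have "keys m \<union> keys n = {}" using keys_plus_monomial[of m n] by simp
      then show False using False by simp
    qed
    then have "lookup (single m c * q) 0 = 0" by (rule lookup_single_mult_0)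
    then show ?thesis using False by simp
  qed
  have "lookup (p * q) 0 = (\<Sum>m\<in>keys p. lookup (single m (lookup p m) * q) 0)"
    by (subst sum_single[of p]) (simp add: sum_distrib_right lookup_sum)
  also have "\<dots> = lookup p 0 * lookup q 0"
    by (simp add: * sum.delta' in_keys_iff)
  finally show ?thesis .
qed

lemma max_ideal_mult: "r \<in> poly_ring S \<Longrightarrow> p \<in> max_ideal S \<Longrightarrow> r * p \<in> max_ideal S"
  by (simp add: max_ideal_def poly_ring_mult lookup_mult_0)

definition ideal_in :: "'v set \<Rightarrow> ('v, 'k::comm_ring_1) mpoly set \<Rightarrow> bool" where
  "ideal_in S J \<longleftrightarrow> J \<subseteq> poly_ring S \<and> 0 \<in> J \<and> (\<forall>a\<in>J. \<forall>b\<in>J. a + b \<in> J) \<and>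
     (\<forall>r\<in>poly_ring S. \<forall>a\<in>J. r * a \<in> J)"

lemma ideal_inD:
  assumes "ideal_in S J"
  shows "a \<in> J \<Longrightarrow> a \<in> poly_ring S" "0 \<in> J" "a \<in> J \<Longrightarrow> b \<in> J \<Longrightarrow> a + b \<in> J"
    "r \<in> poly_ring S \<Longrightarrow> a \<in> J \<Longrightarrow> r * a \<in> J" "r \<in> poly_ring S \<Longrightarrow> a \<in> J \<Longrightarrow> a * r \<in> J"
    "a \<in> J \<Longrightarrow> - a \<in> J" "a \<in> J \<Longrightarrow> b \<in> J \<Longrightarrow> a - b \<in> J"
proof -
  have *: "- a \<in> J" if "a \<in> J" for a
    using assms that poly_ring_uminus[OF poly_ring_1] unfolding ideal_in_def by (metis mult_minus1)
  then show "a \<in> J \<Longrightarrow> - a \<in> J" "a \<in> J \<Longrightarrow> b \<in> J \<Longrightarrow> a - b \<in> J"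
    using assms unfolding ideal_in_def by (simp, metis diff_conv_add_uminus)
qed (use assms in \<open>auto simp: ideal_in_def mult.commute\<close>)

lemma ideal_in_sum: "ideal_in S J \<Longrightarrow> (\<And>i. i \<in> I \<Longrightarrow> f i \<in> J) \<Longrightarrow> sum f I \<in> J"
  by (induction I rule: infinite_finite_induct) (auto dest: ideal_inD)

lemma ideal_in_max: "ideal_in S (max_ideal S)"
  by (simp add: ideal_in_def max_ideal_subset max_ideal_add max_ideal_mult) (simp add: max_ideal_def poly_ring_0)

lemma ideal_gen_alt: "ideal_gen S G = {p. \<exists>rs gs. length rs = length gs \<and> set rs \<subseteq> poly_ring S \<and>
    set gs \<subseteq> G \<and> p = sum_list (map2 (*) rs gs)}"
proof -
  have *: "(\<Sum>i<length gs. rs ! i * gs ! i) = sum_list (map2 (*) rs gs)" if "length rs = length gs"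
    for rs gs :: "('a, 'b) mpoly list"
    using that by (simp add: sum_list_sum_nth atLeast0LessThan)
  show ?thesis unfolding ideal_gen_def by (intro Collect_cong ex_cong1 conj_cong refl) (simp add: *)
qed

lemma ideal_in_ideal_gen:
  fixes G :: "('v, 'k::comm_ring_1) mpoly set"
  assumes "G \<subseteq> poly_ring S"
  shows "ideal_in S (ideal_gen S G)"
  unfolding ideal_in_def
proof (intro conjI ballI)
  show "ideal_gen S G \<subseteq> poly_ring S"
    using assms by (auto simp: ideal_gen_def intro!: poly_ring_sum poly_ring_mult) (meson nth_mem subsetD)
  show "0 \<in> ideal_gen S G" unfolding ideal_gen_alt by (auto intro!: exI[of _ "[]"])
  fix a b assume "a \<in> ideal_gen S G" "b \<in> ideal_gen S G"
  then obtain rs gs rs' gs' where h: "length rs = length gs" "set rs \<subseteq> poly_ring S" "set gs \<subseteq> G"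
      "a = sum_list (map2 (*) rs gs)" "length rs' = length gs'" "set rs' \<subseteq> poly_ring S" "set gs' \<subseteq> G"
      "b = sum_list (map2 (*) rs' gs')"
    unfolding ideal_gen_alt by blast
  then show "a + b \<in> ideal_gen S G" unfolding ideal_gen_alt
    by (intro CollectI exI[of _ "rs @ rs'"] exI[of _ "gs @ gs'"]) auto
next
  fix r a :: "('v, 'k) mpoly"
  assume r: "r \<in> poly_ring S" and "a \<in> ideal_gen S G"
  then obtain rs gs where h: "length rs = length gs" "set rs \<subseteq> poly_ring S" "set gs \<subseteq> G"
      "a = (\<Sum>i<length gs. rs ! i * gs ! i)"
    unfolding ideal_gen_def by blast
  then show "r * a \<in> ideal_gen S G" unfolding ideal_gen_def
    by (intro CollectI exI[of _ "map ((*) r) rs"] exI[of _ gs])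
      (use r in \<open>auto simp: sum_distrib_left mult.assoc intro!: poly_ring_mult\<close>)
qed

lemma ideal_gen_superset: "G \<subseteq> ideal_gen S G"
proof
  fix g assume "g \<in> G"
  then show "g \<in> ideal_gen S G" unfolding ideal_gen_alt
    by (intro CollectI exI[of _ "[1]"] exI[of _ "[g]"]) (auto simp: poly_ring_1)
qed

lemma ideal_gen_least:
  assumes "ideal_in S J" "G \<subseteq> J"
  shows "ideal_gen S G \<subseteq> J"
proof
  fix p assume "p \<in> ideal_gen S G"
  then obtain rs gs where h: "length rs = length gs" "set rs \<subseteq> poly_ring S" "set gs \<subseteq> G"
      "p = (\<Sum>i<length gs. rs ! i * gs ! i)"
    unfolding ideal_gen_def by blast
  have "rs ! i * gs ! i \<in> J" if i: "i < length gs" for i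
  proof (rule ideal_inD(4)[OF assms(1)])
    show "rs ! i \<in> poly_ring S" "gs ! i \<in> J"
      using h(1-3) i assms(2) nth_mem[of i rs] nth_mem[of i gs] by fastforce+
  qed
  then show "p \<in> J" unfolding h(4) by (intro ideal_in_sum[OF assms(1)]) simp
qed

text \<open>For an ideal \<open>J\<close>, the ideal generated by \<open>J\<close> and
  \<open>z\<close>; the explicit form hands over the multiplier of \<open>z\<close>, which the
  exchange arguments manipulate.\<close>

definition adjoin :: "'v set \<Rightarrow> ('v, 'k::comm_ring_1) mpoly set \<Rightarrow> ('v, 'k) mpoly \<Rightarrow> ('v, 'k) mpoly set" where
  "adjoin S J z = {j + r * z | j r. j \<in> J \<and> r \<in> poly_ring S}"

lemma adjoinI: "j \<in> J \<Longrightarrow> r \<in> poly_ring S \<Longrightarrow> j + r * z \<in> adjoin S J z"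
  by (auto simp: adjoin_def)

lemma adjoinE:
  assumes "p \<in> adjoin S J z" obtains j r where "j \<in> J" "r \<in> poly_ring S" "p = j + r * z"
  using assms by (auto simp: adjoin_def)

lemma adjoin_superset: "J \<subseteq> adjoin S J z"
  using adjoinI[of _ J 0 S z] by (auto simp: poly_ring_0)

lemma adjoin_mem: "ideal_in S J \<Longrightarrow> r \<in> poly_ring S \<Longrightarrow> r * z \<in> adjoin S J z"
  using adjoinI[of 0 J r S z] ideal_inD(2) by auto

lemma ideal_in_adjoin:
  fixes J :: "('v, 'k::comm_ring_1) mpoly set"
  assumes "ideal_in S J" "z \<in> poly_ring S"
  shows "ideal_in S (adjoin S J z)"
  unfolding ideal_in_def
proof (intro conjI ballI)
  show "adjoin S J z \<subseteq> poly_ring S"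
    using assms by (auto simp: adjoin_def intro!: poly_ring_add poly_ring_mult dest: ideal_inD(1))
  show "0 \<in> adjoin S J z" using adjoin_superset ideal_inD(2)[OF assms(1)] by blast
  fix a b assume "a \<in> adjoin S J z" "b \<in> adjoin S J z"
  then obtain j r j' r' where "j \<in> J" "r \<in> poly_ring S" "a = j + r * z"
    "j' \<in> J" "r' \<in> poly_ring S" "b = j' + r' * z" by (elim adjoinE)
  then show "a + b \<in> adjoin S J z"
    using adjoinI[of "j + j'" J "r + r'" S z] assms by (simp add: algebra_simps ideal_inD poly_ring_add)
next
  fix s a :: "('v, 'k) mpoly"
  assume "s \<in> poly_ring S" "a \<in> adjoin S J z"
  then obtain j r where "j \<in> J" "r \<in> poly_ring S" "a = j + r * z" by (elim adjoinE)
  then show "s * a \<in> adjoin S J z"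
    using adjoinI[of "s * j" J "s * r" S z] assms \<open>s \<in> poly_ring S\<close>
    by (simp add: algebra_simps ideal_inD poly_ring_mult)
qed

lemma ideal_gen_insert:
  assumes "G \<subseteq> poly_ring S" "z \<in> poly_ring S"
  shows "ideal_gen S (insert z G) = adjoin S (ideal_gen S G) z"
proof
  have iG: "ideal_in S (ideal_gen S G)" using ideal_in_ideal_gen assms by blast
  show "ideal_gen S (insert z G) \<subseteq> adjoin S (ideal_gen S G) z"
    using adjoin_superset ideal_gen_superset adjoin_mem[OF iG poly_ring_1, of z]
    by (intro ideal_gen_least ideal_in_adjoin iG assms) fastforce
  have iz: "ideal_in S (ideal_gen S (insert z G))" using ideal_in_ideal_gen assms by blast
  have "ideal_gen S G \<subseteq> ideal_gen S (insert z G)"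
    by (rule ideal_gen_least[OF iz]) (use ideal_gen_superset[of "insert z G" S] in simp)
  moreover have "z \<in> ideal_gen S (insert z G)" using ideal_gen_superset[of "insert z G" S] by simp
  ultimately show "adjoin S (ideal_gen S G) z \<subseteq> ideal_gen S (insert z G)"
    by (auto simp: adjoin_def intro!: ideal_inD(3,4)[OF iz])
qed

section \<open>Total degree and homogeneous components\<close>

lemma tdeg_superset: "finite X \<Longrightarrow> keys m \<subseteq> X \<Longrightarrow> tdeg m = (\<Sum>v\<in>X. lookup m v)"
  unfolding tdeg_def by (rule sum.mono_neutral_left) (auto simp: in_keys_iff)

lemma tdeg_add: "tdeg (a + b) = tdeg a + tdeg b"
proof -
  have f: "finite (keys a \<union> keys b)" by simp
  show ?thesis
    using tdeg_superset[OF f, of a] tdeg_superset[OF f, of b] tdeg_superset[OF f, of "a + b"]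
    by (simp add: keys_plus_monomial lookup_add sum.distrib)
qed

lemma tdeg_eq_0_iff: "tdeg m = 0 \<longleftrightarrow> m = 0"
proof
  assume "tdeg m = 0"
  then have "\<forall>v\<in>keys m. lookup m v = 0" by (simp add: tdeg_def)
  then show "m = 0" by (intro poly_mapping_eqI) (auto simp: in_keys_iff)
qed (simp add: tdeg_def)

text \<open>Homogeneity with the degree named; the zero polynomial has every degree.\<close>

definition hom_deg :: "nat \<Rightarrow> ('v, 'k::comm_ring_1) mpoly \<Rightarrow> bool" where
  "hom_deg d p \<longleftrightarrow> (\<forall>m\<in>keys p. tdeg m = d)"

definition hom_part :: "nat \<Rightarrow> ('v, 'k::comm_ring_1) mpoly \<Rightarrow> ('v, 'k) mpoly" where
  "hom_part d p = (\<Sum>m\<in>{m\<in>keys p. tdeg m = d}. single m (lookup p m))"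

lemma homogeneous_iff: "homogeneous p \<longleftrightarrow> (\<exists>d. hom_deg d p)"
  by (simp add: homogeneous_def hom_deg_def)

lemma lookup_hom_part: "lookup (hom_part d p) m = (if tdeg m = d then lookup p m else 0)"
  unfolding hom_part_def
  by (auto simp: lookup_sum lookup_single when_def in_keys_iff sum.delta' if_distrib cong: if_cong)

lemma hom_part_add: "hom_part d (p + q) = hom_part d p + hom_part d q"
  by (rule poly_mapping_eqI) (simp add: lookup_hom_part lookup_add)

lemma hom_part_0: "hom_part d 0 = 0"
  by (rule poly_mapping_eqI) (simp add: lookup_hom_part)

lemma hom_part_sum: "hom_part d (sum f I) = (\<Sum>i\<in>I. hom_part d (f i))"
  by (induction I rule: infinite_finite_induct) (auto simp: hom_part_0 hom_part_add)

lemma hom_deg_hom_part: "hom_deg d (hom_part d p)"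
  by (auto simp: hom_deg_def in_keys_iff lookup_hom_part split: if_splits)

lemma hom_part_hom: "hom_deg e p \<Longrightarrow> hom_part d p = (if d = e then p else 0)"
  by (rule poly_mapping_eqI) (auto simp: lookup_hom_part hom_deg_def in_keys_iff)

lemma poly_ring_hom_part: "p \<in> poly_ring S \<Longrightarrow> hom_part d p \<in> poly_ring S"
  by (auto simp: poly_ring_def in_keys_iff lookup_hom_part split: if_splits)

lemma sum_hom_part: "p = (\<Sum>d\<in>tdeg ` keys p. hom_part d p)"
  by (rule poly_mapping_eqI)
    (auto simp: lookup_sum lookup_hom_part in_keys_iff sum.delta' if_distrib cong: if_cong)

lemma hom_deg_0: "hom_deg d 0"
  by (simp add: hom_deg_def)

lemma hom_deg_1: "hom_deg 0 1"
  by (simp add: hom_deg_def tdeg_eq_0_iff)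

lemma hom_deg_add: "hom_deg d p \<Longrightarrow> hom_deg d q \<Longrightarrow> hom_deg d (p + q)"
  using keys_add[of p q] by (auto simp: hom_deg_def)

lemma hom_deg_mult: "hom_deg d p \<Longrightarrow> hom_deg e q \<Longrightarrow> hom_deg (d + e) (p * q)"
  using keys_mult[of p q] by (fastforce simp: hom_deg_def tdeg_add)

lemma hom_deg_power: "hom_deg d p \<Longrightarrow> hom_deg (d * n) (p ^ n)"
  by (induction n) (auto simp: hom_deg_1 intro: hom_deg_mult)

text \<open>Multiplication by a form of degree \<open>e\<close> shifts components. The case split
  guards against truncation in \<open>d - e\<close>.\<close>

lemma hom_part_mult:
  assumes "hom_deg e z"
  shows "hom_part d (f * z) = (if e \<le> d then hom_part (d - e) f * z else 0)"
proof -
  have "hom_part d (hom_part i f * z) = (if i + e = d then hom_part i f * z else 0)" for i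
    using hom_part_hom[OF hom_deg_mult[OF hom_deg_hom_part assms], of d i f] by auto
  then have "hom_part d (f * z) = (\<Sum>i\<in>tdeg ` keys f. if i + e = d then hom_part i f * z else 0)"
    by (subst sum_hom_part[of f]) (simp add: sum_distrib_right hom_part_sum)
  also have "\<dots> = (\<Sum>i\<in>tdeg ` keys f. if i = d - e then (if e \<le> d then hom_part i f * z else 0) else 0)"
    by (intro sum.cong) auto
  also have "\<dots> = (if e \<le> d then hom_part (d - e) f * z else 0)"
  proof (cases "d - e \<in> tdeg ` keys f")
    case False
    then have "hom_part (d - e) f = 0"
      by (intro poly_mapping_eqI) (auto simp: lookup_hom_part image_iff, metis in_keys_iff)
    then show ?thesis using False by (auto simp: sum.delta)
  qed (auto simp: sum.delta)
  finally show ?thesis .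
qed

text \<open>The positive degree makes descents on the degree terminate. The zero polynomial is given
  degree 1 by convention.\<close>

lemma max_ideal_hom_deg:
  assumes "z \<in> max_ideal S" "homogeneous z" obtains e where "e \<ge> 1" "hom_deg e z"
proof (cases "z = 0")
  case True
  then show ?thesis using that[of 1] by (simp add: hom_deg_0)
next
  case False
  obtain e where e: "hom_deg e z" using assms(2) homogeneous_iff by blast
  obtain m where m: "m \<in> keys z" using False by fastforce
  have "m \<noteq> 0" using m assms(1) by (auto simp: max_ideal_def in_keys_iff)
  moreover have "tdeg m = e" using e m by (simp add: hom_deg_def)
  ultimately have "e \<noteq> 0" using tdeg_eq_0_iff[of m] by auto
  then show ?thesis using that[of e] e by simp
qed

definition hom_ideal :: "'v set \<Rightarrow> ('v, 'k::comm_ring_1) mpoly set \<Rightarrow> bool" where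
  "hom_ideal S J \<longleftrightarrow> ideal_in S J \<and> J \<subseteq> max_ideal S \<and> (\<forall>p\<in>J. \<forall>d. hom_part d p \<in> J)"

lemma hom_ideal_adjoin:
  assumes J: "hom_ideal S J" and z: "z \<in> max_ideal S" "homogeneous z"
  shows "hom_ideal S (adjoin S J z)"
  unfolding hom_ideal_def
proof (intro conjI ballI allI)
  have iJ: "ideal_in S J" using J by (simp add: hom_ideal_def)
  have zR: "z \<in> poly_ring S" using z max_ideal_subset by blast
  show ia: "ideal_in S (adjoin S J z)" using ideal_in_adjoin[OF iJ zR] .
  show "adjoin S J z \<subseteq> max_ideal S"
    using J z by (auto simp: adjoin_def hom_ideal_def intro!: max_ideal_add max_ideal_mult)
  fix p d assume "p \<in> adjoin S J z"
  then obtain j r where p: "j \<in> J" "r \<in> poly_ring S" "p = j + r * z" by (elim adjoinE)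
  obtain e where "hom_deg e z" using z homogeneous_iff by blast
  then have *: "hom_part d p = hom_part d j + (if e \<le> d then hom_part (d - e) r else 0) * z"
    using p by (simp add: hom_part_add hom_part_mult)
  show "hom_part d p \<in> adjoin S J z"
    unfolding * by (rule adjoinI) (use p J in \<open>auto intro!: poly_ring_hom_part poly_ring_0 simp: hom_ideal_def\<close>)
qed

text \<open>The elements of the ideal whose components all stay in it form an ideal \<open>Q\<close>
  containing the generators, hence \<open>Q\<close> is everything.\<close>

lemma hom_ideal_ideal_gen:
  fixes G :: "('v, 'k::comm_ring_1) mpoly set"
  assumes "G \<subseteq> max_ideal S" "\<forall>g\<in>G. homogeneous g"
  shows "hom_ideal S (ideal_gen S G)"
proof -
  have i: "ideal_in S (ideal_gen S G)" using assms ideal_in_ideal_gen max_ideal_subset by blast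
  define Q where "Q = {p \<in> ideal_gen S G. \<forall>d. hom_part d p \<in> ideal_gen S G}"
  have "ideal_in S Q"
    unfolding ideal_in_def
  proof (intro conjI ballI)
    show "Q \<subseteq> poly_ring S" using i by (auto simp: Q_def dest: ideal_inD(1))
    show "0 \<in> Q" using ideal_inD(2)[OF i] by (simp add: Q_def hom_part_0)
    show "a + b \<in> Q" if "a \<in> Q" "b \<in> Q" for a b
      using that ideal_inD(3)[OF i] by (simp add: Q_def hom_part_add)
    fix r a :: "('v, 'k) mpoly"
    assume r: "r \<in> poly_ring S" and a: "a \<in> Q"
    have "hom_part d (r * hom_part j a) \<in> ideal_gen S G" for d j
      using ideal_inD(2,4)[OF i] r a
      by (auto simp: hom_part_mult[OF hom_deg_hom_part] Q_def poly_ring_hom_part)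
    then have "hom_part d (r * a) \<in> ideal_gen S G" for d
      by (subst sum_hom_part[of a]) (auto simp: sum_distrib_left hom_part_sum intro!: ideal_in_sum[OF i])
    then show "r * a \<in> Q" using ideal_inD(4)[OF i r] a by (simp add: Q_def)
  qed
  moreover have "G \<subseteq> Q"
  proof
    fix g assume g: "g \<in> G"
    then obtain e where "hom_deg e g" using assms homogeneous_iff by blast
    then show "g \<in> Q" using g ideal_gen_superset[of G S] ideal_inD(2)[OF i]
      by (auto simp: Q_def hom_part_hom)
  qed
  ultimately have "ideal_gen S G \<subseteq> Q" by (rule ideal_gen_least)
  then show ?thesis
    using i ideal_gen_least[OF ideal_in_max assms(1)] by (auto simp: hom_ideal_def Q_def)
qed

section \<open>Noetherianity and regular elements\<close>

text \<open>The subsequence always passes to an index minimising \<open>b\<close> on the remaining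
  tail.\<close>

lemma incseq_subsequence_nat:
  fixes b :: "nat \<Rightarrow> nat"
  shows "\<exists>s :: nat \<Rightarrow> nat. strict_mono s \<and> mono (\<lambda>i. b (s i))"
proof -
  have argmin: "\<exists>y>x. \<forall>m>x. b y \<le> b m" for x
    using ex_has_least_nat[of "\<lambda>m. x < m" "Suc x" b] by blast
  have "\<exists>s. \<forall>n. (\<forall>m\<ge>s n. b (s n) \<le> b m) \<and> s n < s (Suc n)"
  proof (rule dependent_nat_choice)
    show "\<exists>x. \<forall>m\<ge>x. b x \<le> b m" using argmin[of 0] by (meson less_le_trans)
    show "\<exists>y. (\<forall>m\<ge>y. b y \<le> b m) \<and> x < y" if "\<forall>m\<ge>x. b x \<le> b m" for x and n :: nat
      using argmin[of x] by (meson less_le_trans)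
  qed
  then obtain s where s: "\<And>n m. m \<ge> s n \<Longrightarrow> b (s n) \<le> b m" "\<And>n. s n < s (Suc n)" by blast
  have "strict_mono s" using s(2) by (simp add: strict_mono_Suc_iff)
  moreover have "mono (\<lambda>i. b (s i))"
    using s(1) \<open>strict_mono s\<close> by (intro monoI) (simp add: strict_mono_less_eq)
  ultimately show ?thesis by blast
qed

text \<open>Dickson's lemma in subsequence form: the sequence is thinned once for each
  variable.\<close>

lemma dickson_subsequence:
  fixes a :: "nat \<Rightarrow> 'v \<Rightarrow> nat"
  assumes "finite S"
  shows "\<exists>r :: nat \<Rightarrow> nat. strict_mono r \<and> (\<forall>v\<in>S. mono (\<lambda>i. a (r i) v))"
  using assms
proof (induction S)
  case empty
  then show ?case by (intro exI[of _ id]) (auto simp: strict_mono_def)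
next
  case (insert v S)
  then obtain r :: "nat \<Rightarrow> nat" where r: "strict_mono r" "\<And>u. u \<in> S \<Longrightarrow> mono (\<lambda>i. a (r i) u)" by auto
  obtain s :: "nat \<Rightarrow> nat" where s: "strict_mono s" "mono (\<lambda>i. a (r (s i)) v)"
    using incseq_subsequence_nat[of "\<lambda>i. a (r i) v"] by blast
  have "mono (\<lambda>i. a (r (s i)) u)" if "u \<in> S" for u
    using r(2)[OF that] strict_mono_mono[OF s(1)] unfolding mono_def by blast
  then show ?case using s r(1)
    by (intro exI[of _ "r \<circ> s"]) (auto simp: strict_mono_def)
qed

text \<open>Encoding monomials by products of prime powers gives a monomial order that is a
  well-order because its values are natural numbers.\<close>

lemma monomial_weight_exists:
  assumes "finite S"
  shows "\<exists>w :: ('v \<Rightarrow>\<^sub>0 nat) \<Rightarrow> nat. (\<forall>a b. w (a + b) = w a * w b) \<and> (\<forall>a. w a > 0) \<and>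
    inj_on w {m. keys m \<subseteq> S}"
proof -
  obtain T :: "nat set" where T: "T \<subseteq> {p. prime p}" "finite T" "card T = card S"
    using infinite_arbitrarily_large[OF primes_infinite] by blast
  then obtain \<pi> where \<pi>: "bij_betw \<pi> S T"
    using finite_same_card_bij[OF assms T(2)] by metis
  define w where "w m = (\<Prod>v\<in>S. \<pi> v ^ lookup m v)" for m :: "'v \<Rightarrow>\<^sub>0 nat"
  have pr: "prime (\<pi> v)" if "v \<in> S" for v using \<pi> T(1) that bij_betwE by blast
  have mult: "multiplicity (\<pi> v) (w m) = lookup m v" if "v \<in> S" for v m
  proof -
    have inv: "the_inv_into S \<pi> (\<pi> u) = u" if "u \<in> S" for u
      using \<pi> that by (meson bij_betw_def the_inv_into_f_f)
    have "w m = (\<Prod>p\<in>T. p ^ lookup m (the_inv_into S \<pi> p))"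
      unfolding w_def by (rule prod.reindex_bij_betw[OF \<pi>, symmetric, THEN trans, symmetric]) (simp_all add: inv)
    then show ?thesis
      using multiplicity_prod_prime_powers[of T "\<pi> v" "\<lambda>p. lookup m (the_inv_into S \<pi> p)"] T pr[OF that]
        bij_betwE[OF \<pi>] that inv[OF that] by auto
  qed
  have "inj_on w {m. keys m \<subseteq> S}"
  proof (rule inj_onI, rule poly_mapping_eqI)
    fix a b v assume "a \<in> {m. keys m \<subseteq> S}" "b \<in> {m. keys m \<subseteq> S}" "w a = w b"
    then show "lookup a v = lookup b v"
      using mult[of v a] mult[of v b] by (cases "v \<in> S") (simp_all, metis in_keys_iff subsetD)
  qed
  moreover have "w (a + b) = w a * w b" for a b
    by (simp add: w_def lookup_add power_add prod.distrib)
  moreover have "w a > 0" for a unfolding w_def using pr prime_gt_0_nat by (intro prod_pos) auto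
  ultimately show ?thesis by blast
qed

text \<open>Noetherianity through leading monomials with respect to \<open>w\<close>. Among the
  elements new at step \<open>n\<close>, one with the smallest leading monomial has a leading
  monomial that does not occur in \<open>I n\<close>, since subtracting a multiple would otherwise
  produce a smaller new one. By Dickson an earlier of these monomials divides a later one, and
  multiplying by the quotient contradicts this.\<close>

lemma chain_stationary:
  fixes I :: "nat \<Rightarrow> ('v, 'k::field) mpoly set"
  assumes S: "finite S" and ideal: "\<And>n. ideal_in S (I n)" and mono: "\<And>n. I n \<subseteq> I (Suc n)"
  shows "\<exists>n. I n = I (Suc n)"
proof (rule ccontr)
  assume "\<not> ?thesis"
  then have ne: "I n \<noteq> I (Suc n)" for n by blast
  obtain w :: "('v \<Rightarrow>\<^sub>0 nat) \<Rightarrow> nat" where w: "\<And>a b. w (a + b) = w a * w b" "\<And>a. w a > 0"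
    and inj: "inj_on w {m. keys m \<subseteq> S}"
    using monomial_weight_exists[OF S] by blast
  define lead where "lead p m \<longleftrightarrow> m \<in> keys p \<and> (\<forall>m'\<in>keys p. w m' \<le> w m)" for p :: "('v, 'k) mpoly" and m
  have lead_ex: "\<exists>m. lead p m" if "p \<noteq> 0" for p
  proof -
    have "keys p \<noteq> {}" using that by simp
    then obtain m where "m \<in> keys p" "w m = Max (w ` keys p)"
      using Max_in[of "w ` keys p"] by fastforce
    then show ?thesis unfolding lead_def by (intro exI[of _ m]) simp
  qed
  have "\<exists>f m. f \<in> I (Suc n) \<and> lead f m \<and> (\<forall>g\<in>I n. \<not> lead g m)" for n
  proof -
    define Q where "Q = (\<lambda>(f, m). f \<in> I (Suc n) - I n \<and> lead f m)"
    obtain f0 where f0: "f0 \<in> I (Suc n) - I n" using ne[of n] mono[of n] by blast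
    then have "f0 \<noteq> 0" using ideal_inD(2)[OF ideal] by blast
    then obtain m0 where "Q (f0, m0)" using lead_ex f0 by (auto simp: Q_def)
    then obtain fm where "Q fm" and least: "\<And>fm'. Q fm' \<Longrightarrow> w (snd fm) \<le> w (snd fm')"
      using ex_has_least_nat[of Q "(f0, m0)" "\<lambda>fm. w (snd fm)"] by blast
    obtain f m where "fm = (f, m)" by force
    then have f: "f \<in> I (Suc n)" "f \<notin> I n" "lead f m" using \<open>Q fm\<close> by (auto simp: Q_def)
    have min: "w m \<le> w m'" if "f' \<in> I (Suc n)" "f' \<notin> I n" "lead f' m'" for f' m'
      using least[of "(f', m')"] that \<open>fm = (f, m)\<close> by (simp add: Q_def)
    have "\<not> lead g m" if g: "g \<in> I n" for g
    proof
      assume lg: "lead g m"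
      define c where "c = lookup f m / lookup g m"
      define h where "h = f - Const c * g"
      have cg: "Const c * g \<in> I n" using ideal_inD(4)[OF ideal poly_ring_Const g] .
      have h: "h \<in> I (Suc n)" "h \<notin> I n"
        using ideal_inD(7)[OF ideal f(1)] cg mono f(2) ideal_inD(3)[OF ideal _ cg, of h]
        by (auto simp: h_def)
      then have "h \<noteq> 0" using ideal_inD(2)[OF ideal] by blast
      then obtain m' where m': "lead h m'" using lead_ex by blast
      have "lookup g m \<noteq> 0" using lg by (simp add: lead_def in_keys_iff)
      then have "lookup h m = 0" by (simp add: h_def c_def lookup_minus lookup_Const_mult)
      then have "m' \<noteq> m" using m' by (auto simp: lead_def in_keys_iff)
      have "m' \<in> keys f \<union> keys g" using m'
        by (auto simp: lead_def in_keys_iff h_def lookup_minus lookup_Const_mult)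
      then have "w m' \<le> w m" using f(3) lg by (auto simp: lead_def)
      moreover have "w m' \<noteq> w m"
      proof
        assume "w m' = w m"
        moreover have "keys m' \<subseteq> S" "keys m \<subseteq> S"
          using m' f(3) ideal_inD(1)[OF ideal h(1)] ideal_inD(1)[OF ideal f(1)]
          by (auto simp: lead_def poly_ring_def)
        ultimately show False using inj_onD[OF inj, of m' m] \<open>m' \<noteq> m\<close> by simp
      qed
      ultimately show False using min[OF h m'] by simp
    qed
    then show ?thesis using f by blast
  qed
  then obtain f m where f: "\<And>n. f n \<in> I (Suc n)" "\<And>n. lead (f n) (m n)" "\<And>n g. g \<in> I n \<Longrightarrow> \<not> lead g (m n)"
    by metis
  obtain r :: "nat \<Rightarrow> nat" where r: "strict_mono r" "\<And>v. v \<in> S \<Longrightarrow> mono (\<lambda>i. lookup (m (r i)) v)"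
    using dickson_subsequence[OF S, of "\<lambda>i. lookup (m i)"] by blast
  define i j where "i = r 0" and "j = r 1"
  have ij: "i < j" using r(1) by (simp add: i_def j_def strict_mono_def)
  have keys_S: "keys (m n) \<subseteq> S" for n
    using f(2)[of n] ideal_inD(1)[OF ideal f(1)[of n]] by (auto simp: lead_def poly_ring_def)
  have le: "lookup (m i) v \<le> lookup (m j) v" for v
  proof (cases "v \<in> S")
    case True
    then show ?thesis using r(2) by (simp add: mono_def i_def j_def)
  next
    case False
    then have "lookup (m i) v = 0" using keys_S[of i] by (metis in_keys_iff subsetD)
    then show ?thesis by simp
  qed
  define t where "t = m j - m i"
  have t: "t + m i = m j"
    by (rule poly_mapping_eqI) (simp add: t_def lookup_add lookup_minus le)
  have "f i \<in> I j" using f(1)[of i] lift_Suc_mono_le[of I "Suc i" j] mono ij by auto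
  moreover have "keys t \<subseteq> S" using keys_S[of j] t keys_plus_monomial[of t "m i"] by auto
  ultimately have "single t 1 * f i \<in> I j" using ideal_inD(4)[OF ideal poly_ring_single] by blast
  moreover have "lead (single t 1 * f i) (m j)"
    unfolding lead_def
  proof (intro conjI ballI)
    show "m j \<in> keys (single t 1 * f i)"
      using lookup_single_mult[of t 1 "f i" "m i"] f(2)[of i] t by (auto simp: lead_def in_keys_iff)
    fix m' assume "m' \<in> keys (single t 1 * f i)"
    then obtain m'' where "m'' \<in> keys (f i)" "m' = t + m''"
      using keys_mult[of "single t 1" "f i"] by (auto split: if_splits)
    then show "w m' \<le> w (m j)" using f(2)[of i] w(1)[of t] t by (simp add: lead_def flip: t)
  qed
  ultimately show False using f(3) by blast
qed

text \<open>A nonzerodivisor modulo \<open>J\<close>. That the quotient is nonzero is recorded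
  elsewhere, in the containment in \<open>max_ideal S\<close> of a \<open>hom_ideal\<close>.\<close>

definition regular_on :: "'v set \<Rightarrow> ('v, 'k::comm_ring_1) mpoly set \<Rightarrow> ('v, 'k) mpoly \<Rightarrow> bool" where
  "regular_on S J z \<longleftrightarrow> (\<forall>f\<in>poly_ring S. f * z \<in> J \<longrightarrow> f \<in> J)"

text \<open>The preimage in the polynomial ring of the socle of the quotient by \<open>J\<close>;
  thus \<open>socle S J \<subseteq> J\<close> says that the socle is zero.\<close>

definition socle :: "'v set \<Rightarrow> ('v, 'k::comm_ring_1) mpoly set \<Rightarrow> ('v, 'k) mpoly set" where
  "socle S J = colon S J (max_ideal S)"

lemma socleD: "s \<in> socle S J \<Longrightarrow> s \<in> poly_ring S" "s \<in> socle S J \<Longrightarrow> g \<in> max_ideal S \<Longrightarrow> s * g \<in> J"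
  by (auto simp: socle_def colon_def)

lemma hom_idealD:
  assumes "hom_ideal S J"
  shows "ideal_in S J" "J \<subseteq> max_ideal S" "p \<in> J \<Longrightarrow> hom_part d p \<in> J"
  using assms by (auto simp: hom_ideal_def)

lemma regular_on_homI:
  assumes J: "hom_ideal S J" and y: "homogeneous y"
    and reg: "\<And>d f. hom_deg d f \<Longrightarrow> f \<in> poly_ring S \<Longrightarrow> f * y \<in> J \<Longrightarrow> f \<in> J"
  shows "regular_on S J y"
  unfolding regular_on_def
proof (intro ballI impI)
  fix f assume f: "f \<in> poly_ring S" "f * y \<in> J"
  obtain e where e: "hom_deg e y" using y homogeneous_iff by blast
  have "hom_part d f \<in> J" for d
  proof (rule reg[OF hom_deg_hom_part poly_ring_hom_part[OF f(1)]])
    show "hom_part d f * y \<in> J" using hom_idealD(3)[OF J f(2), of "d + e"] by (simp add: hom_part_mult[OF e])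
  qed
  then show "f \<in> J" by (subst sum_hom_part[of f]) (intro ideal_in_sum[OF hom_idealD(1)[OF J]])
qed

text \<open>The descent on degrees is the graded form of Nakayama's lemma.\<close>

lemma regular_swap_first:
  fixes J :: "('v, 'k::comm_ring_1) mpoly set"
  assumes J: "hom_ideal S J" and x: "x \<in> max_ideal S" "homogeneous x" and y: "y \<in> poly_ring S" "homogeneous y"
    and reg: "regular_on S J x" "regular_on S (adjoin S J x) y"
  shows "regular_on S J y"
proof (rule regular_on_homI[OF J y(2)])
  note iJ = hom_idealD(1)[OF J]
  obtain e where e: "e \<ge> 1" "hom_deg e x" using max_ideal_hom_deg x by blast
  fix d and f :: "('v, 'k) mpoly" assume "hom_deg d f" "f \<in> poly_ring S" "f * y \<in> J"
  then show "f \<in> J"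
  proof (induction d arbitrary: f rule: less_induct)
    case (less d)
    have "f * y \<in> adjoin S J x" using adjoin_superset less.prems(3) by blast
    then have "f \<in> adjoin S J x" using reg(2) less.prems(2) by (simp add: regular_on_def)
    then obtain j r where jr: "j \<in> J" "r \<in> poly_ring S" "f = j + r * x" by (elim adjoinE)
    have "f = hom_part d (j + r * x)" using hom_part_hom[OF less.prems(1), of d] jr by simp
    also have "\<dots> = hom_part d j + (if e \<le> d then hom_part (d - e) r * x else 0)"
      by (simp add: hom_part_add hom_part_mult[OF e(2)])
    finally have f: "f = hom_part d j + (if e \<le> d then hom_part (d - e) r * x else 0)" .
    show ?case
    proof (cases "e \<le> d")
      case True
      define r' where "r' = hom_part (d - e) r"
      have r': "r' \<in> poly_ring S" "hom_deg (d - e) r'"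
        by (auto simp: r'_def hom_deg_hom_part poly_ring_hom_part jr)
      have "r' * y * x = f * y - hom_part d j * y" using f True by (simp add: r'_def algebra_simps)
      also have "\<dots> \<in> J"
        using ideal_inD(7)[OF iJ less.prems(3)] ideal_inD(5)[OF iJ y(1)] hom_idealD(3)[OF J jr(1)] by simp
      finally have "r' * y \<in> J" using reg(1) r' y by (simp add: regular_on_def poly_ring_mult)
      moreover have "d - e < d" using True e by simp
      ultimately have "r' \<in> J" using less.IH r' by blast
      then show ?thesis
        using f True ideal_inD(3)[OF iJ hom_idealD(3)[OF J jr(1)]] ideal_inD(5)[OF iJ, of x r'] x max_ideal_subset
        by (auto simp: r'_def)
    qed (use f hom_idealD(3)[OF J jr(1)] in simp)
  qed
qed

text \<open>In \<open>f * x = j + r * y\<close>, regularity of \<open>y\<close> modulo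
  \<open>x\<close> makes \<open>r\<close> a multiple of \<open>x\<close> modulo \<open>J\<close>;
  after substituting this, \<open>x\<close> cancels.\<close>

lemma regular_swap_second:
  assumes J: "ideal_in S J" and x: "x \<in> poly_ring S" and y: "y \<in> poly_ring S"
    and reg: "regular_on S J x" "regular_on S (adjoin S J x) y"
  shows "regular_on S (adjoin S J y) x"
  unfolding regular_on_def
proof (intro ballI impI)
  fix f assume f: "f \<in> poly_ring S" "f * x \<in> adjoin S J y"
  then obtain j r where jr: "j \<in> J" "r \<in> poly_ring S" "f * x = j + r * y" by (elim adjoinE)
  have "r * y = - j + f * x" using jr by (simp add: algebra_simps)
  then have "r * y \<in> adjoin S J x" using adjoinI ideal_inD(6)[OF J] jr f by metis
  then have "r \<in> adjoin S J x" using reg(2) jr by (simp add: regular_on_def)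
  then obtain j' r' where jr': "j' \<in> J" "r' \<in> poly_ring S" "r = j' + r' * x" by (elim adjoinE)
  have "(f - r' * y) * x = j + j' * y" using jr(3) jr'(3) by (simp add: algebra_simps)
  also have "\<dots> \<in> J" by (rule ideal_inD(3)[OF J jr(1) ideal_inD(5)[OF J y jr'(1)]])
  finally have "f - r' * y \<in> J"
    using reg(1) f jr' y by (simp add: regular_on_def poly_ring_minus poly_ring_mult)
  then have "(f - r' * y) + r' * y \<in> adjoin S J y" using adjoinI jr' by blast
  then show "f \<in> adjoin S J y" by simp
qed

lemma adjoin_commute: "adjoin S (adjoin S J x) y = adjoin S (adjoin S J y) x"
proof -
  have "adjoin S (adjoin S J x) y \<subseteq> adjoin S (adjoin S J y) x" for x y
  proof
    fix p assume "p \<in> adjoin S (adjoin S J x) y"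
    then obtain q r where q: "q \<in> adjoin S J x" "r \<in> poly_ring S" "p = q + r * y" by (rule adjoinE)
    then obtain j s where j: "j \<in> J" "s \<in> poly_ring S" "q = j + s * x" by (elim adjoinE)
    have "p = (j + r * y) + s * x" using q j by simp
    then show "p \<in> adjoin S (adjoin S J y) x" using adjoinI q j by metis
  qed
  then show ?thesis by blast
qed

text \<open>The predicate minimised by \<open>quot_dim\<close>. The exchange transports it for each
  single \<open>n\<close>, hence also its least value; \<open>n = 0\<close> expresses that the
  quotient is zero.\<close>

definition spans :: "nat \<Rightarrow> ('v, 'k::field) mpoly set \<Rightarrow> ('v, 'k) mpoly set \<Rightarrow> bool" where
  "spans n A B \<longleftrightarrow> (\<exists>bs. length bs = n \<and> set bs \<subseteq> A \<and>
       (\<forall>a\<in>A. \<exists>c::nat \<Rightarrow> 'k. a - (\<Sum>i<n. Const (c i) * bs ! i) \<in> B))"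

lemma quot_dim_spans: "quot_dim A B = (LEAST n. spans n A B)"
  by (simp add: quot_dim_def spans_def)

lemma spans_0: "spans 0 A B \<longleftrightarrow> A \<subseteq> B"
  by (auto simp: spans_def)

text \<open>The isomorphism between the two socles sends \<open>b\<close> to the \<open>w\<close> with \<open>y b = w x\<close> modulo \<open>J\<close>.\<close>

lemma socle_exchange_step:
  assumes J: "ideal_in S J" and x: "x \<in> max_ideal S" "regular_on S J x" and y: "y \<in> max_ideal S"
    and b: "b \<in> socle S (adjoin S J x)"
  shows "\<exists>w\<in>socle S (adjoin S J y). \<exists>j\<in>J. b * y = j + w * x"
proof -
  have R: "x \<in> poly_ring S" "y \<in> poly_ring S" using x y max_ideal_subset by blast+
  obtain j w where w: "j \<in> J" "w \<in> poly_ring S" "b * y = j + w * x"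
    using socleD(2)[OF b y] by (elim adjoinE)
  have "w * g \<in> adjoin S J y" if g: "g \<in> max_ideal S" for g
  proof -
    have gR: "g \<in> poly_ring S" using g max_ideal_subset by blast
    obtain j1 r1 where r1: "j1 \<in> J" "r1 \<in> poly_ring S" "b * g = j1 + r1 * x"
      using socleD(2)[OF b g] by (elim adjoinE)
    have "(w * g - r1 * y) * x = g * (b * y - j) - r1 * y * x" using w by (simp add: algebra_simps)
    also have "\<dots> = y * (b * g) - g * j - r1 * y * x" by (simp add: algebra_simps)
    also have "\<dots> = y * j1 - g * j" unfolding r1(3) by (simp add: algebra_simps)
    also have "\<dots> \<in> J"
      by (rule ideal_inD(7)[OF J ideal_inD(4)[OF J R(2) r1(1)] ideal_inD(4)[OF J gR w(1)]])
    finally have "w * g - r1 * y \<in> J"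
      using x(2) w gR r1 R by (simp add: regular_on_def poly_ring_minus poly_ring_mult)
    then have "(w * g - r1 * y) + r1 * y \<in> adjoin S J y" using adjoinI r1 by blast
    then show ?thesis by simp
  qed
  then have "w \<in> socle S (adjoin S J y)" using w by (simp add: socle_def colon_def)
  then show ?thesis using w by blast
qed

text \<open>The images \<open>W b\<close> of the spanning \<open>b\<close> span again: an
  \<open>a\<close> is sent to \<open>u\<close> by the same exchange with \<open>x\<close> and
  \<open>y\<close> interchanged, \<open>u\<close> is expanded in the \<open>b\<close>, and
  cancelling \<open>x\<close> carries the expansion back to \<open>a\<close>.\<close>

lemma spans_socle_exchange:
  fixes J :: "('v, 'k::field) mpoly set"
  assumes J: "ideal_in S J" and x: "x \<in> max_ideal S" "regular_on S J x" and y: "y \<in> max_ideal S" "regular_on S J y"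
    and n: "spans n (socle S (adjoin S J x)) (adjoin S J x)"
  shows "spans n (socle S (adjoin S J y)) (adjoin S J y)"
proof -
  have R: "x \<in> poly_ring S" "y \<in> poly_ring S" using x y max_ideal_subset by blast+
  obtain bs where bs: "length bs = n" "set bs \<subseteq> socle S (adjoin S J x)"
    "\<And>a. a \<in> socle S (adjoin S J x) \<Longrightarrow> \<exists>c. a - (\<Sum>i<n. Const (c i) * bs ! i) \<in> adjoin S J x"
    using n unfolding spans_def by blast
  have "\<forall>b\<in>socle S (adjoin S J x). \<exists>w j. w \<in> socle S (adjoin S J y) \<and> j \<in> J \<and> b * y = j + w * x"
    using socle_exchange_step[OF J x y(1)] by blast
  then obtain W j where W: "\<And>b. b \<in> socle S (adjoin S J x) \<Longrightarrow>
      W b \<in> socle S (adjoin S J y) \<and> j b \<in> J \<and> b * y = j b + W b * x"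
    by metis
  have nth: "bs ! i \<in> socle S (adjoin S J x)" if "i < n" for i using bs that nth_mem by blast
  have "\<exists>c. a - (\<Sum>i<n. Const (c i) * map W bs ! i) \<in> adjoin S J y" if a: "a \<in> socle S (adjoin S J y)" for a
  proof -
    have aR: "a \<in> poly_ring S" using a socleD by blast
    obtain u j0 where u: "u \<in> socle S (adjoin S J x)" "j0 \<in> J" "a * x = j0 + u * y"
      using socle_exchange_step[OF J y x(1) a] by blast
    obtain c where c: "u - (\<Sum>i<n. Const (c i) * bs ! i) \<in> adjoin S J x" using bs(3) u(1) by blast
    then obtain j2 r where r: "j2 \<in> J" "r \<in> poly_ring S" "u - (\<Sum>i<n. Const (c i) * bs ! i) = j2 + r * x"
      by (elim adjoinE)
    define s where "s = (\<Sum>i<n. Const (c i) * W (bs ! i))"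
    have sR: "s \<in> poly_ring S" unfolding s_def
      using W nth socleD(1) by (intro poly_ring_sum poly_ring_mult poly_ring_Const) blast
    have "(\<Sum>i<n. Const (c i) * bs ! i) * y = (\<Sum>i<n. Const (c i) * (bs ! i * y))"
      by (simp add: sum_distrib_right mult.assoc)
    also have "\<dots> = (\<Sum>i<n. Const (c i) * j (bs ! i) + Const (c i) * W (bs ! i) * x)"
    proof (intro sum.cong refl)
      fix i assume "i \<in> {..<n}"
      then have "bs ! i * y = j (bs ! i) + W (bs ! i) * x" using W nth by simp
      then show "Const (c i) * (bs ! i * y) = Const (c i) * j (bs ! i) + Const (c i) * W (bs ! i) * x"
        by (simp only: distrib_left mult.assoc)
    qed
    also have "\<dots> = (\<Sum>i<n. Const (c i) * j (bs ! i)) + s * x"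
      by (simp add: sum.distrib s_def sum_distrib_right)
    finally have *: "(\<Sum>i<n. Const (c i) * bs ! i) * y = (\<Sum>i<n. Const (c i) * j (bs ! i)) + s * x" .
    have u': "u = j2 + r * x + (\<Sum>i<n. Const (c i) * bs ! i)" using r(3) by (simp add: algebra_simps)
    have "(a - s - r * y) * x = a * x - s * x - r * y * x" by (simp add: algebra_simps)
    also have "\<dots> = j0 + j2 * y + ((\<Sum>i<n. Const (c i) * bs ! i) * y - s * x)"
      unfolding u(3) u' by (simp add: algebra_simps)
    also have "\<dots> = j0 + j2 * y + (\<Sum>i<n. Const (c i) * j (bs ! i))" by (simp add: *)
    also have "\<dots> \<in> J"
    proof -
      have "(\<Sum>i<n. Const (c i) * j (bs ! i)) \<in> J"
        using W nth by (intro ideal_in_sum[OF J] ideal_inD(4)[OF J] poly_ring_Const) blast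
      then show ?thesis
        using ideal_inD(3)[OF J ideal_inD(3)[OF J u(2) ideal_inD(5)[OF J R(2) r(1)]]] by blast
    qed
    finally have "a - s - r * y \<in> J"
      using x(2) aR sR r R by (simp add: regular_on_def poly_ring_minus poly_ring_mult)
    then have "(a - s - r * y) + r * y \<in> adjoin S J y" using adjoinI r by blast
    moreover have "s = (\<Sum>i<n. Const (c i) * map W bs ! i)" unfolding s_def using bs(1) by (intro sum.cong) auto
    ultimately show ?thesis by (intro exI[of _ c]) simp
  qed
  moreover have "set (map W bs) \<subseteq> socle S (adjoin S J y)" using W bs(2) by auto
  ultimately show ?thesis unfolding spans_def using bs(1) by (intro exI[of _ "map W bs"]) auto
qed

section \<open>Independence of the socle dimension\<close>

text \<open>Primality is tested on homogeneous elements, which suits the homogeneous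
  \<open>z\<close> to be found. The last clause excludes ideals containing
  \<open>max_ideal S\<close>, which no such \<open>z\<close> could avoid; it also makes
  \<open>P\<close> proper.\<close>

definition hom_prime :: "'v set \<Rightarrow> ('v, 'k::comm_ring_1) mpoly set \<Rightarrow> bool" where
  "hom_prime S P \<longleftrightarrow> ideal_in S P \<and> (\<forall>p\<in>P. \<forall>d. hom_part d p \<in> P) \<and>
     (\<forall>a\<in>poly_ring S. \<forall>b\<in>poly_ring S. homogeneous a \<longrightarrow> homogeneous b \<longrightarrow> a * b \<in> P \<longrightarrow> a \<in> P \<or> b \<in> P) \<and>
     (\<exists>v\<in>S. Var v \<notin> P)"

lemma hom_primeD:
  assumes "hom_prime S P"
  shows "ideal_in S P" "p \<in> P \<Longrightarrow> hom_part d p \<in> P"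
    "a \<in> poly_ring S \<Longrightarrow> b \<in> poly_ring S \<Longrightarrow> homogeneous a \<Longrightarrow> homogeneous b \<Longrightarrow> a * b \<in> P \<Longrightarrow> a \<in> P \<or> b \<in> P"
    "\<exists>v\<in>S. Var v \<notin> P"
  using assms unfolding hom_prime_def by blast+

lemma hom_prime_1: "hom_prime S P \<Longrightarrow> 1 \<notin> P"
  using hom_primeD(4)[of S P] ideal_inD(4)[OF hom_primeD(1), of S P _ 1] poly_ring_Var by fastforce

lemma homogeneous_mult: "homogeneous p \<Longrightarrow> homogeneous q \<Longrightarrow> homogeneous (p * q)"
  using hom_deg_mult unfolding homogeneous_iff by blast

lemma homogeneous_1: "homogeneous 1"
  using hom_deg_1 unfolding homogeneous_iff by blast

lemma homogeneous_Var: "homogeneous (Var v :: ('v, 'k::comm_ring_1) mpoly)"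
  by (auto simp: homogeneous_def Var_def)

lemma homogeneous_prod: "(\<And>i. i \<in> I \<Longrightarrow> homogeneous (f i)) \<Longrightarrow> homogeneous (prod f I)"
  by (induction I rule: infinite_finite_induct) (auto simp: homogeneous_1 homogeneous_mult)

lemma hom_prime_prod:
  assumes P: "hom_prime S P" and "finite I"
    and f: "\<And>i. i \<in> I \<Longrightarrow> f i \<in> poly_ring S \<and> homogeneous (f i) \<and> f i \<notin> P"
  shows "prod f I \<notin> P"
  using assms(2) f
proof (induction I)
  case (insert i I)
  then show ?case
    using hom_primeD(3)[OF P, of "f i" "prod f I"] by (auto intro!: poly_ring_prod homogeneous_prod)
qed (simp add: hom_prime_1[OF P])

lemma hom_prime_power:
  assumes "hom_prime S P" "p \<in> poly_ring S" "homogeneous p" "p \<notin> P"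
  shows "p ^ n \<notin> P"
  using hom_prime_prod[OF assms(1), of "{..<n}" "\<lambda>_. p"] assms(2-4) by simp

lemma ideal_prod_mem:
  assumes "ideal_in S P" "finite I" "\<And>i. i \<in> I \<Longrightarrow> f i \<in> poly_ring S" "j \<in> I" "f j \<in> P"
  shows "prod f I \<in> P"
  unfolding prod.remove[OF assms(2,4), of f]
  using assms by (intro ideal_inD(5)[OF assms(1)] poly_ring_prod) auto

lemma hom_prime_separate:
  assumes "hom_prime S P" "\<not> P \<subseteq> Q" "ideal_in S Q"
  shows "\<exists>b\<in>P - Q. homogeneous b"
proof -
  obtain p where p: "p \<in> P" "p \<notin> Q" using assms(2) by blast
  have "\<exists>d. hom_part d p \<notin> Q"
  proof (rule ccontr)
    assume "\<not> ?thesis"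
    then have "p \<in> Q" by (subst sum_hom_part[of p]) (intro ideal_in_sum[OF assms(3)], blast)
    then show False using p by simp
  qed
  then show ?thesis using hom_primeD(2)[OF assms(1) p(1)] hom_deg_hom_part homogeneous_iff by blast
qed

text \<open>Over a finite field linear combinations need not avoid the primes; homogeneity is
  restored by raising both summands to a common degree.\<close>

lemma graded_prime_avoidance:
  fixes \<P> :: "('v, 'k::comm_ring_1) mpoly set set"
  assumes "finite \<P>" "\<And>P. P \<in> \<P> \<Longrightarrow> hom_prime S P"
  shows "\<exists>z\<in>max_ideal S. homogeneous z \<and> (\<forall>P\<in>\<P>. z \<notin> P)"
  using assms
proof (induction \<P> rule: finite_psubset_induct)
  case (psubset \<P>)
  show ?case
  proof (cases "\<exists>P\<in>\<P>. \<exists>Q\<in>\<P>. P \<noteq> Q \<and> P \<subseteq> Q")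
    case True
    then obtain P Q where PQ: "P \<in> \<P>" "Q \<in> \<P>" "P \<noteq> Q" "P \<subseteq> Q" by blast
    obtain z where z: "z \<in> max_ideal S" "homogeneous z" "\<forall>P\<in>\<P> - {P}. z \<notin> P"
      using psubset.IH[of "\<P> - {P}"] psubset.prems PQ(1) by (metis Diff_iff Diff_subset insertI1 psubsetI)
    then have "z \<notin> P" using PQ by blast
    then show ?thesis using z by (intro bexI[of _ z]) auto
  next
    case antichain: False
    show ?thesis
    proof (cases "\<P> = {}")
      case True
      then show ?thesis using ideal_inD(2)[OF ideal_in_max] hom_deg_0 homogeneous_iff by blast
    next
      case False
      then obtain P where P: "P \<in> \<P>" by blast
      then have pP: "hom_prime S P" using psubset.prems by blast
      obtain z where z: "z \<in> max_ideal S" "homogeneous z" "\<forall>P\<in>\<P> - {P}. z \<notin> P"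
        using psubset.IH[of "\<P> - {P}"] psubset.prems P by (metis Diff_iff Diff_subset insertI1 psubsetI)
      show ?thesis
      proof (cases "z \<in> P")
        case False
        then show ?thesis using z by (intro bexI[of _ z]) auto
      next
        case True
        obtain v where v: "v \<in> S" "Var v \<notin> P" using hom_primeD(4)[OF pP] by blast
        have "\<exists>b. b \<in> Q \<and> b \<notin> P \<and> homogeneous b" if "Q \<in> \<P> - {P}" for Q
          using hom_prime_separate[of S Q P] that psubset.prems antichain P hom_primeD(1)[OF pP] by blast
        then obtain b where b: "\<And>Q. Q \<in> \<P> - {P} \<Longrightarrow> b Q \<in> Q \<and> b Q \<notin> P \<and> homogeneous (b Q)" by metis
        have bR: "b Q \<in> poly_ring S" if "Q \<in> \<P> - {P}" for Q
          using b[OF that] ideal_inD(1)[OF hom_primeD(1)[OF psubset.prems[of Q]]] that by blast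
        \<comment> \<open>\<open>s\<close> lies in every prime except \<open>P\<close>, while
          \<open>z\<close> lies in \<open>P\<close> and in no other. The factor \<open>Var v\<close>
          puts \<open>s\<close> into \<open>max_ideal S\<close> even if \<open>P\<close> is the only
          prime.\<close>
        define s where "s = (\<Prod>Q\<in>\<P> - {P}. b Q) * Var v"
        have fin: "finite (\<P> - {P})" using psubset.hyps by simp
        have prR: "(\<Prod>Q\<in>\<P> - {P}. b Q) \<in> poly_ring S" "homogeneous (\<Prod>Q\<in>\<P> - {P}. b Q)"
          using bR b by (auto intro!: poly_ring_prod homogeneous_prod)
        have "(\<Prod>Q\<in>\<P> - {P}. b Q) \<notin> P" using hom_prime_prod[OF pP fin] b bR by blast
        then have sP: "s \<notin> P"
          using hom_primeD(3)[OF pP prR(1) poly_ring_Var[OF v(1)] prR(2) homogeneous_Var] v(2)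
          unfolding s_def by blast
        have s: "s \<in> max_ideal S" "homogeneous s"
          using max_ideal_mult[OF prR(1) max_ideal_Var[OF v(1)]] homogeneous_mult[OF prR(2) homogeneous_Var]
          by (simp_all add: s_def)
        have sQ: "s \<in> Q" if Q: "Q \<in> \<P> - {P}" for Q
        proof -
          have iQ: "ideal_in S Q" using Q psubset.prems hom_primeD(1) by blast
          have "(\<Prod>Q\<in>\<P> - {P}. b Q) \<in> Q"
            using ideal_prod_mem[OF iQ fin _ Q, of b] bR b[OF Q] by simp
          then show ?thesis unfolding s_def by (rule ideal_inD(5)[OF iQ poly_ring_Var[OF v(1)]])
        qed
        have R: "z \<in> poly_ring S" "s \<in> poly_ring S" using z s max_ideal_subset by blast+
        obtain d where d: "d \<ge> 1" "hom_deg d z" using max_ideal_hom_deg z by blast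
        obtain e where e: "e \<ge> 1" "hom_deg e s" using max_ideal_hom_deg s by blast
        have pow: "p ^ n \<in> Q" if "ideal_in S Q" "p \<in> Q" "n \<ge> 1" for p :: "('v, 'k) mpoly" and n Q
        proof -
          have "p ^ n = p ^ (n - 1) * p" using that(3) by (simp flip: power_Suc2)
          then show ?thesis
            using ideal_inD(4)[OF that(1) poly_ring_power[OF ideal_inD(1)[OF that(1,2)]] that(2)] by simp
        qed
        define t where "t = z ^ e + s ^ d"
        have "hom_deg (d * e) t"
          unfolding t_def using hom_deg_power[OF d(2), of e] hom_deg_power[OF e(2), of d]
          by (intro hom_deg_add) (simp_all add: mult.commute)
        then have "homogeneous t" using homogeneous_iff by blast
        moreover have "t \<in> max_ideal S"
          unfolding t_def using pow[OF ideal_in_max] z s d e by (intro max_ideal_add) blast+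
        moreover have "t \<notin> Q" if Q: "Q \<in> \<P>" for Q
        proof
          assume t: "t \<in> Q"
          have pQ: "hom_prime S Q" using psubset.prems Q by blast
          note iQ = hom_primeD(1)[OF pQ]
          show False
          proof (cases "Q = P")
            case True
            then have "z ^ e \<in> Q" using pow[OF iQ _ e(1)] \<open>z \<in> P\<close> by blast
            then have "s ^ d \<in> Q" using ideal_inD(7)[OF iQ t, of "z ^ e"] by (simp add: t_def)
            then show False using hom_prime_power[OF pQ R(2) s(2)] sP True by blast
          next
            case False
            then have "s ^ d \<in> Q" using pow[OF iQ _ d(1)] sQ Q by blast
            then have "z ^ e \<in> Q" using ideal_inD(7)[OF iQ t, of "s ^ d"] by (simp add: t_def)
            then show False using hom_prime_power[OF pQ R(1) z(2)] z(3) Q False by blast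
          qed
        qed
        ultimately show ?thesis by blast
      qed
    qed
  qed
qed

section \<open>Associated primes as maximal annihilators\<close>

definition annihilator :: "'v set \<Rightarrow> ('v, 'k::comm_ring_1) mpoly set \<Rightarrow> ('v, 'k) mpoly \<Rightarrow> ('v, 'k) mpoly set" where
  "annihilator S J f = {g \<in> poly_ring S. g * f \<in> J}"

lemma ideal_in_annihilator:
  fixes J :: "('v, 'k::comm_ring_1) mpoly set"
  assumes J: "ideal_in S J"
  shows "ideal_in S (annihilator S J f)"
  unfolding ideal_in_def
proof (intro conjI ballI)
  show "annihilator S J f \<subseteq> poly_ring S" by (auto simp: annihilator_def)
  show "0 \<in> annihilator S J f" using ideal_inD(2)[OF J] by (simp add: annihilator_def poly_ring_0)
  show "a + b \<in> annihilator S J f" if "a \<in> annihilator S J f" "b \<in> annihilator S J f" for a b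
    using that ideal_inD(3)[OF J] by (simp add: annihilator_def poly_ring_add distrib_right)
  show "r * a \<in> annihilator S J f" if "r \<in> poly_ring S" "a \<in> annihilator S J f" for r a :: "('v, 'k) mpoly"
    using that ideal_inD(4)[OF J] by (simp add: annihilator_def poly_ring_mult mult.assoc)
qed

lemma max_ideal_least:
  fixes P :: "('v, 'k::comm_ring_1) mpoly set"
  assumes P: "ideal_in S P" "\<And>v. v \<in> S \<Longrightarrow> Var v \<in> P"
  shows "max_ideal S \<subseteq> P"
proof
  fix g :: "('v, 'k) mpoly" assume g: "g \<in> max_ideal S"
  have "single m (lookup g m) \<in> P" if m: "m \<in> keys g" for m
  proof -
    have "m \<noteq> 0" using m g by (auto simp: max_ideal_def in_keys_iff)
    then obtain v where v: "v \<in> keys m" by fastforce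
    have mS: "keys m \<subseteq> S" using m g by (auto simp: max_ideal_def poly_ring_def)
    define m' where "m' = m - single v 1"
    have m': "m = m' + single v 1"
      using v by (intro poly_mapping_eqI) (auto simp: m'_def lookup_add lookup_minus lookup_single when_def in_keys_iff)
    then have "keys m' \<subseteq> S" using mS keys_plus_monomial[of m' "single v 1"] by auto
    then have "single m' (lookup g m) * Var v \<in> P"
      using ideal_inD(4)[OF P(1) poly_ring_single P(2)] v mS by blast
    moreover have "single m' (lookup g m) * Var v = single (m' + single v 1) (lookup g m)"
      by (simp add: Var_def mult_single)
    ultimately show ?thesis using m' by simp
  qed
  then show "g \<in> P" by (subst sum_single[of g]) (intro ideal_in_sum[OF P(1)])
qed

lemma chain_maximal:
  fixes \<C> :: "('v, 'k::field) mpoly set set"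
  assumes "finite S" "\<And>C. C \<in> \<C> \<Longrightarrow> ideal_in S C" "C \<in> \<C>"
  shows "\<exists>M\<in>\<C>. C \<subseteq> M \<and> (\<forall>D\<in>\<C>. M \<subseteq> D \<longrightarrow> D = M)"
proof (rule ccontr)
  assume "\<not> ?thesis"
  then have no: "\<exists>D\<in>\<C>. M \<subseteq> D \<and> D \<noteq> M" if "M \<in> \<C>" "C \<subseteq> M" for M
    using that by metis
  have "\<exists>I. \<forall>n. (I n \<in> \<C> \<and> C \<subseteq> I n) \<and> I n \<subset> I (Suc n)"
  proof (rule dependent_nat_choice)
    show "\<exists>x. x \<in> \<C> \<and> C \<subseteq> x" using assms(3) by blast
    show "\<exists>y. (y \<in> \<C> \<and> C \<subseteq> y) \<and> x \<subset> y" if x: "x \<in> \<C> \<and> C \<subseteq> x" for x and n :: nat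
    proof -
      obtain D where "D \<in> \<C>" "x \<subseteq> D" "D \<noteq> x" using no[of x] x by blast
      then show ?thesis using x by (intro exI[of _ D]) auto
    qed
  qed
  then obtain I where I: "\<And>n. I n \<in> \<C>" "\<And>n. I n \<subset> I (Suc n)" by blast
  obtain n where "I n = I (Suc n)"
    using chain_stationary[OF assms(1), of I] assms(2)[OF I(1)] I(2) by (meson psubset_imp_subset)
  then show False using I(2)[of n] by simp
qed

lemma adjoin_list_annihilated:
  assumes J: "ideal_in S J" and "p \<in> poly_ring S" "\<And>g. g \<in> set gs \<Longrightarrow> p * g \<in> J" "k \<in> foldl (adjoin S) J gs"
  shows "p * k \<in> J"
  using assms(3,4)
proof (induction gs arbitrary: k rule: rev_induct)
  case Nil
  then show ?case using ideal_inD(4)[OF J assms(2)] by simp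
next
  case (snoc g gs)
  obtain k' r where k: "k' \<in> foldl (adjoin S) J gs" "r \<in> poly_ring S" "k = k' + r * g"
    using snoc.prems(2) by (auto elim: adjoinE)
  have "p * k = p * k' + r * (p * g)" unfolding k(3) by (simp add: algebra_simps)
  then show ?case using snoc.IH[OF _ k(1)] snoc.prems(1) k(2) ideal_inD(3,4)[OF J] by auto
qed

lemma hom_ideal_adjoin_in:
  assumes "ideal_in S J" "set gs \<subseteq> poly_ring S"
  shows "ideal_in S (foldl (adjoin S) J gs)"
  using assms by (induction gs arbitrary: J) (auto intro: ideal_in_adjoin)

text \<open>As in the theory of associated primes, an annihilator maximal among those of homogeneous
  elements outside \<open>J\<close> is prime. If it contained all variables, the annihilated element
  would be a nonzero socle element.\<close>

lemma finite_maximal_annihilators: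
  fixes J :: "('v, 'k::field) mpoly set"
  assumes S: "finite S" and J: "hom_ideal S J" and soc: "socle S J \<subseteq> J"
  shows "\<exists>\<P>. finite \<P> \<and> (\<forall>P\<in>\<P>. hom_prime S P) \<and>
    (\<forall>f\<in>poly_ring S - J. homogeneous f \<longrightarrow> (\<exists>P\<in>\<P>. annihilator S J f \<subseteq> P))"
proof -
  note iJ = hom_idealD(1)[OF J]
  define F where "F = {f \<in> poly_ring S - J. homogeneous f}"
  define \<C> where "\<C> = annihilator S J ` F"
  define \<P> where "\<P> = {M \<in> \<C>. \<forall>D\<in>\<C>. M \<subseteq> D \<longrightarrow> D = M}"
  have iC: "ideal_in S C" if "C \<in> \<C>" for C using that ideal_in_annihilator[OF iJ] by (auto simp: \<C>_def)
  have prime: "hom_prime S P" if P: "P \<in> \<P>" for P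
    unfolding hom_prime_def
  proof (intro conjI ballI allI impI)
    obtain f where f: "f \<in> F" "P = annihilator S J f" using P by (auto simp: \<P>_def \<C>_def)
    have f': "f \<in> poly_ring S" "f \<notin> J" "homogeneous f" using f by (auto simp: F_def)
    show iP: "ideal_in S P" using P iC by (auto simp: \<P>_def)
    show "hom_part d p \<in> P" if p: "p \<in> P" for p d
    proof -
      obtain e where e: "hom_deg e f" using f' homogeneous_iff by blast
      have "hom_part (d + e) (p * f) \<in> J" using hom_idealD(3)[OF J] p f(2) by (auto simp: annihilator_def)
      then show ?thesis using p f(2) by (simp add: annihilator_def hom_part_mult[OF e] poly_ring_hom_part)
    qed
    show "a \<in> P \<or> b \<in> P" if ab: "a \<in> poly_ring S" "b \<in> poly_ring S" "homogeneous a" "homogeneous b" "a * b \<in> P" for a b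
    proof (rule disjCI)
      assume "b \<notin> P"
      then have "b * f \<in> F" using ab f' f(2) by (auto simp: F_def annihilator_def poly_ring_mult homogeneous_mult)
      then have "annihilator S J (b * f) \<in> \<C>" by (simp add: \<C>_def)
      moreover have "P \<subseteq> annihilator S J (b * f)"
      proof
        fix g assume "g \<in> P"
        then have "b * (g * f) \<in> J" "g \<in> poly_ring S"
          using f(2) ideal_inD(4)[OF iJ ab(2)] by (auto simp: annihilator_def)
        then show "g \<in> annihilator S J (b * f)" by (simp add: annihilator_def mult.left_commute)
      qed
      ultimately have "annihilator S J (b * f) = P" using P by (auto simp: \<P>_def)
      moreover have "a \<in> annihilator S J (b * f)" using ab f(2) by (auto simp: annihilator_def mult.assoc)
      ultimately show "a \<in> P" by blast
    qed
    show "\<exists>v\<in>S. Var v \<notin> P"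
    proof (rule ccontr)
      assume "\<not> ?thesis"
      then have "max_ideal S \<subseteq> P" using max_ideal_least[OF iP] by blast
      then have "f \<in> socle S J" using f' f(2) by (auto simp: socle_def colon_def annihilator_def mult.commute)
      then show False using soc f'(2) by blast
    qed
  qed
  \<comment> \<open>Among infinitely many, some \<open>g n\<close> is a combination of the earlier
    \<open>g i\<close> modulo \<open>J\<close>. A product of elements of \<open>p i - p n\<close>
    kills those, hence also \<open>g n\<close>, and so lies in the prime \<open>p n\<close>,
    contrary to the choice of its factors.\<close>
  have "finite \<P>"
  proof (rule ccontr)
    assume "infinite \<P>"
    then obtain p :: "nat \<Rightarrow> _" where p: "inj p" "range p \<subseteq> \<P>" using infinite_countable_subset by blast
    have "\<exists>g. g \<in> F \<and> p n = annihilator S J g" for n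
    proof -
      have "p n \<in> \<C>" using p(2) unfolding \<P>_def by blast
      then show ?thesis by (auto simp: \<C>_def)
    qed
    then obtain g where g: "\<And>n. g n \<in> F" "\<And>n. p n = annihilator S J (g n)" by metis
    define K where "K n = foldl (adjoin S) J (map g [0..<n])" for n
    have gR: "g n \<in> poly_ring S" "g n \<notin> J" "homogeneous (g n)" for n using g(1)[of n] by (auto simp: F_def)
    have iK: "ideal_in S (K n)" for n
      unfolding K_def using gR by (intro hom_ideal_adjoin_in[OF iJ]) auto
    have KS: "K (Suc n) = adjoin S (K n) (g n)" for n by (simp add: K_def)
    obtain n where n: "K n = K (Suc n)" using chain_stationary[OF S, of K] iK adjoin_superset KS by metis
    then have gn: "g n \<in> K n" using adjoin_mem[OF iK poly_ring_1, of "g n" n] KS by simp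
    have "\<exists>a. a \<in> p i - p n \<and> homogeneous a" if i: "i < n" for i
    proof -
      have "p i \<noteq> p n" using p(1) i by (metis injD less_irrefl)
      moreover have "p i \<in> \<P>" "p n \<in> \<P>" using p(2) by blast+
      ultimately have "\<not> p i \<subseteq> p n" unfolding \<P>_def by auto
      moreover have "hom_prime S (p i)" "hom_prime S (p n)" using prime p(2) by blast+
      ultimately show ?thesis using hom_prime_separate hom_primeD(1) by blast
    qed
    then obtain a where a: "\<And>i. i < n \<Longrightarrow> a i \<in> p i - p n \<and> homogeneous (a i)" by metis
    have aR: "a i \<in> poly_ring S" if "i < n" for i using a[OF that] g(2)[of i] by (auto simp: annihilator_def)
    have "(\<Prod>i<n. a i) * g i \<in> J" if i: "i < n" for i
    proof -
      have "(\<Prod>i<n. a i) \<in> annihilator S J (g i)"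
        using i a[OF i] g(2)[of i] aR by (intro ideal_prod_mem[OF ideal_in_annihilator[OF iJ]]) auto
      then show ?thesis by (simp add: annihilator_def)
    qed
    then have "(\<Prod>i<n. a i) * h \<in> J" if "h \<in> set (map g [0..<n])" for h
      using that by auto
    then have "(\<Prod>i<n. a i) * g n \<in> J"
      by (rule adjoin_list_annihilated[OF iJ poly_ring_prod _ gn[unfolded K_def], rotated]) (use aR in auto)
    then have "(\<Prod>i<n. a i) \<in> p n" using g(2)[of n] aR by (auto simp: annihilator_def intro: poly_ring_prod)
    moreover have "(\<Prod>i<n. a i) \<notin> p n"
    proof (rule hom_prime_prod)
      show "hom_prime S (p n)" using prime p(2) by blast
    qed (use a aR in auto)
    ultimately show False by blast
  qed
  moreover have "\<exists>P\<in>\<P>. annihilator S J f \<subseteq> P" if "f \<in> poly_ring S - J" "homogeneous f" for f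
    using chain_maximal[OF S iC, of "\<C>" "annihilator S J f"] that by (auto simp: \<P>_def \<C>_def F_def)
  ultimately show ?thesis using prime by blast
qed

text \<open>Avoiding both families of primes at once gives one element regular for the two
  quotients; the exchange of sequences needs this common element.\<close>

lemma common_regular_element:
  fixes J K :: "('v, 'k::field) mpoly set"
  assumes S: "finite S" and J: "hom_ideal S J" "socle S J \<subseteq> J" and K: "hom_ideal S K" "socle S K \<subseteq> K"
  shows "\<exists>z\<in>max_ideal S. homogeneous z \<and> regular_on S J z \<and> regular_on S K z"
proof -
  obtain \<P> where P: "finite \<P>" "\<And>P. P \<in> \<P> \<Longrightarrow> hom_prime S P"
    "\<And>f. f \<in> poly_ring S - J \<Longrightarrow> homogeneous f \<Longrightarrow> \<exists>P\<in>\<P>. annihilator S J f \<subseteq> P"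
    using finite_maximal_annihilators[OF S J] by blast
  obtain \<Q> where Q: "finite \<Q>" "\<And>P. P \<in> \<Q> \<Longrightarrow> hom_prime S P"
    "\<And>f. f \<in> poly_ring S - K \<Longrightarrow> homogeneous f \<Longrightarrow> \<exists>P\<in>\<Q>. annihilator S K f \<subseteq> P"
    using finite_maximal_annihilators[OF S K] by blast
  obtain z where z: "z \<in> max_ideal S" "homogeneous z" "\<And>P. P \<in> \<P> \<union> \<Q> \<Longrightarrow> z \<notin> P"
  proof -
    have "finite (\<P> \<union> \<Q>)" "\<And>P. P \<in> \<P> \<union> \<Q> \<Longrightarrow> hom_prime S P" using P(1,2) Q(1,2) by auto
    from graded_prime_avoidance[OF this] show ?thesis using that by blast
  qed
  have zR: "z \<in> poly_ring S" using z max_ideal_subset by blast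
  have "regular_on S J z"
  proof (rule regular_on_homI[OF J(1) z(2)], rule ccontr)
    fix d f assume f: "hom_deg d f" "f \<in> poly_ring S" "f * z \<in> J" "f \<notin> J"
    then obtain P where "P \<in> \<P>" "annihilator S J f \<subseteq> P" using P(3)[of f] homogeneous_iff[of f] by blast
    then show False using f zR z(3) by (auto simp: annihilator_def mult.commute)
  qed
  moreover have "regular_on S K z"
  proof (rule regular_on_homI[OF K(1) z(2)], rule ccontr)
    fix d f assume f: "hom_deg d f" "f \<in> poly_ring S" "f * z \<in> K" "f \<notin> K"
    then obtain P where "P \<in> \<Q>" "annihilator S K f \<subseteq> P" using Q(3)[of f] homogeneous_iff[of f] by blast
    then show False using f zR z(3) by (auto simp: annihilator_def mult.commute)
  qed
  ultimately show ?thesis using z by blast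
qed

text \<open>Regular sequences unfolded from the front and over ideals instead of generators, so that
  an induction may replace \<open>J\<close> by \<open>adjoin S J z\<close>.\<close>

fun reg_seq :: "'v set \<Rightarrow> ('v, 'k::comm_ring_1) mpoly set \<Rightarrow> ('v, 'k) mpoly list \<Rightarrow> bool" where
  "reg_seq S J [] \<longleftrightarrow> True"
| "reg_seq S J (z # zs) \<longleftrightarrow> z \<in> max_ideal S \<and> homogeneous z \<and> regular_on S J z \<and> reg_seq S (adjoin S J z) zs"

lemma reg_seq_snoc: "reg_seq S J (zs @ [z]) \<longleftrightarrow> reg_seq S J zs \<and> z \<in> max_ideal S \<and> homogeneous z \<and>
    regular_on S (foldl (adjoin S) J zs) z"
  by (induction zs arbitrary: J) auto

lemma hom_ideal_adjoin_list: "hom_ideal S J \<Longrightarrow> reg_seq S J zs \<Longrightarrow> hom_ideal S (foldl (adjoin S) J zs)"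
  by (induction zs arbitrary: J) (auto simp: hom_ideal_adjoin)

text \<open>An element regular after the whole sequence is carried forward past one entry at a time
  by \<open>regular_swap_first\<close> and \<open>regular_swap_second\<close>.\<close>

lemma reg_seq_move_front:
  assumes "hom_ideal S J" "reg_seq S J zs" "z \<in> max_ideal S" "homogeneous z"
    "regular_on S (foldl (adjoin S) J zs) z"
  shows "regular_on S J z \<and> reg_seq S (adjoin S J z) zs \<and>
    foldl (adjoin S) (adjoin S J z) zs = adjoin S (foldl (adjoin S) J zs) z"
  using assms
proof (induction zs arbitrary: J)
  case (Cons x zs)
  have x: "x \<in> max_ideal S" "homogeneous x" "regular_on S J x" using Cons.prems by auto
  have R: "x \<in> poly_ring S" "z \<in> poly_ring S" using x Cons.prems max_ideal_subset by blast+
  have IH: "regular_on S (adjoin S J x) z \<and> reg_seq S (adjoin S (adjoin S J x) z) zs \<and>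
    foldl (adjoin S) (adjoin S (adjoin S J x) z) zs = adjoin S (foldl (adjoin S) (adjoin S J x) zs) z"
    using Cons.IH[OF hom_ideal_adjoin[OF Cons.prems(1) x(1,2)]] Cons.prems by simp
  have "regular_on S J z"
    using regular_swap_first[OF Cons.prems(1) x(1,2) R(2) Cons.prems(4) x(3)] IH by blast
  moreover have "regular_on S (adjoin S J z) x"
    using regular_swap_second[OF hom_idealD(1)[OF Cons.prems(1)] R x(3)] IH by blast
  ultimately show ?case using IH x by (simp add: adjoin_commute[of S J z x])
qed simp

definition maximal_reg_seq :: "'v set \<Rightarrow> ('v, 'k::comm_ring_1) mpoly set \<Rightarrow> ('v, 'k) mpoly list \<Rightarrow> bool" where
  "maximal_reg_seq S J zs \<longleftrightarrow> reg_seq S J zs \<and> (\<forall>z. \<not> reg_seq S J (zs @ [z]))"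

lemma regular_socle_subset:
  assumes "x \<in> max_ideal S" "regular_on S J x" shows "socle S J \<subseteq> J"
  using assms socleD unfolding regular_on_def by blast

text \<open>If the socle is zero, prime avoidance finds a further regular element; conversely a
  regular element of \<open>max_ideal S\<close> forces the socle to vanish.\<close>

lemma maximal_reg_seq_iff:
  fixes J :: "('v, 'k::field) mpoly set"
  assumes S: "finite S" and J: "hom_ideal S J" and zs: "reg_seq S J zs"
  shows "maximal_reg_seq S J zs \<longleftrightarrow> \<not> socle S (foldl (adjoin S) J zs) \<subseteq> foldl (adjoin S) J zs"
proof
  assume max: "maximal_reg_seq S J zs"
  show "\<not> socle S (foldl (adjoin S) J zs) \<subseteq> foldl (adjoin S) J zs"
  proof
    assume soc: "socle S (foldl (adjoin S) J zs) \<subseteq> foldl (adjoin S) J zs"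
    have h: "hom_ideal S (foldl (adjoin S) J zs)" using hom_ideal_adjoin_list[OF J zs] .
    obtain z where "z \<in> max_ideal S" "homogeneous z" "regular_on S (foldl (adjoin S) J zs) z"
      using common_regular_element[OF S h soc h soc] by blast
    then show False using max zs by (auto simp: maximal_reg_seq_def reg_seq_snoc)
  qed
next
  assume "\<not> socle S (foldl (adjoin S) J zs) \<subseteq> foldl (adjoin S) J zs"
  then show "maximal_reg_seq S J zs"
    using zs regular_socle_subset by (auto simp: maximal_reg_seq_def reg_seq_snoc)
qed

text \<open>Exchange argument: if \<open>\<theta>\<^sub>1 \<dots> \<theta>\<^sub>d\<close> and \<open>\<theta>'\<^sub>1 \<dots> \<theta>'\<^sub>e\<close> are maximal, a common regular element \<open>z\<close>
  replaces both last entries without changing the socles; moving it to the front reduces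
  to shorter sequences modulo \<open>z\<close>.\<close>

lemma spans_socle_independent:
  fixes J :: "('v, 'k::field) mpoly set"
  assumes S: "finite S" and "hom_ideal S J" "maximal_reg_seq S J xs" "maximal_reg_seq S J ys"
  shows "spans n (socle S (foldl (adjoin S) J xs)) (foldl (adjoin S) J xs) \<longleftrightarrow>
    spans n (socle S (foldl (adjoin S) J ys)) (foldl (adjoin S) J ys)"
  using assms(2-)
proof (induction "length xs" arbitrary: J xs ys)
  case 0
  then have "xs = []" by simp
  moreover have "ys = []"
  proof (rule ccontr)
    assume "ys \<noteq> []"
    then obtain y ys' where "ys = y # ys'" by (cases ys) auto
    then have "reg_seq S J ([] @ [y])" using 0 by (simp add: maximal_reg_seq_def)
    then show False using 0 \<open>xs = []\<close> unfolding maximal_reg_seq_def by blast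
  qed
  ultimately show ?case by simp
next
  case (Suc d)
  obtain us x where xs: "xs = us @ [x]" using Suc.hyps(2) by (cases xs rule: rev_cases) auto
  have "ys \<noteq> []"
  proof
    assume "ys = []"
    moreover obtain x' xs' where "xs = x' # xs'" using Suc.hyps(2) by (metis length_Suc_conv)
    then have "reg_seq S J ([] @ [x'])" using Suc.prems(2) by (simp add: maximal_reg_seq_def)
    ultimately show False using Suc.prems(3) unfolding maximal_reg_seq_def by blast
  qed
  then obtain vs y where ys: "ys = vs @ [y]" by (cases ys rule: rev_cases) auto
  define K L where "K = foldl (adjoin S) J us" and "L = foldl (adjoin S) J vs"
  have x: "reg_seq S J us" "x \<in> max_ideal S" "homogeneous x" "regular_on S K x"
    and y: "reg_seq S J vs" "y \<in> max_ideal S" "homogeneous y" "regular_on S L y"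
    using Suc.prems(2,3) by (auto simp: xs ys maximal_reg_seq_def reg_seq_snoc K_def L_def)
  have hK: "hom_ideal S K" and hL: "hom_ideal S L"
    using hom_ideal_adjoin_list[OF Suc.prems(1)] x(1) y(1) by (auto simp: K_def L_def)
  obtain z where z: "z \<in> max_ideal S" "homogeneous z" "regular_on S K z" "regular_on S L z"
    using common_regular_element[OF S hK regular_socle_subset[OF x(2,4)] hL regular_socle_subset[OF y(2,4)]] by blast
  have exK: "spans m (socle S (adjoin S K x)) (adjoin S K x) \<longleftrightarrow> spans m (socle S (adjoin S K z)) (adjoin S K z)" for m
    using spans_socle_exchange[OF hom_idealD(1)[OF hK] x(2,4) z(1,3)]
      spans_socle_exchange[OF hom_idealD(1)[OF hK] z(1,3) x(2,4)] by blast
  have exL: "spans m (socle S (adjoin S L y)) (adjoin S L y) \<longleftrightarrow> spans m (socle S (adjoin S L z)) (adjoin S L z)" for m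
    using spans_socle_exchange[OF hom_idealD(1)[OF hL] y(2,4) z(1,4)]
      spans_socle_exchange[OF hom_idealD(1)[OF hL] z(1,4) y(2,4)] by blast
  have fu: "regular_on S J z" "reg_seq S (adjoin S J z) us" "foldl (adjoin S) (adjoin S J z) us = adjoin S K z"
    using reg_seq_move_front[OF Suc.prems(1) x(1) z(1,2)] z(3) by (auto simp: K_def)
  have fv: "reg_seq S (adjoin S J z) vs" "foldl (adjoin S) (adjoin S J z) vs = adjoin S L z"
    using reg_seq_move_front[OF Suc.prems(1) y(1) z(1,2)] z(4) by (auto simp: L_def)
  have hz: "hom_ideal S (adjoin S J z)" using hom_ideal_adjoin[OF Suc.prems(1) z(1,2)] .
  \<comment> \<open>The exchange with \<open>n = 0\<close> shows that the socle stays nonzero when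
    \<open>x\<close> is replaced by \<open>z\<close>, so the shorter sequence \<open>us\<close> is
    maximal modulo \<open>z\<close>.\<close>
  have "\<not> spans 0 (socle S (adjoin S K x)) (adjoin S K x)"
    using maximal_reg_seq_iff[OF S Suc.prems(1), of xs] Suc.prems(2)
    by (simp add: xs spans_0 K_def maximal_reg_seq_def)
  then have mu: "maximal_reg_seq S (adjoin S J z) us"
    unfolding maximal_reg_seq_iff[OF S hz fu(2)] fu(3) using exK spans_0 by blast
  have "\<not> spans 0 (socle S (adjoin S L y)) (adjoin S L y)"
    using maximal_reg_seq_iff[OF S Suc.prems(1), of ys] Suc.prems(3)
    by (simp add: ys spans_0 L_def maximal_reg_seq_def)
  then have mv: "maximal_reg_seq S (adjoin S J z) vs"
    unfolding maximal_reg_seq_iff[OF S hz fv(1)] fv(2) using exL spans_0 by blast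
  have "d = length us" using Suc.hyps(2) xs by simp
  from Suc.hyps(1)[OF this hz mu mv] show ?case
    using exK exL by (simp add: xs ys fu(3) fv(2) K_def L_def)
qed

lemma ideal_gen_list:
  assumes "G \<subseteq> poly_ring S" "set zs \<subseteq> poly_ring S"
  shows "ideal_gen S (G \<union> set zs) = foldl (adjoin S) (ideal_gen S G) zs"
  using assms
proof (induction zs arbitrary: G)
  case (Cons z zs)
  then show ?case using Cons.IH[of "insert z G"] by (simp add: ideal_gen_insert)
qed simp

text \<open>The ideal of the whole sequence is proper because it stays inside
  \<open>max_ideal S\<close>; the remaining conditions unfold entry by entry.\<close>

lemma hom_regular_seq_iff:
  fixes G :: "('v, 'k::field) mpoly set"
  assumes "G \<subseteq> max_ideal S" "\<forall>g\<in>G. homogeneous g"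
  shows "hom_regular_seq S G zs \<longleftrightarrow> reg_seq S (ideal_gen S G) zs"
  using assms
proof (induction zs arbitrary: G)
  case Nil
  have "ideal_gen S G \<subseteq> max_ideal S" using ideal_gen_least[OF ideal_in_max Nil(1)] .
  moreover have "1 \<notin> max_ideal S" by (simp add: max_ideal_def)
  ultimately have "ideal_gen S G \<noteq> poly_ring S" using poly_ring_1 by blast
  then show ?case by (simp add: hom_regular_seq_def)
next
  case (Cons z zs)
  have G: "G \<subseteq> poly_ring S" using Cons.prems max_ideal_subset by blast
  have step: "hom_regular_seq S G (z # zs) \<longleftrightarrow> z \<in> max_ideal S \<and> homogeneous z \<and>
      regular_on S (ideal_gen S G) z \<and> hom_regular_seq S (insert z G) zs"
    by (auto simp: hom_regular_seq_def regular_on_def All_less_Suc2)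
  show ?case
  proof (cases "z \<in> max_ideal S \<and> homogeneous z")
    case True
    then have "ideal_gen S (insert z G) = adjoin S (ideal_gen S G) z"
      using ideal_gen_insert[OF G] max_ideal_subset by blast
    then show ?thesis using step Cons.IH[of "insert z G"] Cons.prems True by simp
  qed (use step in auto)
qed

text \<open>The nonzero socle makes \<open>zs\<close> maximal. This pins down the value under
  \<open>THE\<close>, which is uniquely determined because one maximal sequence exists and all of
  them agree.\<close>

theorem cm_type_eq:
  fixes G :: "('v, 'k::field) mpoly set"
  assumes S: "finite S" and G: "G \<subseteq> max_ideal S" "\<forall>g\<in>G. homogeneous g"
    and zs: "hom_regular_seq S G zs" and soc: "\<not> socle S (ideal_gen S (G \<union> set zs)) \<subseteq> ideal_gen S (G \<union> set zs)"
  shows "cm_type S G = quot_dim (socle S (ideal_gen S (G \<union> set zs))) (ideal_gen S (G \<union> set zs))"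
proof -
  have GR: "G \<subseteq> poly_ring S" using G max_ideal_subset by blast
  have h: "hom_ideal S (ideal_gen S G)" using hom_ideal_ideal_gen[OF G] .
  have max: "maximal_hom_regular_seq S G ys \<longleftrightarrow> maximal_reg_seq S (ideal_gen S G) ys" for ys
    by (simp add: maximal_hom_regular_seq_def maximal_reg_seq_def hom_regular_seq_iff[OF G])
  have gen: "ideal_gen S (G \<union> set ys) = foldl (adjoin S) (ideal_gen S G) ys" if "hom_regular_seq S G ys" for ys
    using that max_ideal_subset by (intro ideal_gen_list[OF GR]) (auto simp: hom_regular_seq_def)
  have mz: "maximal_hom_regular_seq S G zs"
    unfolding max maximal_reg_seq_iff[OF S h zs[unfolded hom_regular_seq_iff[OF G]]] using soc gen[OF zs] by simp
  have "quot_dim (socle S (ideal_gen S (G \<union> set ys))) (ideal_gen S (G \<union> set ys)) =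
      quot_dim (socle S (ideal_gen S (G \<union> set zs))) (ideal_gen S (G \<union> set zs))"
    if ys: "maximal_hom_regular_seq S G ys" for ys
  proof -
    have "hom_regular_seq S G ys" using ys by (simp add: maximal_hom_regular_seq_def)
    then show ?thesis
      unfolding quot_dim_spans gen[OF \<open>hom_regular_seq S G ys\<close>] gen[OF zs]
      using spans_socle_independent[OF S h] ys mz unfolding max by metis
  qed
  then show ?thesis
    unfolding cm_type_def socle_def[symmetric] using mz by (intro the_equality) metis+
qed

section \<open>Monomial ideals and depolarization\<close>

definition mon_dvd :: "('v \<Rightarrow>\<^sub>0 nat) \<Rightarrow> ('v \<Rightarrow>\<^sub>0 nat) \<Rightarrow> bool" where
  "mon_dvd g m \<longleftrightarrow> (\<forall>v. lookup g v \<le> lookup m v)"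

definition in_mon :: "('v \<Rightarrow>\<^sub>0 nat) set \<Rightarrow> ('v \<Rightarrow>\<^sub>0 nat) \<Rightarrow> bool" where
  "in_mon M m \<longleftrightarrow> (\<exists>g\<in>M. mon_dvd g m)"

definition mon_ideal :: "'v set \<Rightarrow> ('v \<Rightarrow>\<^sub>0 nat) set \<Rightarrow> ('v, 'k::comm_ring_1) mpoly set" where
  "mon_ideal S M = {p \<in> poly_ring S. \<forall>m\<in>keys p. in_mon M m}"

lemma in_mon_plus: "in_mon M m \<Longrightarrow> in_mon M (t + m)"
  unfolding in_mon_def mon_dvd_def by (fastforce simp: lookup_add intro: trans_le_add2)

lemma ideal_in_mon_ideal: "ideal_in S (mon_ideal S M :: ('v, 'k::comm_ring_1) mpoly set)"
  unfolding ideal_in_def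
proof (intro conjI ballI)
  show "mon_ideal S M \<subseteq> poly_ring S" "0 \<in> mon_ideal S M" by (auto simp: mon_ideal_def poly_ring_0)
  show "a + b \<in> mon_ideal S M" if "a \<in> mon_ideal S M" "b \<in> mon_ideal S M" for a b
    using that keys_add[of a b] by (fastforce simp: mon_ideal_def poly_ring_add)
  show "r * a \<in> mon_ideal S M" if ra: "r \<in> poly_ring S" "a \<in> mon_ideal S M" for r a :: "('v, 'k) mpoly"
  proof -
    have "in_mon M m" if m: "m \<in> keys (r * a)" for m
    proof -
      obtain m1 m2 where "m = m1 + m2" "m2 \<in> keys a" using keys_mult[of r a] m by blast
      then show ?thesis using ra in_mon_plus by (auto simp: mon_ideal_def)
    qed
    then show ?thesis using ra by (auto simp: mon_ideal_def poly_ring_mult)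
  qed
qed

lemma mon_ideal_least:
  fixes J :: "('v, 'k::comm_ring_1) mpoly set"
  assumes J: "ideal_in S J" and M: "\<And>g. g \<in> M \<Longrightarrow> single g 1 \<in> J"
  shows "mon_ideal S M \<subseteq> J"
proof
  fix p :: "('v, 'k) mpoly" assume p: "p \<in> mon_ideal S M"
  have "single m (lookup p m) \<in> J" if m: "m \<in> keys p" for m
  proof -
    obtain g where g: "g \<in> M" "mon_dvd g m" using p m by (auto simp: mon_ideal_def in_mon_def)
    have mg: "m = (m - g) + g"
      using g(2) by (intro poly_mapping_eqI) (simp add: mon_dvd_def lookup_add lookup_minus)
    have "keys m \<subseteq> S" using p m by (auto simp: mon_ideal_def poly_ring_def)
    then have "keys (m - g) \<subseteq> S" using keys_plus_monomial[of "m - g" g] mg by auto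
    then have "single (m - g) (lookup p m) * single g 1 \<in> J"
      using ideal_inD(4)[OF J poly_ring_single M[OF g(1)]] by blast
    then show ?thesis using mg by (simp add: mult_single)
  qed
  then show "p \<in> J" by (subst sum_single[of p]) (intro ideal_in_sum[OF J])
qed

lemma keys_mult_Var: "keys (p * Var v :: ('v, 'k::comm_ring_1) mpoly) = (+) (single v 1) ` keys p"
proof (intro set_eqI iffI)
  fix m assume m: "m \<in> keys (p * Var v)"
  then obtain a b where "a \<in> keys p" "b \<in> keys (Var v :: ('v, 'k) mpoly)" "m = a + b"
    using keys_mult[of p "Var v"] by blast
  then show "m \<in> (+) (single v 1) ` keys p" by (auto simp: Var_def add.commute)
next
  fix m assume "m \<in> (+) (single v 1) ` keys p"
  then show "m \<in> keys (p * Var v)"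
    using lookup_single_mult[of "single v 1" 1 p] by (auto simp: Var_def in_keys_iff mult.commute)
qed

section \<open>Renaming variables in monomials and polynomials\<close>

definition submon :: "('v \<Rightarrow> 'v) \<Rightarrow> ('v \<Rightarrow>\<^sub>0 nat) \<Rightarrow> ('v \<Rightarrow>\<^sub>0 nat)" where
  "submon h m = (\<Sum>v\<in>keys m. single (h v) (lookup m v))"

definition subst :: "('v \<Rightarrow> 'v) \<Rightarrow> ('v, 'k::comm_ring_1) mpoly \<Rightarrow> ('v, 'k) mpoly" where
  "subst h p = (\<Sum>m\<in>keys p. single (submon h m) (lookup p m))"

lemma submon_superset: "finite X \<Longrightarrow> keys m \<subseteq> X \<Longrightarrow> submon h m = (\<Sum>v\<in>X. single (h v) (lookup m v))"
  unfolding submon_def by (rule sum.mono_neutral_left) (auto simp: in_keys_iff)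

lemma submon_add: "submon h (a + b) = submon h a + submon h b"
proof -
  have f: "finite (keys a \<union> keys b)" by simp
  show ?thesis
    using submon_superset[OF f, of a] submon_superset[OF f, of b] submon_superset[OF f, of "a + b"]
    by (simp add: keys_plus_monomial lookup_add single_add sum.distrib)
qed

lemma submon_single: "submon h (single v n) = single (h v) n"
  by (simp add: submon_def)

lemma keys_submon: "keys (submon h m) \<subseteq> h ` keys m"
  unfolding submon_def using keys_sum[of "\<lambda>v. single (h v) (lookup m v)" "keys m"] by (auto split: if_splits)

lemma submon_id:
  assumes "\<And>v. v \<in> keys m \<Longrightarrow> h v = v" shows "submon h m = m"
proof -
  have "submon h m = (\<Sum>v\<in>keys m. single v (lookup m v))"
    unfolding submon_def using assms by (intro sum.cong) auto
  then show ?thesis using sum_single[of m] by simp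
qed

lemma subst_superset: "finite X \<Longrightarrow> keys p \<subseteq> X \<Longrightarrow> subst h p = (\<Sum>m\<in>X. single (submon h m) (lookup p m))"
  unfolding subst_def by (rule sum.mono_neutral_left) (auto simp: in_keys_iff)

lemma subst_add: "subst h (p + q) = subst h p + subst h q"
proof -
  have f: "finite (keys p \<union> keys q)" by simp
  show ?thesis
    using subst_superset[OF f, of p] subst_superset[OF f, of q] subst_superset[OF f, of "p + q"] keys_add[of p q]
    by (simp add: lookup_add single_add sum.distrib)
qed

lemma subst_0: "subst h 0 = 0"
  by (simp add: subst_def)

lemma subst_minus: "subst h (p - q) = subst h p - subst h q"
  using subst_add[of h "p - q" q] by (simp add: algebra_simps)

lemma subst_sum: "subst h (sum f I) = (\<Sum>i\<in>I. subst h (f i))"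
  by (induction I rule: infinite_finite_induct) (auto simp: subst_0 subst_add)

lemma subst_single: "subst h (single m c) = single (submon h m) c"
  by (simp add: subst_def)

lemma subst_Var: "subst h (Var v) = Var (h v)"
  by (simp add: Var_def subst_single submon_single)

lemma subst_mult: "subst h (p * q) = subst h p * subst h q"
proof -
  have "p * q = (\<Sum>m\<in>keys p. single m (lookup p m)) * (\<Sum>n\<in>keys q. single n (lookup q n))"
    by (rule arg_cong2[OF sum_single sum_single])
  then have "subst h (p * q) = subst h (\<Sum>m\<in>keys p. \<Sum>n\<in>keys q. single (m + n) (lookup p m * lookup q n))"
    by (simp add: sum_product mult_single)
  also have "\<dots> = (\<Sum>m\<in>keys p. single (submon h m) (lookup p m)) * (\<Sum>n\<in>keys q. single (submon h n) (lookup q n))"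
    by (simp add: subst_sum subst_single submon_add sum_product mult_single)
  finally show ?thesis by (simp add: subst_def)
qed

lemma keys_subst: "keys (subst h p) \<subseteq> submon h ` keys p"
  unfolding subst_def using keys_sum[of "\<lambda>m. single (submon h m) (lookup p m)" "keys p"] by (auto split: if_splits)

lemma keys_subst_vars: "p \<in> poly_ring S \<Longrightarrow> m \<in> keys (subst h p) \<Longrightarrow> keys m \<subseteq> h ` S"
proof -
  assume p: "p \<in> poly_ring S" and "m \<in> keys (subst h p)"
  then obtain n where n: "n \<in> keys p" "m = submon h n" using keys_subst by fast
  then have "keys m \<subseteq> h ` keys n" using keys_submon by fast
  moreover have "keys n \<subseteq> S" using p n by (simp add: poly_ring_def)
  ultimately show ?thesis by blast
qed

lemma subst_poly_ring: "h ` S \<subseteq> S \<Longrightarrow> p \<in> poly_ring S \<Longrightarrow> subst h p \<in> poly_ring S"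
  using keys_subst_vars[of p S _ h] subset_trans[of _ "h ` S" S] unfolding poly_ring_def by simp

lemma subst_congruent:
  fixes K :: "('v, 'k::comm_ring_1) mpoly set"
  assumes K: "ideal_in S K" and h: "h ` S \<subseteq> S" and diff: "\<And>v. v \<in> S \<Longrightarrow> Var v - Var (h v) \<in> K"
    and f: "f \<in> poly_ring S"
  shows "f - subst h f \<in> K"
proof -
  have mono: "single m c - single (submon h m) c \<in> K" if "keys m \<subseteq> S" for m and c :: 'k
    using that
  proof (induction "tdeg m" arbitrary: m)
    case 0
    then have "m = 0" using tdeg_eq_0_iff[of m] by simp
    then show ?case using ideal_inD(2)[OF K] by (simp add: submon_def)
  next
    case (Suc d)
    then have "m \<noteq> 0" by (auto simp: tdeg_def)
    then obtain v where v: "v \<in> keys m" by fastforce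
    define m' where "m' = m - single v 1"
    have m: "m = m' + single v 1"
      using v by (intro poly_mapping_eqI) (auto simp: m'_def lookup_add lookup_minus lookup_single when_def in_keys_iff)
    have vS: "v \<in> S" "h v \<in> S" "keys m' \<subseteq> S" using v Suc.prems h m keys_plus_monomial[of m' "single v 1"] by auto
    have "tdeg m = tdeg m' + 1" unfolding m tdeg_add by (simp add: tdeg_def)
    then have IH: "single m' c - single (submon h m') c \<in> K" using Suc.hyps vS by simp
    have "keys (submon h m') \<subseteq> S" using keys_submon[of h m'] vS h by blast
    then have R: "single (submon h m') c \<in> poly_ring S" by (rule poly_ring_single)
    have "single m c - single (submon h m) c =
      (single m' c - single (submon h m') c) * Var v + single (submon h m') c * (Var v - Var (h v))"
      by (simp add: m submon_add submon_single Var_def algebra_simps mult_single)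
    then show ?case
      using ideal_inD(3)[OF K ideal_inD(5)[OF K poly_ring_Var[OF vS(1)] IH] ideal_inD(4)[OF K R diff[OF vS(1)]]]
      by simp
  qed
  have "f - subst h f = (\<Sum>m\<in>keys f. single m (lookup f m) - single (submon h m) (lookup f m))"
    by (simp add: sum_subtractf subst_def flip: sum_single)
  then show ?thesis using f mono by (auto simp: poly_ring_def intro!: ideal_in_sum[OF K])
qed

text \<open>Modulo the differences \<open>f\<close> is congruent to \<open>subst h f\<close>, and
  \<open>subst h\<close> kills the differences because \<open>h\<close> is idempotent. Membership
  thereby becomes a test on single monomials.\<close>

lemma mem_ideal_gen_subst:
  fixes f :: "('v, 'k::comm_ring_1) mpoly"
  assumes M: "\<And>g. g \<in> M \<Longrightarrow> keys g \<subseteq> S" and h: "h ` S \<subseteq> S" "\<And>v. v \<in> S \<Longrightarrow> h (h v) = h v"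
    and L: "L \<subseteq> S" "\<And>v. v \<in> S - L \<Longrightarrow> h v = v" and f: "f \<in> poly_ring S"
  shows "f \<in> ideal_gen S ((\<lambda>g. single g 1) ` M \<union> (\<lambda>l. Var l - Var (h l)) ` L) \<longleftrightarrow>
    subst h f \<in> mon_ideal S (submon h ` M)"
proof -
  define G :: "('v, 'k) mpoly set" where "G = (\<lambda>g. single g 1) ` M \<union> (\<lambda>l. Var l - Var (h l)) ` L"
  have hS: "h v \<in> S" if "v \<in> S" for v using h(1) that by blast
  have GR: "G \<subseteq> poly_ring S"
    using M hS L(1) by (auto simp: G_def intro!: poly_ring_single poly_ring_minus poly_ring_Var)
  define K where "K = ideal_gen S G"
  have K: "ideal_in S K" unfolding K_def by (rule ideal_in_ideal_gen[OF GR])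
  have GK: "G \<subseteq> K" unfolding K_def by (rule ideal_gen_superset)
  have diff: "Var v - Var (h v) \<in> K" if "v \<in> S" for v
    using GK L(2)[of v] that ideal_inD(2)[OF K] unfolding G_def by (cases "v \<in> L") auto
  have cong: "f - subst h f \<in> K" if "f \<in> poly_ring S" for f
    using subst_congruent[OF K h(1) _ that] diff by blast
  have "f \<in> K \<longleftrightarrow> subst h f \<in> mon_ideal S (submon h ` M)"
  proof
    define Q :: "('v, 'k) mpoly set" where "Q = {f \<in> poly_ring S. subst h f \<in> mon_ideal S (submon h ` M)}"
    have MI: "ideal_in S (mon_ideal S (submon h ` M) :: ('v, 'k) mpoly set)" by (rule ideal_in_mon_ideal)
    have "ideal_in S Q"
      unfolding ideal_in_def
      by (auto simp: Q_def poly_ring_0 poly_ring_add poly_ring_mult subst_0 subst_add subst_mult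
          intro: ideal_inD(2-4)[OF MI] subst_poly_ring[OF h(1)])
    moreover have "G \<subseteq> Q"
    proof -
      have "single (submon h g) (1 :: 'k) \<in> mon_ideal S (submon h ` M)" if "g \<in> M" for g
      proof -
        have "keys (submon h g) \<subseteq> S" using M[OF that] keys_submon[of h g] hS by blast
        then show ?thesis using that
          by (auto simp: mon_ideal_def in_mon_def mon_dvd_def intro!: poly_ring_single)
      qed
      moreover have "subst h (Var l - Var (h l) :: ('v, 'k) mpoly) = 0" if "l \<in> L" for l
        using h(2) L(1) that by (auto simp: subst_minus subst_Var)
      ultimately show ?thesis
        using GR ideal_inD(2)[OF MI] by (auto simp: G_def Q_def subst_single)
    qed
    ultimately have "K \<subseteq> Q" unfolding K_def by (rule ideal_gen_least)
    then show "f \<in> K \<Longrightarrow> subst h f \<in> mon_ideal S (submon h ` M)" by (auto simp: Q_def)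
  next
    assume s: "subst h f \<in> mon_ideal S (submon h ` M)"
    have "single g' (1 :: 'k) \<in> K" if g': "g' \<in> submon h ` M" for g'
    proof -
      obtain g where g: "g \<in> M" "g' = submon h g" using g' by blast
      have "single g 1 \<in> K" using GK g(1) by (auto simp: G_def)
      moreover have "single g 1 - single g' 1 \<in> K"
        using cong[OF poly_ring_single[OF M[OF g(1)]]] g(2) by (simp add: subst_single)
      ultimately show ?thesis using ideal_inD(7)[OF K, of "single g 1" "single g 1 - single g' 1"] by simp
    qed
    then have "subst h f \<in> K" using mon_ideal_least[OF K] s by blast
    then show "f \<in> K" using ideal_inD(3)[OF K cong[OF f]] by fastforce
  qed
  then show ?thesis by (simp add: K_def G_def)
qed

text \<open>A variable \<open>l\<close> occurring to degree at most one may be identified with \<open>x\<close>: this is one step of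
  undoing a polarization. The coefficients of \<open>f\<close> are killed by moving along the monomials
  \<open>l\<^sup>i x\<^sup>j\<close> of fixed total degree.\<close>

lemma depolarization_regular:
  fixes f :: "('v, 'k::comm_ring_1) mpoly"
  assumes lx: "l \<noteq> x"
    and M1: "\<And>g. g \<in> M \<Longrightarrow> lookup g l \<le> 1"
    and M2: "\<And>g. g \<in> M \<Longrightarrow> lookup g l = 1 \<Longrightarrow> lookup g x \<ge> 1"
    and M3: "\<And>g. g \<in> M \<Longrightarrow> lookup g l = 0 \<Longrightarrow> lookup g x \<le> 1"
    and f: "f \<in> poly_ring S" "f * (Var l - Var x) \<in> mon_ideal S M"
  shows "f \<in> mon_ideal S M"
proof -
  define el ex where "el = single l (1::nat)" and "ex = single x (1::nat)"
  have look: "lookup (el + m) v = lookup m v + (if v = l then 1 else 0)"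
    "lookup (ex + m) v = lookup m v + (if v = x then 1 else 0)" for m v
    by (auto simp: el_def ex_def lookup_add lookup_single)
  have lex: "lookup ex v = (if v = x then 1 else 0)" for v by (simp add: ex_def lookup_single when_def)
  have prod: "f * (Var l - Var x) = single el 1 * f - single ex 1 * f"
    by (simp add: Var_def el_def ex_def algebra_simps)
  have out: "lookup (single el 1 * f) m = lookup (single ex 1 * f) m" if "\<not> in_mon M m" for m
    using f(2) that unfolding prod mon_ideal_def by (auto simp: in_keys_iff lookup_minus)
  have zero: "lookup (single e 1 * f) m = 0" if "e = el \<or> e = ex" "lookup e v = 1" "lookup m v = 0" for e m v
  proof (rule lookup_single_mult_0)
    fix n show "m \<noteq> e + n" using that by (auto simp: lookup_add)
  qed
  \<comment> \<open>When \<open>l m\<close> is outside the ideal, \<open>out\<close> equates the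
    coefficient at \<open>m\<close> with that at \<open>l m / x\<close>, whose exponent of
    \<open>x\<close> is smaller. By \<open>M1\<close> one more factor \<open>l\<close> still leaves
    \<open>l m / x\<close> outside, so the induction continues; without a factor \<open>x\<close>
    the coefficient is zero.\<close>
  have caseA: "lookup f m = 0" if "\<not> in_mon M (el + m)" for m
    using that
  proof (induction "lookup m x" arbitrary: m)
    case 0
    have "lookup (single ex 1 * f) (el + m) = 0"
      using zero[of ex x "el + m"] 0 lx by (simp add: look ex_def)
    then show ?case using out[OF 0(2)] lookup_single_mult[of el 1 f m] by simp
  next
    case (Suc k)
    define m2 where "m2 = (el + m) - ex"
    have m2: "ex + m2 = el + m"
      using Suc.hyps(2) by (intro poly_mapping_eqI) (auto simp: m2_def look lookup_minus lex)
    have m2x: "k = lookup m2 x" using arg_cong[OF m2, of "\<lambda>m. lookup m x"] Suc.hyps(2) lx by (simp add: look)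
    have m2l: "lookup m2 l \<ge> 1" using arg_cong[OF m2, of "\<lambda>m. lookup m l"] lx by (simp add: look)
    have n2: "\<not> in_mon M m2" using in_mon_plus[of M m2 ex] Suc.prems m2 by auto
    have "\<not> in_mon M (el + m2)"
    proof
      assume "in_mon M (el + m2)"
      then obtain g where g: "g \<in> M" "\<And>v. lookup g v \<le> lookup m2 v + (if v = l then 1 else 0)"
        unfolding in_mon_def mon_dvd_def look by blast
      have "lookup g v \<le> lookup m2 v" for v using g(2)[of v] M1[OF g(1)] m2l by (cases "v = l") auto
      then show False using n2 g(1) unfolding in_mon_def mon_dvd_def by blast
    qed
    then have "lookup f m2 = 0" using Suc.hyps(1) m2x by simp
    then have "lookup (single ex 1 * f) (el + m) = 0" using lookup_single_mult[of ex 1 f m2] m2 by simp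
    then show ?case using out[OF Suc.prems] lookup_single_mult[of el 1 f m] by simp
  qed
  have "lookup f m = 0" if m: "\<not> in_mon M m" for m
  proof (cases "in_mon M (el + m)")
    \<comment> \<open>Here \<open>m\<close> is outside the ideal but \<open>l m\<close> is inside,
      so \<open>l\<close> does not divide \<open>m\<close>, and \<open>x\<close> does by
      \<open>M2\<close>. Then \<open>M3\<close> keeps \<open>x m\<close> outside, and
      \<open>out\<close> at \<open>x m\<close> compares the coefficient at \<open>m\<close> with
      zero.\<close>
    case True
    then obtain g where g: "g \<in> M" "\<And>v. lookup g v \<le> lookup m v + (if v = l then 1 else 0)"
      unfolding in_mon_def mon_dvd_def look by blast
    obtain v where "lookup g v > lookup m v" using m g(1) unfolding in_mon_def mon_dvd_def by (meson not_le)
    then have gl: "lookup g l > lookup m l" using g(2)[of v] by (cases "v = l") auto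
    then have ml: "lookup m l = 0" "lookup g l = 1" using M1[OF g(1)] by auto
    then have mx: "lookup m x \<ge> 1" using M2[OF g(1)] g(2)[of x] lx by simp
    have "\<not> in_mon M (ex + m)"
    proof
      assume "in_mon M (ex + m)"
      then obtain g' where g': "g' \<in> M" "\<And>v. lookup g' v \<le> lookup m v + (if v = x then 1 else 0)"
        unfolding in_mon_def mon_dvd_def look by blast
      have "lookup g' l = 0" using g'(2)[of l] ml lx by simp
      then have "lookup g' v \<le> lookup m v" for v using g'(2)[of v] M3[OF g'(1)] mx by (cases "v = x") auto
      then show False using m g'(1) unfolding in_mon_def mon_dvd_def by blast
    qed
    moreover have "lookup (single el 1 * f) (ex + m) = 0"
      using zero[of el l "ex + m"] ml lx by (simp add: look el_def)
    ultimately show ?thesis using out lookup_single_mult[of ex 1 f m] by simp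
  qed (rule caseA)
  then show ?thesis using f(1) by (auto simp: mon_ideal_def in_keys_iff)
qed

text \<open>\<open>\<phi>\<close> is a linear normal form and \<open>Z\<close> collects the
  monomials that vanish in the quotient, so \<open>T\<close> is a basis of \<open>A\<close> modulo
  \<open>B\<close>. For the lower bound the normal forms of a spanning list are projected to the
  coordinates in \<open>T\<close>, where they span as many independent monomials as \<open>T\<close>
  has elements.\<close>

lemma quot_dim_monomial_basis:
  fixes A B :: "('v, 'k::field) mpoly set" and \<phi> :: "('v, 'k) mpoly \<Rightarrow> ('v, 'k) mpoly"
  assumes add: "\<And>p q. \<phi> (p - q) = \<phi> p - \<phi> q" "\<And>c p. \<phi> (Const c * p) = Const c * \<phi> p"
    and T: "finite T" "\<And>t. t \<in> T \<Longrightarrow> single t 1 \<in> A \<and> \<phi> (single t 1) = single t 1"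
    and A: "A \<subseteq> poly_ring S" "\<And>a. a \<in> A \<Longrightarrow> keys (\<phi> a) \<subseteq> T \<union> Z" and TZ: "T \<inter> Z = {}"
    and B: "\<And>f. f \<in> B \<longleftrightarrow> f \<in> poly_ring S \<and> keys (\<phi> f) \<subseteq> Z"
  shows "quot_dim A B = card T"
proof -
  have \<phi>0: "\<phi> 0 = 0" using add(1)[of 0 0] by simp
  have \<phi>add: "\<phi> (p + q) = \<phi> p + \<phi> q" for p q using add(1)[of p "0 - q"] add(1)[of 0 q] \<phi>0 by simp
  have \<phi>sum: "\<phi> (sum f I) = (\<Sum>i\<in>I. \<phi> (f i))" for f and I :: "nat set"
    by (induction I rule: infinite_finite_induct) (auto simp: \<phi>0 \<phi>add)
  have "spans (card T) A B"
  proof -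
    obtain ts where ts: "set ts = T" "distinct ts" using finite_distinct_list[OF T(1)] by blast
    have len: "length ts = card T" using ts distinct_card by metis
    have "a - (\<Sum>i<card T. Const (lookup (\<phi> a) (ts ! i)) * map (\<lambda>t. single t 1) ts ! i) \<in> B" if a: "a \<in> A" for a
    proof -
      define s where "s = (\<Sum>i<card T. Const (lookup (\<phi> a) (ts ! i)) * (single (ts ! i) 1 :: ('v, 'k) mpoly))"
      have tsT: "ts ! i \<in> T" if "i < card T" for i using that len ts nth_mem by metis
      have sR: "s \<in> poly_ring S" unfolding s_def
        using tsT T(2) A(1) by (intro poly_ring_sum poly_ring_mult poly_ring_Const) blast
      have "\<phi> s = s" unfolding s_def \<phi>sum add(2) using T(2) tsT by (intro sum.cong) auto
      have "s = (\<Sum>t\<in>T. Const (lookup (\<phi> a) t) * single t 1)"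
        unfolding s_def by (rule sum.reindex_bij_betw[OF bij_betw_nth[OF ts(2)]]) (use ts len in auto)
      also have "\<dots> = (\<Sum>t\<in>T. single t (lookup (\<phi> a) t))" by (simp add: Const_def mult_single)
      finally have ls: "lookup s m = (if m \<in> T then lookup (\<phi> a) m else 0)" for m
        using T(1) by (simp add: lookup_sum lookup_single when_def sum.delta' if_distrib cong: if_cong)
      have "keys (\<phi> (a - s)) \<subseteq> Z"
      proof
        fix m assume m: "m \<in> keys (\<phi> (a - s))"
        then have "lookup (\<phi> a) m \<noteq> lookup s m" by (simp add: add(1) \<open>\<phi> s = s\<close> in_keys_iff lookup_minus)
        then have "m \<notin> T" "m \<in> keys (\<phi> a)" by (auto simp: ls in_keys_iff split: if_splits)
        then show "m \<in> Z" using A(2)[OF a] by blast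
      qed
      then have "a - s \<in> B" using B sR A(1) a poly_ring_minus by blast
      then show ?thesis using len by (simp add: s_def)
    qed
    then have "\<exists>c. a - (\<Sum>i<card T. Const (c i) * map (\<lambda>t. single t 1) ts ! i) \<in> B" if "a \<in> A" for a
      using that by (intro exI[of _ "\<lambda>i. lookup (\<phi> a) (ts ! i)"]) simp
    moreover have "set (map (\<lambda>t. single t 1) ts) \<subseteq> A" using T(2) ts by auto
    ultimately show ?thesis unfolding spans_def using len
      by (intro exI[of _ "map (\<lambda>t. single t 1) ts"]) simp
  qed
  moreover have "card T \<le> n" if "spans n A B" for n
  proof -
    obtain bs where bs: "length bs = n" "set bs \<subseteq> A"
      "\<And>a. a \<in> A \<Longrightarrow> \<exists>c. a - (\<Sum>i<n. Const (c i) * bs ! i) \<in> B"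
      using \<open>spans n A B\<close> unfolding spans_def by blast
    interpret vs: vector_space "\<lambda>c p :: ('v, 'k) mpoly. Const c * p"
      by standard (auto simp: algebra_simps Const_def single_add mult_single simp flip: mult.assoc)
    define \<pi> where "\<pi> p = (\<Sum>t\<in>T. single t (lookup (\<phi> p) t))" for p
    have l\<pi>: "lookup (\<pi> p) m = (if m \<in> T then lookup (\<phi> p) m else 0)" for p m
      unfolding \<pi>_def using T(1) by (simp add: lookup_sum lookup_single when_def sum.delta' if_distrib cong: if_cong)
    define D :: "('v, 'k) mpoly set" where "D = (\<lambda>t. single t 1) ` T"
    have "D \<subseteq> vs.span (\<pi> ` set bs)"
    proof
      fix d assume "d \<in> D"
      then obtain t where t: "t \<in> T" "d = single t 1" by (auto simp: D_def)
      obtain c where c: "d - (\<Sum>i<n. Const (c i) * bs ! i) \<in> B" using bs(3) T(2) t by blast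
      have "d = (\<Sum>i<n. Const (c i) * \<pi> (bs ! i))"
      proof (rule poly_mapping_eqI)
        fix m
        have \<phi>s: "\<phi> (d - (\<Sum>i<n. Const (c i) * bs ! i)) = d - (\<Sum>i<n. Const (c i) * \<phi> (bs ! i))"
          using T(2) t by (simp add: add \<phi>sum)
        show "lookup d m = lookup (\<Sum>i<n. Const (c i) * \<pi> (bs ! i)) m"
        proof (cases "m \<in> T")
          case True
          then have "m \<notin> keys (\<phi> (d - (\<Sum>i<n. Const (c i) * bs ! i)))" using c B TZ by blast
          then show ?thesis using True
            by (simp add: \<phi>s in_keys_iff lookup_minus lookup_sum lookup_Const_mult l\<pi>)
        next
          case False
          then show ?thesis using t by (auto simp: lookup_sum lookup_Const_mult l\<pi> lookup_single when_def)
        qed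
      qed
      then show "d \<in> vs.span (\<pi> ` set bs)"
        using bs(1) by (simp only:) (intro vs.span_sum vs.span_scale vs.span_base imageI, simp)
    qed
    moreover have "vs.independent D"
    proof -
      have inj: "inj_on (\<lambda>t. single t (1::'k)) T"
        by (rule inj_onI) (metis keys_single one_neq_zero singleton_inject)
      have "u t = 0" if sum: "(\<Sum>t\<in>T. Const (u t) * single t 1) = 0" and t: "t \<in> T" for u :: "_ \<Rightarrow> 'k" and t
      proof -
        have "lookup (\<Sum>t\<in>T. Const (u t) * single t 1) t = u t"
          using T(1) t by (simp add: lookup_sum lookup_Const_mult lookup_single when_def sum.delta' if_distrib cong: if_cong)
        then show ?thesis using sum by simp
      qed
      note zero = this
      have "u d = 0" if "(\<Sum>d\<in>D. Const (u d) * d) = 0" "d \<in> D" for u d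
        using zero[of "\<lambda>t. u (single t 1)"] that by (auto simp: D_def sum.reindex[OF inj])
      then show ?thesis using T(1) by (auto simp: vs.dependent_finite D_def)
    qed
    ultimately have "card D \<le> card (\<pi> ` set bs)" using vs.independent_span_bound[of "\<pi> ` set bs" D] by simp
    also have "\<dots> \<le> n" using bs(1) card_image_le[of "set bs" \<pi>] card_length[of bs] by simp
    also have "card D = card T" unfolding D_def
      by (rule card_image, rule inj_onI) (metis keys_single one_neq_zero singleton_inject)
    finally show ?thesis .
  qed
  ultimately show ?thesis unfolding quot_dim_spans by (rule Least_equality)
qed

lemma socle_iff_Var:
  assumes J: "ideal_in S J"
  shows "f \<in> socle S J \<longleftrightarrow> f \<in> poly_ring S \<and> (\<forall>v\<in>S. f * Var v \<in> J)"
proof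
  assume f: "f \<in> poly_ring S \<and> (\<forall>v\<in>S. f * Var v \<in> J)"
  have "max_ideal S \<subseteq> annihilator S J f"
    using f by (intro max_ideal_least[OF ideal_in_annihilator[OF J]])
      (auto simp: annihilator_def poly_ring_Var mult.commute)
  then show "f \<in> socle S J" using f by (auto simp: socle_def colon_def annihilator_def mult.commute)
qed (auto dest: socleD max_ideal_Var)

section \<open>Hyperedges grafted with blocks of variables\<close>

definition ind_mon :: "'v set \<Rightarrow> ('v \<Rightarrow>\<^sub>0 nat)" where
  "ind_mon U = (\<Sum>u\<in>U. single u 1)"

lemma lookup_ind_mon: "finite U \<Longrightarrow> lookup (ind_mon U) v = (if v \<in> U then 1 else 0)"
  by (simp add: ind_mon_def lookup_sum lookup_single when_def sum.delta' if_distrib cong: if_cong)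

lemma keys_ind_mon: "finite U \<Longrightarrow> keys (ind_mon U) = U"
  by (auto simp: in_keys_iff lookup_ind_mon split: if_splits)

lemma monomial_prod_eq: "monomial_prod U = (single (ind_mon U) 1 :: ('v, 'k::comm_ring_1) mpoly)"
  unfolding monomial_prod_def ind_mon_def
  by (induction U rule: infinite_finite_induct) (auto simp: Var_def mult_single)

lemma lookup_submon_ind_mon:
  assumes "finite U" shows "lookup (submon h (ind_mon U)) u = card {w \<in> U. h w = u}"
proof -
  have "submon h (ind_mon U) = (\<Sum>w\<in>U. single (h w) 1)"
    unfolding submon_superset[OF assms, of "ind_mon U" h, unfolded keys_ind_mon[OF assms], OF subset_refl]
    by (intro sum.cong) (simp_all add: lookup_ind_mon assms)
  then have "lookup (submon h (ind_mon U)) u = (\<Sum>w\<in>U. if h w = u then 1 else 0)"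
    by (simp add: lookup_sum lookup_single when_def del: One_nat_def)
  also have "\<dots> = card {w \<in> U. h w = u}"
    using assms by (simp add: sum.If_cases Int_def)
  finally show ?thesis .
qed

text \<open>Minimality is stated by private hyperedges; for empty \<open>F\<close> only the empty
  set is left, in agreement with the case that no vertex has height 3.\<close>

definition minimal_hitting_sets :: "'v set \<Rightarrow> 'v set set \<Rightarrow> 'v set set" where
  "minimal_hitting_sets X F = {U. U \<subseteq> X \<and> (\<forall>f\<in>F. f \<inter> U \<noteq> {}) \<and> (\<forall>v\<in>U. \<exists>f\<in>F. f \<inter> U = {v})}"

text \<open>What the algebra retains of the tree: the blocks are the neighbourhoods of the vertices
  of height 1, \<open>x a\<close> is the distinguished vertex of a block, and \<open>F\<close>
  consists of the neighbourhoods of the vertices of height 3.\<close>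

locale block_ideal =
  fixes S :: "'v set" and I :: "'a set" and Bl :: "'a \<Rightarrow> 'v set" and x :: "'a \<Rightarrow> 'v" and F :: "'v set set"
  assumes finite_S: "finite S"
    and cover: "\<Union>(Bl ` I) = S"
    and disjoint: "a \<in> I \<Longrightarrow> b \<in> I \<Longrightarrow> v \<in> Bl a \<Longrightarrow> v \<in> Bl b \<Longrightarrow> a = b"
    and root: "a \<in> I \<Longrightarrow> x a \<in> Bl a"
    and card_block: "a \<in> I \<Longrightarrow> card (Bl a) \<ge> 2"
    and hyperedge: "f \<in> F \<Longrightarrow> f \<subseteq> x ` I" "f \<in> F \<Longrightarrow> f \<noteq> {}"
begin

definition rt :: "'v \<Rightarrow> 'v" where
  "rt v = x (THE a. a \<in> I \<and> v \<in> Bl a)"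

abbreviation "X \<equiv> x ` I"

lemma rt_block: "a \<in> I \<Longrightarrow> v \<in> Bl a \<Longrightarrow> rt v = x a"
  unfolding rt_def using disjoint by (auto intro!: arg_cong[of _ _ x])

lemma block_subset: "a \<in> I \<Longrightarrow> Bl a \<subseteq> S"
  using cover by blast

lemma block_of: assumes "v \<in> S" obtains a where "a \<in> I" "v \<in> Bl a"
  using cover assms by blast

lemma X_subset: "X \<subseteq> S"
  using root block_subset by blast

lemma rt_X: "v \<in> X \<Longrightarrow> rt v = v"
  using rt_block root by auto

lemma rt_in_X: "v \<in> S \<Longrightarrow> rt v \<in> X"
  using rt_block by (auto elim: block_of)

lemma finite_block: "a \<in> I \<Longrightarrow> finite (Bl a)"
  using finite_subset[OF block_subset finite_S] .

lemma finite_X: "finite X"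
  using finite_subset[OF X_subset finite_S] .

lemma finite_hyperedge: "f \<in> F \<Longrightarrow> finite f"
  using finite_subset[OF hyperedge(1) finite_X] .

definition gens :: "('v, 'k::field) mpoly set" where
  "gens = monomial_prod ` (Bl ` I \<union> F)"

definition gen_mons :: "('v \<Rightarrow>\<^sub>0 nat) set" where
  "gen_mons = ind_mon ` (Bl ` I \<union> F)"

lemma gens_eq: "gens = (\<lambda>g. single g 1) ` gen_mons"
  by (simp add: gens_def gen_mons_def image_image monomial_prod_eq)

lemma gen_mons_vars: "g \<in> gen_mons \<Longrightarrow> keys g \<subseteq> S"
proof -
  assume "g \<in> gen_mons"
  then obtain U where U: "U \<in> Bl ` I \<union> F" "g = ind_mon U" by (auto simp: gen_mons_def)
  then have "U \<subseteq> S" using block_subset hyperedge(1) X_subset by blast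
  then show ?thesis using U keys_ind_mon[OF finite_subset[OF _ finite_S]] by simp
qed

section \<open>The differences of variables with their roots form a regular sequence\<close>

definition ident :: "'v \<Rightarrow> ('v, 'k::field) mpoly" where
  "ident l = Var l - Var (rt l)"

text \<open>Partial depolarization: variables in \<open>L\<close> are already identified with their
  roots, the others are still free. Each such stage is one step of the regular sequence.\<close>

definition collapse :: "'v set \<Rightarrow> 'v \<Rightarrow> 'v" where
  "collapse L v = (if v \<in> L then rt v else v)"

lemma collapse_in_S: "v \<in> S \<Longrightarrow> collapse L v \<in> S"
  using rt_in_X X_subset by (auto simp: collapse_def)

lemma mem_ideal_collapse:
  assumes L: "L \<subseteq> S - X" and f: "(f :: ('v, 'k::field) mpoly) \<in> poly_ring S"
  shows "f \<in> ideal_gen S (gens \<union> ident ` L) \<longleftrightarrow>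
    subst (collapse L) f \<in> mon_ideal S (submon (collapse L) ` gen_mons)"
proof -
  have eq: "ident ` L = (\<lambda>l. Var l - Var (collapse L l) :: ('v, 'k) mpoly) ` L"
    by (intro image_cong) (auto simp: ident_def collapse_def)
  have idem: "collapse L (collapse L v) = collapse L v" if "v \<in> S" for v
    using rt_in_X[OF that] L by (auto simp: collapse_def)
  show ?thesis
    unfolding gens_eq eq
  proof (rule mem_ideal_gen_subst[OF gen_mons_vars _ idem _ _ f])
    show "collapse L ` S \<subseteq> S" using collapse_in_S by blast
  qed (use L in \<open>auto simp: collapse_def\<close>)
qed

lemma lookup_collapsed_block:
  assumes L: "L \<subseteq> S - X" and a: "a \<in> I" and u: "u \<in> S - L"
  shows "lookup (submon (collapse L) (ind_mon (Bl a))) u =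
    (if u = x a then card {w \<in> Bl a. w \<in> L \<or> w = x a} else if u \<in> Bl a then 1 else 0)"
proof -
  have "{w \<in> Bl a. collapse L w = u} =
    (if u = x a then {w \<in> Bl a. w \<in> L \<or> w = x a} else if u \<in> Bl a then {u} else {})"
    using rt_block[OF a] rt_in_X a u root[OF a] L by (auto simp: collapse_def)
  then show ?thesis using lookup_submon_ind_mon[OF finite_block[OF a], of "collapse L" u] by simp
qed

lemma collapsed_hyperedge: "L \<subseteq> S - X \<Longrightarrow> f \<in> F \<Longrightarrow> submon (collapse L) (ind_mon f) = ind_mon f"
  using hyperedge(1)[of f] keys_ind_mon[OF finite_hyperedge, of f]
  by (intro submon_id) (auto simp: collapse_def)

text \<open>At every stage the block of \<open>l\<close> contains \<open>l\<close> once and the root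
  of \<open>l\<close> at least once, while every other generator omits \<open>l\<close> and contains
  that root at most once. These are the hypotheses of \<open>depolarization_regular\<close>.\<close>

lemma ident_regular:
  assumes L: "L \<subseteq> S - X" and l: "l \<in> S - X" "l \<notin> L"
  shows "regular_on S (ideal_gen S (gens \<union> ident ` L)) (ident l :: ('v, 'k::field) mpoly)"
  unfolding regular_on_def
proof (intro ballI impI)
  fix f :: "('v, 'k) mpoly"
  assume f: "f \<in> poly_ring S" "f * ident l \<in> ideal_gen S (gens \<union> ident ` L)"
  let ?M = "submon (collapse L) ` gen_mons"
  have lS: "l \<in> S" using l by simp
  have rl: "rt l \<in> X" "l \<noteq> rt l" using rt_in_X[OF lS] l by auto
  obtain b where b: "b \<in> I" "l \<in> Bl b" using block_of[OF lS] by blast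
  then have rtl: "rt l = x b" using rt_block by blast
  have u: "l \<in> S - L" "rt l \<in> S - L" using l rl L X_subset by auto
  have idR: "ident l \<in> poly_ring S" using lS rl(1) X_subset
    by (auto simp: ident_def intro!: poly_ring_minus poly_ring_Var)
  have "subst (collapse L) (f * ident l) = subst (collapse L) f * (Var l - Var (rt l))"
    using l rl L by (auto simp: subst_mult ident_def subst_minus subst_Var collapse_def)
  then have prod: "subst (collapse L) f * (Var l - Var (rt l)) \<in> mon_ideal S ?M"
    using mem_ideal_collapse[OF L poly_ring_mult[OF f(1) idR]] f(2) by simp
  have cases: "(lookup g l = 1 \<and> lookup g (rt l) \<ge> 1) \<or> (lookup g l = 0 \<and> lookup g (rt l) \<le> 1)" if "g \<in> ?M" for g
  proof -
    obtain U where U: "U \<in> Bl ` I \<union> F" "g = submon (collapse L) (ind_mon U)"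
      using \<open>g \<in> ?M\<close> by (auto simp: gen_mons_def)
    show ?thesis
    proof (cases "U \<in> F")
      case True
      then show ?thesis using U l collapsed_hyperedge[OF L True] finite_hyperedge[OF True] hyperedge(1)[OF True]
        by (auto simp: lookup_ind_mon)
    next
      case False
      then obtain a where a: "a \<in> I" "U = Bl a" using U by blast
      note look = lookup_collapsed_block[OF L a(1)]
      have lx: "l \<noteq> x a" using l a(1) by auto
      show ?thesis
      proof (cases "a = b")
        case True
        have "{x a} \<subseteq> {w \<in> Bl a. w \<in> L \<or> w = x a}" using root[OF a(1)] by auto
        then have "card {x a} \<le> card {w \<in> Bl a. w \<in> L \<or> w = x a}"
          using finite_block[OF a(1)] by (intro card_mono) auto
        then show ?thesis using look[OF u(1)] look[OF u(2)] U(2) a b rtl True lx by simp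
      next
        case False
        then have "l \<notin> Bl a" "x b \<notin> Bl a" using disjoint a b root by blast+
        moreover have "x b \<noteq> x a" using root[OF a(1)] calculation(2) by auto
        ultimately show ?thesis using look[OF u(1)] look[OF u(2)] U(2) a rtl lx by simp
      qed
    qed
  qed
  have "subst (collapse L) f \<in> mon_ideal S ?M"
  proof (rule depolarization_regular[OF rl(2) _ _ _ _ prod])
    show "subst (collapse L) f \<in> poly_ring S"
      using f(1) collapse_in_S by (intro subst_poly_ring) auto
  qed (use cases in force)+
  then show "f \<in> ideal_gen S (gens \<union> ident ` L)" using mem_ideal_collapse[OF L f(1)] by simp
qed

lemma gens_max_ideal: "gens \<subseteq> max_ideal S" "g \<in> gens \<Longrightarrow> homogeneous g"
proof -
  show "homogeneous g" if "g \<in> gens" for g :: "('v, 'k::field) mpoly"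
    using that by (auto simp: gens_eq homogeneous_def)
  show "gens \<subseteq> max_ideal S"
  proof
    fix g :: "('v, 'k::field) mpoly" assume "g \<in> gens"
    then obtain U where U: "U \<in> Bl ` I \<union> F" "g = single (ind_mon U) 1" by (auto simp: gens_def monomial_prod_eq)
    have "finite U" "U \<noteq> {}" using U finite_block root finite_hyperedge hyperedge(2) by blast+
    then have "ind_mon U \<noteq> 0" using keys_ind_mon[of U] by auto
    moreover have "keys (ind_mon U) \<subseteq> S" using gen_mons_vars U by (auto simp: gen_mons_def)
    ultimately show "g \<in> max_ideal S"
      using U by (simp add: max_ideal_def poly_ring_single lookup_single when_def)
  qed
qed

lemma ident_max_ideal: "l \<in> S \<Longrightarrow> ident l \<in> max_ideal S" "homogeneous (ident l)"
proof -
  show "homogeneous (ident l :: ('v, 'k::field) mpoly)"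
    unfolding homogeneous_iff ident_def hom_deg_def
    using keys_minus_subset[of "Var l :: ('v, 'k) mpoly" "Var (rt l)"]
    by (intro exI[of _ 1]) (auto simp: Var_def tdeg_def)
  assume "l \<in> S"
  then show "ident l \<in> max_ideal S"
    using max_ideal_Var[of l S] max_ideal_Var[of "rt l" S] rt_in_X X_subset ideal_inD(7)[OF ideal_in_max]
    unfolding ident_def by blast
qed

lemma ident_regular_seq:
  assumes ls: "distinct ls" "set ls = S - X"
  shows "hom_regular_seq S gens (map ident ls :: ('v, 'k::field) mpoly list)"
  unfolding hom_regular_seq_def
proof (intro conjI allI impI)
  show sub: "set (map ident ls :: ('v, 'k) mpoly list) \<subseteq> max_ideal S" using ls ident_max_ideal(1) by auto
  show "\<forall>t\<in>set (map ident ls :: ('v, 'k) mpoly list). homogeneous t" using ident_max_ideal(2) by auto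
  have "ideal_gen S (gens \<union> set (map ident ls)) \<subseteq> (max_ideal S :: ('v, 'k) mpoly set)"
    using ideal_gen_least[OF ideal_in_max] sub gens_max_ideal(1) by (metis Un_least)
  moreover have "(1 :: ('v, 'k) mpoly) \<notin> max_ideal S" by (simp add: max_ideal_def)
  ultimately show "ideal_gen S (gens \<union> set (map ident ls)) \<noteq> (poly_ring S :: ('v, 'k) mpoly set)"
    using poly_ring_1 by blast
  fix i assume "i < length (map ident ls :: ('v, 'k) mpoly list)"
  then have i: "i < length ls" by simp
  have "set (take i ls) \<subseteq> S - X" using ls(2) set_take_subset by fastforce
  moreover have "ls ! i \<notin> set (take i ls)" using ls(1) i by (auto simp: in_set_conv_nth nth_eq_iff_index_eq)
  moreover have "ls ! i \<in> S - X" using ls(2) i nth_mem by blast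
  ultimately have "regular_on S (ideal_gen S (gens \<union> ident ` set (take i ls))) (ident (ls ! i) :: ('v, 'k) mpoly)"
    by (intro ident_regular)
  then show "\<forall>f\<in>poly_ring S. f * map ident ls ! i \<in> ideal_gen S (gens \<union> set (take i (map ident ls))) \<longrightarrow>
      f \<in> ideal_gen S (gens \<union> set (take i (map ident ls) :: ('v, 'k) mpoly list))"
    using i by (simp add: regular_on_def take_map)
qed

section \<open>The Artinian reduction and its socle monomials\<close>

definition mult_at :: "'v \<Rightarrow> nat" where
  "mult_at v = card {w \<in> S. rt w = v}"

definition art_mons :: "('v \<Rightarrow>\<^sub>0 nat) set" where
  "art_mons = submon (collapse (S - X)) ` gen_mons"

lemma mult_at_root: "a \<in> I \<Longrightarrow> mult_at (x a) = card (Bl a)"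
proof -
  assume a: "a \<in> I"
  have "{w \<in> S. rt w = x a} = Bl a"
  proof (intro set_eqI iffI)
    fix w assume w: "w \<in> {w \<in> S. rt w = x a}"
    then obtain b where b: "b \<in> I" "w \<in> Bl b" using block_of by blast
    then have "x b = x a" using w rt_block by auto
    then have "a = b" using disjoint[OF a b(1)] root[OF a] root[OF b(1)] by simp
    then show "w \<in> Bl a" using b by simp
  qed (use a block_subset rt_block in auto)
  then show ?thesis by (simp add: mult_at_def)
qed

lemma mult_at_ge_2: "v \<in> X \<Longrightarrow> mult_at v \<ge> 2"
  using mult_at_root card_block by auto

lemma in_art_mons:
  assumes "keys m \<subseteq> X"
  shows "in_mon art_mons m \<longleftrightarrow> (\<exists>v\<in>X. mult_at v \<le> lookup m v) \<or> (\<exists>f\<in>F. f \<subseteq> keys m)"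
proof -
  have block: "mon_dvd (submon (collapse (S - X)) (ind_mon (Bl a))) m \<longleftrightarrow> mult_at (x a) \<le> lookup m (x a)"
    if a: "a \<in> I" for a
  proof -
    have "collapse (S - X) w = x a" if w: "w \<in> Bl a" for w
    proof -
      have "collapse (S - X) w = rt w" using w block_subset[OF a] rt_X[of w] by (auto simp: collapse_def)
      then show ?thesis using rt_block[OF a w] by simp
    qed
    then have "{w \<in> Bl a. collapse (S - X) w = u} = (if u = x a then Bl a else {})" for u
      by auto
    then have "lookup (submon (collapse (S - X)) (ind_mon (Bl a))) u = (if u = x a then card (Bl a) else 0)" for u
      using lookup_submon_ind_mon[OF finite_block[OF a], of "collapse (S - X)" u] by simp
    then show ?thesis using mult_at_root[OF a] by (auto simp: mon_dvd_def)
  qed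
  have edge: "mon_dvd (submon (collapse (S - X)) (ind_mon f)) m \<longleftrightarrow> f \<subseteq> keys m" if f: "f \<in> F" for f
    unfolding collapsed_hyperedge[OF subset_refl f]
    by (auto simp: mon_dvd_def lookup_ind_mon[OF finite_hyperedge[OF f]] in_keys_iff Suc_le_eq)
  have "in_mon art_mons m \<longleftrightarrow> (\<exists>U\<in>Bl ` I \<union> F. mon_dvd (submon (collapse (S - X)) (ind_mon U)) m)"
    by (simp add: in_mon_def art_mons_def gen_mons_def)
  also have "\<dots> \<longleftrightarrow> (\<exists>a\<in>I. mult_at (x a) \<le> lookup m (x a)) \<or> (\<exists>f\<in>F. f \<subseteq> keys m)"
    using block edge by blast
  finally show ?thesis by auto
qed

definition socle_mons :: "('v \<Rightarrow>\<^sub>0 nat) set" where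
  "socle_mons = {m. keys m \<subseteq> X \<and> \<not> in_mon art_mons m \<and> (\<forall>v\<in>X. in_mon art_mons (single v 1 + m))}"

definition top_mon :: "'v set \<Rightarrow> ('v \<Rightarrow>\<^sub>0 nat)" where
  "top_mon U = (\<Sum>v\<in>X - U. single v (mult_at v - 1))"

lemma lookup_top_mon: "lookup (top_mon U) v = (if v \<in> X - U then mult_at v - 1 else 0)"
  unfolding top_mon_def using finite_X
  by (simp add: lookup_sum lookup_single when_def sum.delta' if_distrib cong: if_cong)

lemma keys_top_mon: "keys (top_mon U) = X - U"
  using mult_at_ge_2 by (fastforce simp: in_keys_iff lookup_top_mon split: if_splits)

lemma keys_single_plus:
  "keys (single v 1 + m :: 'v \<Rightarrow>\<^sub>0 nat) = insert v (keys m)"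
  "keys (single v (Suc 0) + m) = insert v (keys m)"
  by (simp_all add: keys_plus_monomial)

lemma lookup_single_plus:
  "lookup (single v (Suc 0) + m) u = (if u = v then Suc (lookup m u) else lookup m u)"
  by (simp add: lookup_add lookup_single when_def)

text \<open>Multiplying a socle monomial by \<open>v\<close> enters the ideal either through the
  pure power, so \<open>v\<close> has exponent \<open>mult_at v - 1\<close>, or through a hyperedge
  that lacked only \<open>v\<close>, so \<open>v\<close> has exponent 0. The variables with exponent
  0 thus form a hitting set with private hyperedges, and they determine the monomial.\<close>

lemma bij_socle_mons: "bij_betw top_mon (minimal_hitting_sets X F) socle_mons"
proof (rule bij_betw_imageI)
  show "inj_on top_mon (minimal_hitting_sets X F)"
  proof (rule inj_onI)
    fix U U' assume UU: "U \<in> minimal_hitting_sets X F" "U' \<in> minimal_hitting_sets X F" "top_mon U = top_mon U'"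
    then have "X - U = X - U'" using keys_top_mon by metis
    then show "U = U'" using UU by (auto simp: minimal_hitting_sets_def)
  qed
  show "top_mon ` minimal_hitting_sets X F = socle_mons"
  proof (intro set_eqI iffI)
    fix m assume "m \<in> top_mon ` minimal_hitting_sets X F"
    then obtain U where U: "U \<subseteq> X" "\<And>f. f \<in> F \<Longrightarrow> f \<inter> U \<noteq> {}" "\<And>v. v \<in> U \<Longrightarrow> \<exists>f\<in>F. f \<inter> U = {v}" "m = top_mon U"
      by (auto simp: minimal_hitting_sets_def)
    have km: "keys m = X - U" using U(4) keys_top_mon by simp
    have "\<not> in_mon art_mons m"
      using in_art_mons[of m] km U(2,4) mult_at_ge_2 by (fastforce simp: lookup_top_mon split: if_splits)
    moreover have "in_mon art_mons (single v 1 + m)" if v: "v \<in> X" for v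
    proof -
      have k: "keys (single v 1 + m) \<subseteq> X" using km v by (auto simp: keys_single_plus)
      show ?thesis
      proof (cases "v \<in> U")
        case True
        then obtain f where f: "f \<in> F" "f \<inter> U = {v}" using U(3) by blast
        then have "f \<subseteq> keys (single v 1 + m)" using hyperedge(1)[OF f(1)] km by (auto simp: keys_single_plus)
        then show ?thesis using in_art_mons[OF k] f(1) by blast
      next
        case False
        then have "mult_at v \<le> lookup (single v 1 + m) v"
          using v U(4) by (auto simp: lookup_single_plus lookup_top_mon)
        then show ?thesis using in_art_mons[OF k] v by blast
      qed
    qed
    ultimately show "m \<in> socle_mons" using km by (auto simp: socle_mons_def)
  next
    fix m assume "m \<in> socle_mons"
    then have m: "keys m \<subseteq> X" "\<not> in_mon art_mons m" "\<And>v. v \<in> X \<Longrightarrow> in_mon art_mons (single v 1 + m)"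
      by (auto simp: socle_mons_def)
    have lt: "lookup m v < mult_at v" if "v \<in> X" for v using m(2) in_art_mons[OF m(1)] that not_le by blast
    have nf: "\<not> f \<subseteq> keys m" if "f \<in> F" for f using m(2) in_art_mons[OF m(1)] that by blast
    have step: "lookup m v = mult_at v - 1 \<or> (\<exists>f\<in>F. f \<subseteq> insert v (keys m))" if v: "v \<in> X" for v
    proof -
      have k: "keys (single v 1 + m) \<subseteq> X" using m(1) v by (auto simp: keys_single_plus)
      consider u where "u \<in> X" "mult_at u \<le> lookup (single v 1 + m) u" | f where "f \<in> F" "f \<subseteq> insert v (keys m)"
        using m(3)[OF v] unfolding in_art_mons[OF k] keys_single_plus by blast
      then show ?thesis
      proof cases
        case 1
        have "mult_at u \<le> (if u = v then Suc (lookup m u) else lookup m u)"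
          using 1(2) by (simp add: lookup_single_plus)
        then have "lookup m v = mult_at v - 1" using lt[OF 1(1)] by (cases "u = v") simp_all
        then show ?thesis ..
      next
        case 2
        then show ?thesis by auto
      qed
    qed
    define U where "U = X - keys m"
    have "U \<in> minimal_hitting_sets X F"
      unfolding minimal_hitting_sets_def
    proof (intro CollectI conjI ballI)
      show "U \<subseteq> X" by (auto simp: U_def)
      show "f \<inter> U \<noteq> {}" if "f \<in> F" for f using nf[OF that] hyperedge(1)[OF that] by (auto simp: U_def)
      show "\<exists>f\<in>F. f \<inter> U = {v}" if v: "v \<in> U" for v
      proof -
        have vX: "v \<in> X" "lookup m v = 0" using v by (auto simp: U_def in_keys_iff)
        \<comment> \<open>Since \<open>mult_at v\<close> is at least 2, exponent 0 is not the top
          exponent, and only the hyperedge alternative of \<open>step\<close> is left.\<close>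
        then have "lookup m v \<noteq> mult_at v - 1" using mult_at_ge_2[of v] by simp
        then obtain f where f: "f \<in> F" "f \<subseteq> insert v (keys m)" using step[OF vX(1)] by blast
        then have "f \<inter> U = {v}" using nf[OF f(1)] v by (auto simp: U_def)
        then show ?thesis using f(1) by blast
      qed
    qed
    moreover have "m = top_mon U"
    proof (rule poly_mapping_eqI)
      fix v
      show "lookup m v = lookup (top_mon U) v"
      proof (cases "v \<in> keys m")
        case True
        then have "insert v (keys m) = keys m" by blast
        then have "lookup m v = mult_at v - 1" using step[of v] nf True m(1) by auto
        then show ?thesis using True m(1) by (auto simp: lookup_top_mon U_def)
      qed (auto simp: lookup_top_mon U_def in_keys_iff)
    qed
    ultimately show "m \<in> top_mon ` minimal_hitting_sets X F" by blast
  qed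
qed

text \<open>Provides a nonzero socle element, and with it the maximality of the chosen regular
  sequence.\<close>

lemma minimal_hitting_sets_nonempty: "minimal_hitting_sets X F \<noteq> {}"
proof -
  have "\<exists>v\<in>X. v \<in> f" if "f \<in> F" for f using hyperedge[OF that] by blast
  then obtain Y where Y: "Y \<subseteq> X" "\<forall>f\<in>F. \<exists>v\<in>Y. v \<in> f" "\<forall>v\<in>Y. \<exists>f\<in>F. \<forall>y\<in>Y. y \<in> f \<longleftrightarrow> y = v"
    using minimal_hitting_subset[OF finite_X, of F "\<lambda>f v. v \<in> f"] by auto
  have "\<exists>f\<in>F. f \<inter> Y = {v}" if v: "v \<in> Y" for v
  proof -
    obtain f where "f \<in> F" "\<forall>y\<in>Y. y \<in> f \<longleftrightarrow> y = v" using Y(3) v by blast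
    then show ?thesis using v by (intro bexI[of _ f]) auto
  qed
  then have "Y \<in> minimal_hitting_sets X F" using Y by (auto simp: minimal_hitting_sets_def)
  then show ?thesis by blast
qed

text \<open>Once all variables outside \<open>X\<close> are collapsed, membership in
  \<open>J\<close> and in its socle are both tested monomial by monomial, so
  \<open>socle_mons\<close> is a basis of the socle modulo \<open>J\<close>.\<close>

theorem cm_type_block_ideal:
  "cm_type S (gens :: ('v, 'k::field) mpoly set) = card (minimal_hitting_sets X F)"
proof -
  obtain ls where ls: "distinct ls" "set ls = S - X"
    using finite_distinct_list[of "S - X"] finite_S by blast
  define h where "h = collapse (S - X)"
  define J :: "('v, 'k) mpoly set" where "J = ideal_gen S (gens \<union> set (map ident ls))"
  have JL: "J = ideal_gen S (gens \<union> ident ` (S - X))" using ls by (simp add: J_def)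
  have memJ: "f \<in> J \<longleftrightarrow> f \<in> poly_ring S \<and> (\<forall>m\<in>keys (subst h f). in_mon art_mons m)" for f
  proof -
    have "gens \<union> ident ` (S - X) \<subseteq> (poly_ring S :: ('v, 'k) mpoly set)"
      using gens_max_ideal(1) ident_max_ideal(1) max_ideal_subset by blast
    then have "ideal_in S J" unfolding JL by (rule ideal_in_ideal_gen)
    moreover have "subst h f \<in> poly_ring S" if "f \<in> poly_ring S"
      using that collapse_in_S unfolding h_def by (intro subst_poly_ring) auto
    ultimately show ?thesis
      using mem_ideal_collapse[of "S - X" f] ideal_inD(1)[of S J f]
      by (auto simp: JL h_def art_mons_def mon_ideal_def)
  qed
  have iJ: "ideal_in S J"
    unfolding JL using gens_max_ideal(1) ident_max_ideal(1) max_ideal_subset by (intro ideal_in_ideal_gen) blast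
  have hX: "h v \<in> X" "v \<in> X \<Longrightarrow> h v = v" if "v \<in> S" for v
    using that rt_in_X by (auto simp: h_def collapse_def)
  have hS: "h ` S = X" using hX X_subset by force
  have keysX: "keys m \<subseteq> X" if "f \<in> poly_ring S" "m \<in> keys (subst h f)" for m and f :: "('v, 'k) mpoly"
    using keys_subst_vars[OF that] hS by simp
  have soc: "f \<in> socle S J \<longleftrightarrow> f \<in> poly_ring S \<and> (\<forall>m\<in>keys (subst h f). \<forall>v\<in>X. in_mon art_mons (single v 1 + m))" for f
  proof -
    have "f * Var v \<in> J \<longleftrightarrow> (\<forall>m\<in>keys (subst h f). in_mon art_mons (single (h v) 1 + m))"
      if "v \<in> S" "f \<in> poly_ring S" for v
      using that by (auto simp: memJ poly_ring_mult poly_ring_Var subst_mult subst_Var keys_mult_Var)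
    then have "(\<forall>v\<in>S. f * Var v \<in> J) \<longleftrightarrow> (\<forall>m\<in>keys (subst h f). \<forall>u\<in>h ` S. in_mon art_mons (single u 1 + m))"
      if "f \<in> poly_ring S" using that by (simp only: ball_simps cong: ball_cong) blast
    then show ?thesis unfolding socle_iff_Var[OF iJ] hS by blast
  qed
  have fix_mon: "subst h (single t 1) = single t (1 :: 'k)" "single t (1 :: 'k) \<in> poly_ring S" if "t \<in> socle_mons" for t
  proof -
    have "keys t \<subseteq> X" using that by (simp add: socle_mons_def)
    then have "submon h t = t" "keys t \<subseteq> S" using hX(2) X_subset by (blast intro: submon_id)+
    then show "subst h (single t 1) = single t (1 :: 'k)" "single t (1 :: 'k) \<in> poly_ring S"
      by (simp_all add: subst_single poly_ring_single)
  qed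
  have inA: "single t (1 :: 'k) \<in> socle S J" if t: "t \<in> socle_mons" for t
    unfolding soc using fix_mon[OF t] t by (auto simp: socle_mons_def)
  have "quot_dim (socle S J) J = card socle_mons"
  proof (rule quot_dim_monomial_basis[where \<phi> = "subst h" and Z = "{m. in_mon art_mons m}" and S = S])
    show "subst h (Const c * p) = Const c * subst h p" for c and p :: "('v, 'k) mpoly"
      by (simp add: subst_mult Const_def subst_single submon_def)
    have "finite (minimal_hitting_sets X F)"
      using finite_X by (rule finite_subset[rotated, OF finite_Pow_iff[THEN iffD2]]) (auto simp: minimal_hitting_sets_def)
    then show "finite socle_mons" using bij_betw_finite[OF bij_socle_mons] by simp
    show "socle S J \<subseteq> poly_ring S" using socleD(1) by blast
    show "keys (subst h a) \<subseteq> socle_mons \<union> {m. in_mon art_mons m}" if "a \<in> socle S J" for a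
      using that keysX unfolding soc by (auto simp: socle_mons_def)
    show "f \<in> J \<longleftrightarrow> f \<in> poly_ring S \<and> keys (subst h f) \<subseteq> {m. in_mon art_mons m}" for f
      unfolding memJ by blast
  qed (use inA fix_mon in \<open>auto simp: subst_minus socle_mons_def\<close>)
  also have "card socle_mons = card (minimal_hitting_sets X F)"
    using bij_betw_same_card[OF bij_socle_mons] by simp
  finally have dim: "quot_dim (socle S J) J = card (minimal_hitting_sets X F)" .
  obtain t where t: "t \<in> socle_mons" using minimal_hitting_sets_nonempty bij_socle_mons by (auto simp: bij_betw_def)
  have "single t (1 :: 'k) \<notin> J" using fix_mon[OF t] t by (simp add: memJ socle_mons_def)
  then have ns: "\<not> socle S J \<subseteq> J" using inA[OF t] by blast
  have hom: "\<forall>g\<in>(gens :: ('v, 'k) mpoly set). homogeneous g" using gens_max_ideal(2) by blast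
  show ?thesis
    using cm_type_eq[OF finite_S gens_max_ideal(1) hom ident_regular_seq[OF ls]] ns dim
    unfolding J_def by simp
qed

end

section \<open>The type of the odd neighbourhood ideal\<close>

lemma hom_regular_seq_Var:
  "hom_regular_seq {v} {} [Var v :: ('v, 'k::field) mpoly]"
proof -
  have "regular_on {v} (ideal_gen {v} {}) (Var v :: ('v, 'k) mpoly)"
    unfolding regular_on_def
  proof (intro ballI impI)
    fix f :: "('v, 'k) mpoly" assume "f * Var v \<in> ideal_gen {v} {}"
    then have 0: "f * Var v = 0" by (auto simp: ideal_gen_def)
    have "keys f = {}" using keys_mult_Var[of f v] unfolding 0 by simp
    then have "f = 0" by (rule keys_eq_empty[THEN iffD1])
    then show "f \<in> ideal_gen {v} {}" using ideal_inD(2)[OF ideal_in_ideal_gen[of "{}" "{v}"]] by simp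
  qed
  then show ?thesis
    using hom_regular_seq_iff[of "{}" "{v}" "[Var v :: ('v, 'k) mpoly]"]
    by (simp add: max_ideal_Var homogeneous_Var)
qed

text \<open>The value for the one-vertex tree: a polynomial ring in one variable with the zero
  ideal. Modulo \<open>Var v\<close> only the residue field remains, and it is its own
  socle.\<close>

lemma cm_type_polynomial_ring: "cm_type {v} ({} :: ('v, 'k::field) mpoly set) = 1"
proof -
  let ?m = "max_ideal {v} :: ('v, 'k) mpoly set"
  have gen: "ideal_gen {v} {Var v} = ?m"
  proof
    have V: "Var v \<in> ?m" by (simp add: max_ideal_Var)
    then show "ideal_gen {v} {Var v} \<subseteq> ?m" by (intro ideal_gen_least[OF ideal_in_max]) simp
    have "{Var v} \<subseteq> (poly_ring {v} :: ('v, 'k) mpoly set)" by (simp add: poly_ring_Var)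
    then show "?m \<subseteq> ideal_gen {v} {Var v}"
      using ideal_gen_superset[of "{Var v}" "{v}"]
      by (intro max_ideal_least ideal_in_ideal_gen) auto
  qed
  have soc: "socle {v} ?m = poly_ring {v}"
    using max_ideal_mult by (auto simp: socle_def colon_def)
  have "quot_dim (poly_ring {v}) ?m = card {0 :: 'v \<Rightarrow>\<^sub>0 nat}"
    by (rule quot_dim_monomial_basis[where \<phi> = "\<lambda>p. p" and Z = "- {0}" and S = "{v}"])
      (auto simp: poly_ring_1 max_ideal_def in_keys_iff)
  moreover have "\<not> socle {v} ?m \<subseteq> ?m"
  proof -
    have "1 \<in> (poly_ring {v} :: ('v, 'k) mpoly set)" by (rule poly_ring_1)
    moreover have "1 \<notin> ?m" by (simp add: max_ideal_def)
    ultimately show ?thesis unfolding soc by blast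
  qed
  ultimately show ?thesis
    using cm_type_eq[OF _ _ _ hom_regular_seq_Var[where v = v and 'k = 'k]] gen soc by simp
qed

context unmixed_balanced_tree
begin

text \<open>A TD-set for height 3 may use arbitrary vertices. In a minimal one, however, each
  element alone hits some vertex of height 3, so it lies in the neighbourhood of that vertex and
  hence is one of the \<open>x a\<close>.\<close>

lemma minimal_V3_TD_sets:
  assumes x: "\<And>a. a \<in> Vk V E 1 \<Longrightarrow> x a \<in> nbhd E a \<and> (\<forall>z\<in>Vk V E 3. nbhd E z \<inter> nbhd E a \<subseteq> {x a})"
  shows "minimal_hitting_sets (x ` Vk V E 1) (nbhd E ` Vk V E 3) = {D. minimal_V3_TD_set V E D}"
proof -
  have TD: "V3_TD_set V E D \<longleftrightarrow> D \<subseteq> V \<and> (\<forall>z\<in>Vk V E 3. nbhd E z \<inter> D \<noteq> {})" for D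
  proof -
    have "z \<in> nbhd_set E D \<longleftrightarrow> nbhd E z \<inter> D \<noteq> {}" for z
      unfolding nbhd_set_def using mem_nbhd E_sym by blast
    then show ?thesis by (auto simp: V3_TD_set_def)
  qed
  have nz: "nbhd E z \<subseteq> x ` Vk V E 1" if z: "z \<in> Vk V E 3" for z
  proof
    fix u assume u: "u \<in> nbhd E z"
    have "z \<in> V_odd V E" using z by (simp add: odd_height)
    then have "u \<in> V_even V E" using odd_nbhd u by blast
    then obtain a where "a \<in> Vk V E 1" "u \<in> nbhd E a" using support_block by blast
    then show "u \<in> x ` Vk V E 1" using x[of a] z u by blast
  qed
  have xV: "x ` Vk V E 1 \<subseteq> V" using x nbhd_subset by blast
  have "U \<in> minimal_hitting_sets (x ` Vk V E 1) (nbhd E ` Vk V E 3) \<longleftrightarrow> minimal_V3_TD_set V E U" for U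
  proof
    assume U: "U \<in> minimal_hitting_sets (x ` Vk V E 1) (nbhd E ` Vk V E 3)"
    show "minimal_V3_TD_set V E U"
      unfolding minimal_V3_TD_set_def
    proof (intro conjI allI impI)
      show "V3_TD_set V E U" unfolding TD using U xV by (auto simp: minimal_hitting_sets_def)
      fix D assume "D \<subset> U"
      then obtain v where v: "v \<in> U" "v \<notin> D" "D \<subseteq> U" by blast
      then obtain z where z: "z \<in> Vk V E 3" "nbhd E z \<inter> U = {v}" using U by (auto simp: minimal_hitting_sets_def)
      then have "nbhd E z \<inter> D \<subseteq> {v}" using v(3) by auto
      then have "nbhd E z \<inter> D = {}" using v(2) by auto
      then show "\<not> V3_TD_set V E D" unfolding TD using z(1) by blast
    qed
  next
    assume U: "minimal_V3_TD_set V E U"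
    then have hit: "U \<subseteq> V" "\<And>z. z \<in> Vk V E 3 \<Longrightarrow> nbhd E z \<inter> U \<noteq> {}"
      unfolding minimal_V3_TD_set_def TD by blast+
    have min: "\<exists>z\<in>Vk V E 3. nbhd E z \<inter> U = {v}" if v: "v \<in> U" for v
    proof -
      have "\<not> V3_TD_set V E (U - {v})" using U v unfolding minimal_V3_TD_set_def by blast
      then obtain z where "z \<in> Vk V E 3" "nbhd E z \<inter> (U - {v}) = {}" unfolding TD using hit(1) by blast
      then show ?thesis using hit(2)[of z] by (intro bexI[of _ z]) auto
    qed
    have "U \<subseteq> x ` Vk V E 1"
    proof
      fix v assume "v \<in> U"
      then obtain z where z: "z \<in> Vk V E 3" "nbhd E z \<inter> U = {v}" using min by blast
      then have "v \<in> nbhd E z" by auto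
      then show "v \<in> x ` Vk V E 1" using nz[OF z(1)] by blast
    qed
    then show "U \<in> minimal_hitting_sets (x ` Vk V E 1) (nbhd E ` Vk V E 3)"
      using hit(2) min by (auto simp: minimal_hitting_sets_def)
  qed
  then show ?thesis by blast
qed

lemma cm_type_N_odd:
  "cm_type (V_even V E) (N_odd_gens V E :: ('a, 'k::field) mpoly set) = card {D. minimal_V3_TD_set V E D}"
proof -
  obtain x where x: "\<And>a. a \<in> Vk V E 1 \<Longrightarrow> x a \<in> nbhd E a \<and> (\<forall>z\<in>Vk V E 3. nbhd E z \<inter> nbhd E a \<subseteq> {x a})"
    using support_root by metis
  have odd: "a \<in> V_odd V E" if "a \<in> Vk V E 1 \<or> a \<in> Vk V E 3" for a using that odd_height by blast
  interpret block_ideal "V_even V E" "Vk V E 1" "nbhd E" x "nbhd E ` Vk V E 3"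
  proof
    show "finite (V_even V E)" by (rule finite_even)
    show "\<Union> (nbhd E ` Vk V E 1) = V_even V E"
    proof
      show "\<Union> (nbhd E ` Vk V E 1) \<subseteq> V_even V E" using odd_nbhd odd by blast
      show "V_even V E \<subseteq> \<Union> (nbhd E ` Vk V E 1)" using support_block by blast
    qed
    show "a = b" if "a \<in> Vk V E 1" "b \<in> Vk V E 1" "v \<in> nbhd E a" "v \<in> nbhd E b" for a b v
    proof -
      have "v \<in> V_even V E" using odd_nbhd odd that by blast
      then show ?thesis using support_block[of v] that by blast
    qed
    show "x a \<in> nbhd E a" "2 \<le> card (nbhd E a)" if "a \<in> Vk V E 1" for a
      using x odd_nbhd odd that by blast+
    fix f assume f: "f \<in> nbhd E ` Vk V E 3"
    then obtain z where z: "z \<in> Vk V E 3" "f = nbhd E z" by blast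
    have zo: "nbhd E z \<subseteq> V_even V E" "2 \<le> card (nbhd E z)" using odd_nbhd[of z] odd z by blast+
    show "f \<noteq> {}" using zo z by auto
    show "f \<subseteq> x ` Vk V E 1"
    proof
      fix u assume u: "u \<in> f"
      then obtain a where "a \<in> Vk V E 1" "u \<in> nbhd E a" using support_block[of u] zo z by blast
      then show "u \<in> x ` Vk V E 1" using x[of a] z u by blast
    qed
  qed
  have "gens = (N_odd_gens V E :: ('a, 'k) mpoly set)"
    unfolding gens_def N_odd_gens_def odd_height image_Un image_image ..
  then show ?thesis using cm_type_block_ideal[where 'k = 'k] minimal_V3_TD_sets[OF x] by simp
qed

end

theorem theorem5p12:
  fixes V :: "'v set" and E :: "'v \<Rightarrow> 'v \<Rightarrow> bool"
  assumes "tree V E" and "unmixed V E" and "balanced V E"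
  shows "cm_type (V_even V E) (N_odd_gens V E :: ('v, 'k::field) mpoly set)
         = card {D. minimal_V3_TD_set V E D}"
proof (cases "V_odd V E = {}")
  case False
  then interpret unmixed_balanced_tree V E
    using assms by unfold_locales
  show ?thesis by (rule cm_type_N_odd)
next
  case True
  interpret tree_graph V E using assms(1) by unfold_locales
  \<comment> \<open>Adjacent heights would differ by one, so without odd heights there are no edges.
    The tree is a single vertex, and both sides equal 1, the right one counting just the empty
    set.\<close>
  have even: "even (height E v)" if "v \<in> V" for v using True that by (auto simp: V_odd_def)
  have noE: "\<not> E u v" for u v
  proof
    assume uv: "E u v"
    have "height E u \<noteq> height E v" using assms(3) E_in[OF uv] uv unfolding balanced_def by blast
    then have "height E u = height E v + 1 \<or> height E v = height E u + 1"
      using height_step[OF uv] height_step[OF E_sym[OF uv]] by linarith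
    then show False using even[of u] even[of v] E_in[OF uv] by auto
  qed
  obtain v where v: "v \<in> V" using assms(1) by (auto simp: tree_def connected_graph_def)
  have "u = v" if "u \<in> V" for u
  proof -
    obtain xs where xs: "walk E xs" "hd xs = u" "last xs = v" using walk_exists[OF \<open>u \<in> V\<close> v] by blast
    then show ?thesis using noE by (cases xs; cases "tl xs") auto
  qed
  then have V: "V = {v}" using v by blast
  have V3: "Vk V E 3 = {}" using even by (force simp: Vk_def)
  have "{D. minimal_V3_TD_set V E D} = {{}}"
    by (auto simp: minimal_V3_TD_set_def V3_TD_set_def V3)
  moreover have "V_even V E = {v}" using even V by (auto simp: V_even_def)
  moreover have "N_odd_gens V E = ({} :: ('v, 'k) mpoly set)" by (simp add: N_odd_gens_def True)
  ultimately show ?thesis by (simp add: cm_type_polynomial_ring)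
qed

end
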